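(* Let $X$ be a compact metrizable space, and let $S\subset C(X)$ be a function system which separates the points of $X$. For Borel probability measures $\mu,\nu$ on $X$, the following are equivalent: (i) $\mu\preceq_{\mathrm C}\nu$; (ii) $\mu\preceq_{\mathrm S}\nu$; (iii) $\mu\preceq_{\mathrm{ISD}}\nu$.
   Context: A function system in $C(X)$ (complex continuous functions) is a unital self-adjoint linear subspace; $S_{\mathrm{sa}}$ is its set of real-valued elements. Put $A=C(X)$; since $S$ separates points, $C^*(S)=A$. A Borel probability measure $\mu$ on $X$ is identified with the state $\mu(f)=\int_X f\,d\mu$ of $A$. UCP means unital completely positive; $\mathcal E(A)$ is the state space of $A$ with the weak-$*$ topology; $(\pi_\varphi,H_\varphi,\xi_\varphi)$ is the GNS representation of $\varphi\in\mathcal E(A)$. All relations are associated with the pair $(S,A)$. Abstract Choquet order: let $\mathcal C_S\subset C(X)_{\mathrm{sa}}$ be the uniformly closed max-stable cone generated by $S_{\mathrm{sa}}$, i.e. the norm-closed cone generated by the functions $\max\{s_1,\dots,s_n\}$, $n\ge1$, $s_1,\dots,s_n\in S_{\mathrm{sa}}$. Then $\mu\preceq_{\mathrm C}\nu$ means $\int_X f\,d\mu\le\int_X f\,d\nu$ for all $f\in\mathcal C_S$. Dilation order: for states $\varphi,\psi$ of $A$, $\varphi\preceq_{\mathrm D}\psi$ if there is a UCP map $\Phi:A\to B(H_\varphi)$ with $\Phi(s)=\pi_\varphi(s)$ for all $s\in S$ and $\psi(a)=\langle\Phi(a)\xi_\varphi,\xi_\varphi\rangle$ for all $a\in A$. Strong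 dilation relation: $\varphi\preceq_{\mathrm S}\psi$ if there is such a $\Phi$ with range contained in the bicommutant $\pi_\varphi(A)''$. Barycenter: for a Borel probability measure $m$ on $\mathcal E(A)$, $\mathfrak b(m)(a)=\int_{\mathcal E(A)}\alpha(a)\,dm(\alpha)$, $a\in A$; $\bar m$ denotes the completion of $m$. Integral subdivision relation: $\varphi\preceq_{\mathrm{ISD}}\psi$ if for every Borel probability measure $m$ on $\mathcal E(A)$ with $\mathfrak b(m)=\varphi$ there is a family of states $\alpha\mapsto\psi_\alpha\in\mathcal E(A)$ ($\alpha\in\mathcal E(A)$) such that $\alpha\mapsto\psi_\alpha(a)$ is $\bar m$-measurable for every $a\in A$, $\alpha\preceq_{\mathrm D}\psi_\alpha$ for $\bar m$-almost every $\alpha$, and $\psi(a)=\int_{\mathcal E(A)}\psi_\alpha(a)\,d\bar m(\alpha)$ for all $a\in A$. *)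

theory Defs
  imports "HOL-Probability.Probability"
begin

section \<open>The C*-algebra of continuous functions\<close>

text \<open>
  On a compact space every continuous function is bounded, so there the type
  \<open>'a \<Rightarrow>\<^sub>C complex\<close>, with its supremum norm, is the algebra of all continuous functions.
  The library provides its normed-space structure; the pointwise product is added here.
  Complex scalars act by multiplication with constant functions.
\<close>

setup_lifting type_definition_bcontfun

instantiation bcontfun :: (topological_space, real_normed_algebra_1) real_normed_algebra_1
begin

lift_definition one_bcontfun :: "'a \<Rightarrow>\<^sub>C 'b" is "\<lambda>_. 1"
  by (rule const_bcontfun)

lift_definition times_bcontfun :: "('a \<Rightarrow>\<^sub>C 'b) \<Rightarrow> ('a \<Rightarrow>\<^sub>C 'b) \<Rightarrow> 'a \<Rightarrow>\<^sub>C 'b" is "\<lambda>f g x. f x * g x"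
proof -
  fix f g :: "'a \<Rightarrow> 'b"
  assume f: "f \<in> bcontfun" and g: "g \<in> bcontfun"
  obtain B C where B: "\<And>x. norm (f x) \<le> B" and C: "\<And>x. norm (g x) \<le> C"
    using f g by (auto simp: bcontfun_def bounded_iff)
  have "norm (f x * g x) \<le> B * C" for x
    by (meson B C mult_mono norm_ge_zero norm_mult_ineq order_trans)
  then show "(\<lambda>x. f x * g x) \<in> bcontfun"
    using f g by (auto simp: bcontfun_def intro!: continuous_intros boundedI)
qed

lemmas [simp] = one_bcontfun.rep_eq times_bcontfun.rep_eq

instance
proof
  fix f g :: "'a \<Rightarrow>\<^sub>C 'b"
  have "norm (f x * g x) \<le> norm f * norm g" for x
    by (meson mult_mono norm_bounded norm_ge_zero norm_mult_ineq order_trans)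
  then show "norm (f * g) \<le> norm f * norm g"
    by (intro norm_bound) simp
  show "norm (1 :: 'a \<Rightarrow>\<^sub>C 'b) = 1"
    using norm_bounded[of "1 :: 'a \<Rightarrow>\<^sub>C 'b" undefined] norm_bound[of "1 :: 'a \<Rightarrow>\<^sub>C 'b" 1]
    by simp
  show "(0 :: 'a \<Rightarrow>\<^sub>C 'b) \<noteq> 1"
    by (metis one_bcontfun.rep_eq zero_bcontfun.rep_eq zero_neq_one)
qed (auto intro!: bcontfun_eqI simp: algebra_simps)

end

instance bcontfun :: (topological_space, real_normed_field) comm_ring_1
  by standard (auto intro!: bcontfun_eqI simp: algebra_simps)

lift_definition adj :: "('a::topological_space \<Rightarrow>\<^sub>C complex) \<Rightarrow> 'a \<Rightarrow>\<^sub>C complex"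
  is "\<lambda>f x. cnj (f x)"
  by (auto simp: bcontfun_def bounded_iff intro!: continuous_intros)

definition function_system :: "('a::topological_space \<Rightarrow>\<^sub>C complex) set \<Rightarrow> bool" where
  "function_system S \<longleftrightarrow>
     1 \<in> S \<and> (\<forall>f\<in>S. \<forall>g\<in>S. f + g \<in> S) \<and> (\<forall>c. \<forall>f\<in>S. const_bcontfun c * f \<in> S) \<and>
     (\<forall>f\<in>S. adj f \<in> S)"

definition separates_points :: "('a::topological_space \<Rightarrow>\<^sub>C complex) set \<Rightarrow> bool" where
  "separates_points S \<longleftrightarrow> (\<forall>x y. x \<noteq> y \<longrightarrow> (\<exists>f\<in>S. apply_bcontfun f x \<noteq> apply_bcontfun f y))"

definition real_elements :: "('a::topological_space \<Rightarrow>\<^sub>C complex) set \<Rightarrow> ('a \<Rightarrow>\<^sub>C complex) set" where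
  "real_elements S = {s \<in> S. \<forall>x. apply_bcontfun s x \<in> \<real>}"


section \<open>The abstract Choquet order\<close>

definition maxima :: "('a::topological_space \<Rightarrow>\<^sub>C complex) set \<Rightarrow> ('a \<Rightarrow>\<^sub>C real) set" where
  "maxima S = {f. \<exists>F. finite F \<and> F \<noteq> {} \<and> F \<subseteq> real_elements S \<and>
                 (\<forall>x. apply_bcontfun f x = Max ((\<lambda>s. Re (apply_bcontfun s x)) ` F))}"

definition choquet_cone :: "('a::topological_space \<Rightarrow>\<^sub>C complex) set \<Rightarrow> ('a \<Rightarrow>\<^sub>C real) set" where
  "choquet_cone S = closure (convex_cone hull maxima S)"

definition choquet_le ::
  "('a::topological_space \<Rightarrow>\<^sub>C complex) set \<Rightarrow> 'a measure \<Rightarrow> 'a measure \<Rightarrow> bool" where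
  "choquet_le S \<mu> \<nu> \<longleftrightarrow> (\<forall>f\<in>choquet_cone S. (\<integral>x. apply_bcontfun f x \<partial>\<mu>) \<le> (\<integral>x. apply_bcontfun f x \<partial>\<nu>))"


section \<open>States\<close>

type_synonym 'a functional = "('a \<Rightarrow>\<^sub>C complex) \<Rightarrow> complex"

text \<open>
  The topology of the function type \<open>'a functional\<close> is the product topology, i.e. pointwise
  convergence, so the subspace topology on the following set is the weak-* topology.
\<close>

definition state_space :: "'a::topological_space functional set" where
  "state_space = {\<phi>. (\<forall>a b. \<phi> (a + b) = \<phi> a + \<phi> b) \<and> (\<forall>c a. \<phi> (const_bcontfun c * a) = c * \<phi> a) \<and>
                      (\<forall>a. \<phi> (adj a * a) \<in> \<real>\<^sub>\<ge>\<^sub>0) \<and> \<phi> 1 = 1}"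

definition state_of :: "'a::topological_space measure \<Rightarrow> 'a functional" where
  "state_of \<mu> = (\<lambda>f. \<integral>x. apply_bcontfun f x \<partial>\<mu>)"


section \<open>Operators on complex inner product spaces\<close>

text \<open>
  The Hilbert space of the GNS representation depends on the state, so Hilbert spaces are
  represented by explicit carrier sets. The inner product is linear in its first argument.
  Operators are extensional functions on the carrier, so that equality of operators is
  equality of functions.
\<close>

record 'h inner_space =
  vecs :: "'h set"
  vadd :: "'h \<Rightarrow> 'h \<Rightarrow> 'h"
  vscale :: "complex \<Rightarrow> 'h \<Rightarrow> 'h"
  vinner :: "'h \<Rightarrow> 'h \<Rightarrow> complex"

definition vnorm :: "'h inner_space \<Rightarrow> 'h \<Rightarrow> real" where
  "vnorm H h = sqrt (Re (vinner H h h))"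

definition bounded_ops :: "'h inner_space \<Rightarrow> ('h \<Rightarrow> 'h) set" where
  "bounded_ops H = {T \<in> vecs H \<rightarrow>\<^sub>E vecs H.
     (\<forall>h\<in>vecs H. \<forall>k\<in>vecs H. T (vadd H h k) = vadd H (T h) (T k)) \<and>
     (\<forall>c. \<forall>h\<in>vecs H. T (vscale H c h) = vscale H c (T h)) \<and>
     (\<exists>K. \<forall>h\<in>vecs H. vnorm H (T h) \<le> K * vnorm H h)}"

definition commutant :: "'h inner_space \<Rightarrow> ('h \<Rightarrow> 'h) set \<Rightarrow> ('h \<Rightarrow> 'h) set" where
  "commutant H M = {T \<in> bounded_ops H. \<forall>U\<in>M. \<forall>h\<in>vecs H. T (U h) = U (T h)}"

text \<open>
  Complete positivity is positivity of all matrix amplifications: an element of the \<open>n \<times> n\<close>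
  matrices over the algebra is positive if it is of the form \<open>b\<^sup>* b\<close>, and an \<open>n \<times> n\<close> matrix of
  operators is positive if it is positive as an operator on the \<open>n\<close>-fold direct sum.
\<close>

definition pos_matrix :: "nat \<Rightarrow> (nat \<Rightarrow> nat \<Rightarrow> 'a::topological_space \<Rightarrow>\<^sub>C complex) \<Rightarrow> bool" where
  "pos_matrix n x \<longleftrightarrow> (\<exists>b. \<forall>i<n. \<forall>j<n. x i j = (\<Sum>k<n. adj (b k i) * b k j))"

definition pos_op_matrix :: "'h inner_space \<Rightarrow> nat \<Rightarrow> (nat \<Rightarrow> nat \<Rightarrow> 'h \<Rightarrow> 'h) \<Rightarrow> bool" where
  "pos_op_matrix H n T \<longleftrightarrow>
     (\<forall>h. (\<forall>i<n. h i \<in> vecs H) \<longrightarrow> (\<Sum>i<n. \<Sum>j<n. vinner H (T i j (h j)) (h i)) \<in> \<real>\<^sub>\<ge>\<^sub>0)"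

definition ucp_map ::
  "'h inner_space \<Rightarrow> (('a::topological_space \<Rightarrow>\<^sub>C complex) \<Rightarrow> 'h \<Rightarrow> 'h) \<Rightarrow> bool" where
  "ucp_map H \<Phi> \<longleftrightarrow>
     (\<forall>a. \<Phi> a \<in> bounded_ops H) \<and>
     (\<forall>a b. \<forall>h\<in>vecs H. \<Phi> (a + b) h = vadd H (\<Phi> a h) (\<Phi> b h)) \<and>
     (\<forall>c a. \<forall>h\<in>vecs H. \<Phi> (const_bcontfun c * a) h = vscale H c (\<Phi> a h)) \<and>
     (\<forall>h\<in>vecs H. \<Phi> 1 h = h) \<and>
     (\<forall>n x. pos_matrix n x \<longrightarrow> pos_op_matrix H n (\<lambda>i j. \<Phi> (x i j)))"


section \<open>The GNS representation\<close>

text \<open>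
  The GNS space is the completion of the algebra modulo \<open>{a. \<phi> (a\<^sup>* a) = 0}\<close> with respect to the
  inner product \<open>\<langle>a, b\<rangle> = \<phi> (b\<^sup>* a)\<close>. Quotient and completion are formed in one step: vectors are
  the classes of sequences in the algebra that are Cauchy for the seminorm \<open>\<phi> (a\<^sup>* a)\<^sup>1\<^sup>/\<^sup>2\<close>, two
  sequences being equivalent if the seminorm of their difference tends to \<open>0\<close>.
\<close>

definition gns_seminorm :: "'a::topological_space functional \<Rightarrow> ('a \<Rightarrow>\<^sub>C complex) \<Rightarrow> real" where
  "gns_seminorm \<phi> a = sqrt (Re (\<phi> (adj a * a)))"

definition gns_Cauchy :: "'a::topological_space functional \<Rightarrow> (nat \<Rightarrow> 'a \<Rightarrow>\<^sub>C complex) set" where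
  "gns_Cauchy \<phi> = {u. \<forall>e>0. \<exists>N. \<forall>m\<ge>N. \<forall>n\<ge>N. gns_seminorm \<phi> (u m - u n) < e}"

definition gns_rel ::
  "'a::topological_space functional \<Rightarrow> ((nat \<Rightarrow> 'a \<Rightarrow>\<^sub>C complex) \<times> (nat \<Rightarrow> 'a \<Rightarrow>\<^sub>C complex)) set" where
  "gns_rel \<phi> = {(u, v). u \<in> gns_Cauchy \<phi> \<and> v \<in> gns_Cauchy \<phi> \<and>
                        (\<lambda>n. gns_seminorm \<phi> (u n - v n)) \<longlonglongrightarrow> 0}"

definition gns_class ::
  "'a::topological_space functional \<Rightarrow> (nat \<Rightarrow> 'a \<Rightarrow>\<^sub>C complex) \<Rightarrow> (nat \<Rightarrow> 'a \<Rightarrow>\<^sub>C complex) set" where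
  "gns_class \<phi> u = gns_rel \<phi> `` {u}"

definition gns_space ::
  "'a::topological_space functional \<Rightarrow> (nat \<Rightarrow> 'a \<Rightarrow>\<^sub>C complex) set inner_space" where
  "gns_space \<phi> = \<lparr>
     vecs = gns_Cauchy \<phi> // gns_rel \<phi>,
     vadd = (\<lambda>h k. \<Union>u\<in>h. \<Union>v\<in>k. gns_class \<phi> (\<lambda>n. u n + v n)),
     vscale = (\<lambda>c h. \<Union>u\<in>h. gns_class \<phi> (\<lambda>n. const_bcontfun c * u n)),
     vinner = (\<lambda>h k. THE z. \<exists>u\<in>h. \<exists>v\<in>k. (\<lambda>n. \<phi> (adj (v n) * u n)) \<longlonglongrightarrow> z)\<rparr>"

definition gns_rep ::
  "'a::topological_space functional \<Rightarrow> ('a \<Rightarrow>\<^sub>C complex) \<Rightarrow>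
     (nat \<Rightarrow> 'a \<Rightarrow>\<^sub>C complex) set \<Rightarrow> (nat \<Rightarrow> 'a \<Rightarrow>\<^sub>C complex) set" where
  "gns_rep \<phi> a = (\<lambda>h\<in>vecs (gns_space \<phi>). \<Union>u\<in>h. gns_class \<phi> (\<lambda>n. a * u n))"

definition gns_vec :: "'a::topological_space functional \<Rightarrow> (nat \<Rightarrow> 'a \<Rightarrow>\<^sub>C complex) set" where
  "gns_vec \<phi> = gns_class \<phi> (\<lambda>_. 1)"


section \<open>The dilation relations\<close>

definition dilates ::
  "('a::topological_space \<Rightarrow>\<^sub>C complex) set \<Rightarrow> 'a functional \<Rightarrow> 'a functional \<Rightarrow>
     (('a \<Rightarrow>\<^sub>C complex) \<Rightarrow> (nat \<Rightarrow> 'a \<Rightarrow>\<^sub>C complex) set \<Rightarrow> (nat \<Rightarrow> 'a \<Rightarrow>\<^sub>C complex) set) \<Rightarrow> bool" where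
  "dilates S \<phi> \<psi> \<Phi> \<longleftrightarrow>
     ucp_map (gns_space \<phi>) \<Phi> \<and>
     (\<forall>s\<in>S. \<Phi> s = gns_rep \<phi> s) \<and>
     (\<forall>a. \<psi> a = vinner (gns_space \<phi>) (\<Phi> a (gns_vec \<phi>)) (gns_vec \<phi>))"

definition dilation_le ::
  "('a::topological_space \<Rightarrow>\<^sub>C complex) set \<Rightarrow> 'a functional \<Rightarrow> 'a functional \<Rightarrow> bool" where
  "dilation_le S \<phi> \<psi> \<longleftrightarrow> (\<exists>\<Phi>. dilates S \<phi> \<psi> \<Phi>)"

definition strong_dilation_le ::
  "('a::topological_space \<Rightarrow>\<^sub>C complex) set \<Rightarrow> 'a functional \<Rightarrow> 'a functional \<Rightarrow> bool" where
  "strong_dilation_le S \<phi> \<psi> \<longleftrightarrow>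
     (\<exists>\<Phi>. dilates S \<phi> \<psi> \<Phi> \<and>
          range \<Phi> \<subseteq> commutant (gns_space \<phi>) (commutant (gns_space \<phi>) (range (gns_rep \<phi>))))"


section \<open>The integral subdivision relation\<close>

definition state_prob :: "'a::topological_space functional measure \<Rightarrow> bool" where
  "state_prob m \<longleftrightarrow> prob_space m \<and> sets m = sets (restrict_space borel state_space)"

definition barycenter :: "'a::topological_space functional measure \<Rightarrow> 'a functional" where
  "barycenter m = (\<lambda>a. \<integral>\<alpha>. \<alpha> a \<partial>m)"

definition isd_le ::
  "('a::topological_space \<Rightarrow>\<^sub>C complex) set \<Rightarrow> 'a functional \<Rightarrow> 'a functional \<Rightarrow> bool" where
  "isd_le S \<phi> \<psi> \<longleftrightarrow>
     (\<forall>m. state_prob m \<and> barycenter m = \<phi> \<longrightarrow>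
        (\<exists>\<Psi>. (\<forall>\<alpha>\<in>state_space. \<Psi> \<alpha> \<in> state_space) \<and>
              (\<forall>a. (\<lambda>\<alpha>. \<Psi> \<alpha> a) \<in> borel_measurable (completion m)) \<and>
              (AE \<alpha> in completion m. dilation_le S \<alpha> (\<Psi> \<alpha>)) \<and>
              (\<forall>a. \<psi> a = (\<integral>\<alpha>. \<Psi> \<alpha> a \<partial>completion m))))"

end

theory Submission
  imports Defs
begin

text \<open>
  The Choquet order yields, by the Hahn--Banach theorem, a state \<open>L\<close> on \<open>C(X \<times> X)\<close> with
  \<open>L (c \<otimes> s) = \<mu>(c s)\<close> for \<open>s \<in> S\<close> and \<open>L (1 \<otimes> f) = \<nu>(f)\<close>. Averaging \<open>L\<close> over finer and finer
  partitions of unity gives unital positive maps \<open>k\<^sub>n\<close> on \<open>C(X)\<close> with \<open>\<mu>(k\<^sub>n f) = \<nu>(f)\<close> such that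
  \<open>k\<^sub>n f\<close> converges in \<open>L\<^sup>2(\<mu>)\<close> for every \<open>f\<close>, and \<open>k\<^sub>n s\<close> converges to \<open>s\<close> for \<open>s \<in> S\<close>. Multiplication by the
  limits is a strong dilation. If \<open>\<mu>\<close> is the barycenter of \<open>m\<close>, then a subsequence of \<open>k\<^sub>n\<close> converges in
  the same way in \<open>L\<^sup>2(\<alpha>)\<close> for \<open>m\<close>-almost every \<open>\<alpha>\<close>, because \<open>C(X)\<close> is separable, and the resulting
  dilations of the \<open>\<alpha>\<close> form an integral subdivision. No Riesz representation or disintegration of
  measures is needed. Conversely, a strong dilation has commutative range, so that it dominates
  \<open>max {s\<^sub>1, \<dots>, s\<^sub>n}\<close> once it fixes \<open>s\<^sub>1, \<dots>, s\<^sub>n\<close>; for the integral subdivision relation it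
  suffices to decompose \<open>\<mu>\<close> into point evaluations.
\<close>

subsection \<open>States\<close>

text \<open>A dilation should multiply by the density of
  \<open>c \<mapsto> L (c \<otimes> f)\<close> with respect to \<mu>. That density is defined only
  up to \<mu>-null sets, so it has no value at other states \<alpha>, in particular at those
  averaged by a measure with barycenter \<mu>. This is why everything is carried by maps with
  continuous values: \<alpha> can be applied to them, and because \<mu> of their values at f is
  exactly \<nu>(f) at every stage, averaging over \<alpha> gives \<nu>(f) before any limit is taken.
  Since GNS vectors are classes of Cauchy sequences, the limit operators can be formed termwise;
  uniform boundedness makes up for convergence that is only in mean square. Maxima enter through
  compactness: the values prescribed for L are compatible with positivity because finitely many
  fibres, each an element of S, suffice to test it. In the converse direction the s that attains the
  maximum changes from point to point. A partition of unity can select it locally because an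
  operator in the bicommutant commutes with multiplication by the weights.\<close>

lift_definition of_real_fun :: "('a::topological_space \<Rightarrow>\<^sub>C real) \<Rightarrow> 'a \<Rightarrow>\<^sub>C complex"
  is "\<lambda>f x. complex_of_real (f x)"
  by (auto simp: bcontfun_def bounded_iff intro!: continuous_intros)

lift_definition Re_fun :: "('a::topological_space \<Rightarrow>\<^sub>C complex) \<Rightarrow> 'a \<Rightarrow>\<^sub>C real"
  is "\<lambda>f x. Re (f x)"
  by (auto simp: bcontfun_def bounded_iff intro!: continuous_intros)
    (meson abs_Re_le_cmod order_trans)

lift_definition Im_fun :: "('a::topological_space \<Rightarrow>\<^sub>C complex) \<Rightarrow> 'a \<Rightarrow>\<^sub>C real"
  is "\<lambda>f x. Im (f x)"
  by (auto simp: bcontfun_def bounded_iff intro!: continuous_intros)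
    (meson abs_Im_le_cmod order_trans)

lemmas [simp] = adj.rep_eq of_real_fun.rep_eq Re_fun.rep_eq Im_fun.rep_eq

lemma adj_simps [simp]:
  "adj (a + b) = adj a + adj b" "adj (a - b) = adj a - adj b" "adj (- a) = - adj a"
  "adj (a * b) = adj a * adj b" "adj (adj a) = a" "adj 1 = 1" "adj 0 = 0"
  "adj (const_bcontfun c) = const_bcontfun (cnj c)"
  by (auto intro!: bcontfun_eqI)

lemma sum_apply_bcontfun [simp]:
  "apply_bcontfun (\<Sum>i\<in>I. f i) x = (\<Sum>i\<in>I. apply_bcontfun (f i) x)"
  for f :: "'i \<Rightarrow> 'a::topological_space \<Rightarrow>\<^sub>C 'b::real_normed_vector"
  by (induction I rule: infinite_finite_induct) auto

lemma const_bcontfun_simps [simp]: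
  "const_bcontfun 1 = (1 :: 'a::topological_space \<Rightarrow>\<^sub>C complex)"
  "const_bcontfun (- 1) = (- 1 :: 'a::topological_space \<Rightarrow>\<^sub>C complex)"
  by (auto intro!: bcontfun_eqI)

lemma norm_adj [simp]: "norm (adj a) = norm a"
proof -
  have *: "norm (adj b) \<le> norm b" for b :: "'a \<Rightarrow>\<^sub>C complex"
    by (rule norm_bound) (simp add: norm_bounded)
  show ?thesis using *[of a] *[of "adj a"] by simp
qed

lemma adj_of_real_fun [simp]: "adj (of_real_fun f) = of_real_fun f"
  by (rule bcontfun_eqI) simp

text \<open>Bridges two notions of positivity: states and positive matrices are defined through
  squares, while the estimates are pointwise. The root is self-adjoint, so it can be moved across an
  inner product.\<close>

lemma nonneg_sqrt_factor:
  fixes f :: "'a::topological_space \<Rightarrow>\<^sub>C complex"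
  assumes "\<And>x. apply_bcontfun f x \<in> \<real>\<^sub>\<ge>\<^sub>0"
  obtains b where "f = adj b * b" "adj b = b"
proof -
  have "norm (of_real (sqrt (Re (apply_bcontfun f x))) :: complex) \<le> sqrt (norm f)" for x
  proof -
    have "\<bar>Re (apply_bcontfun f x)\<bar> \<le> norm f"
      using abs_Re_le_cmod[of "apply_bcontfun f x"] norm_bounded[of f x] by linarith
    then show ?thesis by (simp flip: real_sqrt_abs')
  qed
  then have "(\<lambda>x. complex_of_real (sqrt (Re (apply_bcontfun f x)))) \<in> bcontfun"
    by (intro bcontfun_normI) (auto intro!: continuous_intros)
  then obtain b where b: "(\<lambda>x. complex_of_real (sqrt (Re (apply_bcontfun f x)))) = apply_bcontfun b"
    by (rule bcontfunE)
  have bx: "apply_bcontfun b x = complex_of_real (sqrt (Re (apply_bcontfun f x)))" for x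
    using fun_cong[OF b, of x] by simp
  have "apply_bcontfun f x = apply_bcontfun (adj b * b) x" for x
  proof -
    have "apply_bcontfun f x = of_real (Re (apply_bcontfun f x))" "Re (apply_bcontfun f x) \<ge> 0"
      using assms[of x] by (auto simp: nonneg_Reals_def)
    then show ?thesis by (simp add: bx flip: of_real_mult)
  qed
  then have "f = adj b * b" by (rule bcontfun_eqI)
  moreover have "adj b = b" by (intro bcontfun_eqI) (simp add: bx)
  ultimately show ?thesis by (rule that)
qed

locale state =
  fixes \<phi> :: "'a::topological_space functional"
  assumes state: "\<phi> \<in> state_space"
begin

lemma add [simp]: "\<phi> (a + b) = \<phi> a + \<phi> b"
  and scale [simp]: "\<phi> (const_bcontfun c * a) = c * \<phi> a"
  and pos_square: "\<phi> (adj a * a) \<in> \<real>\<^sub>\<ge>\<^sub>0"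
  and one [simp]: "\<phi> 1 = 1"
  using state unfolding state_space_def by blast+

lemma zero [simp]: "\<phi> 0 = 0"
  using add[of 0 0] by simp

lemma minus [simp]: "\<phi> (- a) = - \<phi> a"
  using add[of a "- a"] by (simp add: eq_neg_iff_add_eq_0 add.commute)

lemma diff [simp]: "\<phi> (a - b) = \<phi> a - \<phi> b"
  using add[of a "- b"] by simp

lemma const [simp]: "\<phi> (const_bcontfun c) = c"
  using scale[of c 1] by simp

lemma sum [simp]: "\<phi> (\<Sum>i\<in>I. f i) = (\<Sum>i\<in>I. \<phi> (f i))"
  by (induction I rule: infinite_finite_induct) auto

lemma positive:
  assumes "\<And>x. apply_bcontfun f x \<in> \<real>\<^sub>\<ge>\<^sub>0"
  shows "\<phi> f \<in> \<real>\<^sub>\<ge>\<^sub>0"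
  using nonneg_sqrt_factor[OF assms] pos_square by metis

text \<open>Polarization: \<phi> is real on the squares of \<open>1 + a\<close> and
  \<open>1 + \<i> a\<close>, hence on their cross terms, which settles the imaginary and the real
  part of the claim respectively.\<close>

lemma adj: "\<phi> (adj a) = cnj (\<phi> a)"
proof -
  define b where "b = const_bcontfun \<i> * a"
  have "Im (\<phi> (adj (1 + a) * (1 + a))) = 0" "Im (\<phi> (adj a * a)) = 0"
       "Im (\<phi> (adj (1 + b) * (1 + b))) = 0" "Im (\<phi> (adj b * b)) = 0"
    using pos_square[unfolded complex_nonneg_Reals_iff] by blast+
  moreover have "adj (1 + a) * (1 + a) = 1 + adj a + a + adj a * a"
    "adj (1 + b) * (1 + b) = 1 + const_bcontfun (- \<i>) * adj a + const_bcontfun \<i> * a + adj b * b"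
    by (auto intro!: bcontfun_eqI simp: b_def algebra_simps)
  ultimately show ?thesis
    by (simp add: complex_eq_iff)
qed

lemma mono:
  assumes "\<And>x. apply_bcontfun f x \<in> \<real>" "\<And>x. apply_bcontfun g x \<in> \<real>"
    "\<And>x. Re (apply_bcontfun f x) \<le> Re (apply_bcontfun g x)"
  shows "Re (\<phi> f) \<le> Re (\<phi> g)"
proof -
  have "apply_bcontfun (g - f) x \<in> \<real>\<^sub>\<ge>\<^sub>0" for x
    using assms[of x] by (auto simp: complex_nonneg_Reals_iff complex_is_Real_iff)
  from positive[OF this] show ?thesis by (auto simp: complex_nonneg_Reals_iff)
qed

lemma cauchy_schwarz:
  "(cmod (\<phi> (adj b * a)))\<^sup>2 \<le> Re (\<phi> (adj a * a)) * Re (\<phi> (adj b * b))"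
proof -
  define z A B where "z = \<phi> (adj b * a)" and "A = Re (\<phi> (adj a * a))" and "B = Re (\<phi> (adj b * b))"
  have cz: "\<phi> (adj a * b) = cnj z"
    using adj[of "adj b * a"] by (simp add: z_def mult.commute)
  have AB: "\<phi> (adj a * a) = of_real A" "\<phi> (adj b * b) = of_real B" "A \<ge> 0" "B \<ge> 0"
    using pos_square[of a] pos_square[of b]
    by (auto simp: A_def B_def complex_nonneg_Reals_iff complex_eq_iff)
  \<comment> \<open>The phase of \<open>z\<close> is absorbed into the scalar \<open>l\<close>,
    which leaves a quadratic inequality in the real parameter \<open>t\<close>. Its left side is
    minimal at \<open>1 / B\<close>; if \<open>B = 0\<close>, the choice
    \<open>(A + 1) / |z|^2\<close> would make it negative.\<close>
  have key: "A - 2 * t * (cmod z)\<^sup>2 + t\<^sup>2 * (cmod z)\<^sup>2 * B \<ge> 0" for t :: real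
  proof -
    define l where "l = of_real t * z"
    have "adj (a - const_bcontfun l * b) * (a - const_bcontfun l * b) =
       adj a * a - const_bcontfun l * (adj a * b) - const_bcontfun (cnj l) * (adj b * a)
        + const_bcontfun (cnj l * l) * (adj b * b)"
      by (auto intro!: bcontfun_eqI simp: algebra_simps)
    then have "\<phi> (adj (a - const_bcontfun l * b) * (a - const_bcontfun l * b)) =
       of_real A - l * cnj z - cnj l * z + cnj l * l * of_real B"
      by (simp add: cz z_def[symmetric] AB)
    also have "\<dots> = of_real (A - 2 * t * (cmod z)\<^sup>2 + t\<^sup>2 * (cmod z)\<^sup>2 * B)"
      using complex_norm_square[of z]
      by (simp add: l_def algebra_simps power2_eq_square) 
    finally show ?thesis
      using pos_square[of "a - const_bcontfun l * b"] by (simp add: complex_nonneg_Reals_iff)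
  qed
  show ?thesis
  proof (cases "B = 0")
    case False
    then have "B > 0" using AB by simp
    have "A - (cmod z)\<^sup>2 / B \<ge> 0"
      using key[of "1 / B"] False by (simp add: field_simps power2_eq_square)
    then show ?thesis using \<open>B > 0\<close> by (simp add: z_def A_def B_def field_simps)
  next
    case True
    have "z = 0"
    proof (rule ccontr)
      assume "z \<noteq> 0"
      then have "A - 2 * (A + 1) \<ge> 0"
        using key[of "(A + 1) / (cmod z)\<^sup>2"] True by simp
      then show False using AB by simp
    qed
    then show ?thesis using True by (simp add: z_def B_def)
  qed
qed

text \<open>Positivity applied to \<open>c^2 |b|^2 - |a|^2\<close>. It yields both contractivity of
  a state and boundedness of multiplication for the seminorm \<open>q\<close>.\<close>

lemma square_le:
  assumes "\<And>x. cmod (apply_bcontfun a x) \<le> c * cmod (apply_bcontfun b x)" "c \<ge> 0"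
  shows "Re (\<phi> (adj a * a)) \<le> c\<^sup>2 * Re (\<phi> (adj b * b))"
proof -
  have "Re (\<phi> (adj a * a)) \<le> Re (\<phi> (const_bcontfun (of_real (c\<^sup>2)) * (adj b * b)))"
  proof (rule mono)
    fix x
    have *: "apply_bcontfun (adj f * f) x = of_real ((cmod (apply_bcontfun f x))\<^sup>2)" for f :: "'a \<Rightarrow>\<^sub>C complex"
      using complex_norm_square[of "apply_bcontfun f x"] by (simp add: mult.commute)
    show "apply_bcontfun (adj a * a) x \<in> \<real>"
      unfolding * by simp
    show "apply_bcontfun (const_bcontfun (of_real (c\<^sup>2)) * (adj b * b)) x \<in> \<real>"
      using *[of b] by (metis Reals_mult Reals_of_real const_bcontfun.rep_eq times_bcontfun.rep_eq)
    have "(cmod (apply_bcontfun a x))\<^sup>2 \<le> (c * cmod (apply_bcontfun b x))\<^sup>2"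
      using assms by (intro power_mono) auto
    then show "Re (apply_bcontfun (adj a * a) x)
        \<le> Re (apply_bcontfun (const_bcontfun (of_real (c\<^sup>2)) * (adj b * b)) x)"
      using *[of a] *[of b] by (simp add: power_mult_distrib del: of_real_power)
  qed
  also have "\<dots> = c\<^sup>2 * Re (\<phi> (adj b * b))"
    by (simp only: scale) simp
  finally show ?thesis .
qed

lemma norm_le: "cmod (\<phi> a) \<le> norm a"
proof -
  have "(cmod (\<phi> a))\<^sup>2 \<le> Re (\<phi> (adj a * a))"
    using cauchy_schwarz[of 1 a] by simp
  also have "\<dots> \<le> (norm a)\<^sup>2 * Re (\<phi> (adj 1 * 1))"
    by (rule square_le) (auto simp: norm_bounded)
  finally show ?thesis by (simp add: power2_le_iff_abs_le)
qed

section \<open>The mean-square seminorm of a state\<close>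

abbreviation (input) q where "q \<equiv> gns_seminorm \<phi>"

lemma q_nonneg [simp]: "0 \<le> q a"
  by (simp add: gns_seminorm_def pos_square[unfolded complex_nonneg_Reals_iff])

lemma q_square: "(q a)\<^sup>2 = Re (\<phi> (adj a * a))"
  and q_square': "\<phi> (adj a * a) = of_real ((q a)\<^sup>2)"
  using pos_square[of a]
  by (auto simp: gns_seminorm_def complex_nonneg_Reals_iff complex_eq_iff)

lemma q_CS: "cmod (\<phi> (adj b * a)) \<le> q a * q b"
proof (rule power2_le_imp_le)
  show "(cmod (\<phi> (adj b * a)))\<^sup>2 \<le> (q a * q b)\<^sup>2"
    using cauchy_schwarz[of b a] by (simp add: power_mult_distrib q_square)
qed simp

lemma q_mult_le:
  assumes "\<And>x. cmod (apply_bcontfun a x) \<le> c" "c \<ge> 0"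
  shows "q (a * b) \<le> c * q b"
proof (rule power2_le_imp_le)
  show "(q (a * b))\<^sup>2 \<le> (c * q b)\<^sup>2"
    unfolding power_mult_distrib q_square
    by (rule square_le) (auto simp: norm_mult assms intro!: mult_right_mono)
qed (simp add: assms)

lemma q_mult: "q (a * b) \<le> norm a * q b"
  by (rule q_mult_le) (auto simp: norm_bounded)

lemma q_one [simp]: "q 1 = 1"
  by (simp add: gns_seminorm_def)

lemma q_le_norm: "q a \<le> norm a"
  using q_mult[of a 1] by simp

lemma q_scale [simp]: "q (const_bcontfun c * a) = cmod c * q a"
proof -
  have "adj (const_bcontfun c * a) * (const_bcontfun c * a) = const_bcontfun (cnj c * c) * (adj a * a)"
    by (auto intro!: bcontfun_eqI simp: algebra_simps)
  then have "\<phi> (adj (const_bcontfun c * a) * (const_bcontfun c * a)) = cnj c * c * \<phi> (adj a * a)"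
    by (simp only: scale)
  also have "cnj c * c = of_real ((cmod c)\<^sup>2)"
    using complex_norm_square[of c] by (simp add: mult.commute)
  finally show ?thesis
    by (simp add: gns_seminorm_def real_sqrt_mult flip: of_real_power)
qed

lemma q_zero [simp]: "q 0 = 0"
  by (simp add: gns_seminorm_def)

lemma q_minus [simp]: "q (- a) = q a"
  by (simp add: gns_seminorm_def)

lemma q_commute: "q (a - b) = q (b - a)"
  using q_minus[of "a - b"] by simp

lemma q_triangle: "q (a + b) \<le> q a + q b"
proof (rule power2_le_imp_le)
  have "\<phi> (adj a * b) = cnj (\<phi> (adj b * a))"
    using adj[of "adj b * a"] by (simp add: mult.commute)
  then have "Re (\<phi> (adj (a + b) * (a + b))) = (q a)\<^sup>2 + (q b)\<^sup>2 + 2 * Re (\<phi> (adj b * a))"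
    by (simp add: algebra_simps q_square)
  also have "Re (\<phi> (adj b * a)) \<le> q a * q b"
    using q_CS[of b a] complex_Re_le_cmod order_trans by blast
  finally show "(q (a + b))\<^sup>2 \<le> (q a + q b)\<^sup>2"
    by (simp add: q_square[of "a + b"] power2_sum)
qed simp

lemma q_triangle_diff: "q (a - c) \<le> q (a - b) + q (b - c)"
  using q_triangle[of "a - b" "b - c"] by simp

end

subsection \<open>The GNS space\<close>

context state
begin

abbreviation (input) H where "H \<equiv> gns_space \<phi>"

lemma gns_CauchyD:
  assumes "u \<in> gns_Cauchy \<phi>" "e > 0"
  obtains N where "\<And>m n. m \<ge> N \<Longrightarrow> n \<ge> N \<Longrightarrow> q (u m - u n) < e"
  using assms unfolding gns_Cauchy_def by blast

lemma gns_CauchyI: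
  assumes "\<And>e. e > 0 \<Longrightarrow> \<exists>N. \<forall>m\<ge>N. \<forall>n\<ge>N. q (u m - u n) \<le> e"
  shows "u \<in> gns_Cauchy \<phi>"
  unfolding gns_Cauchy_def
proof safe
  fix e :: real assume "e > 0"
  then obtain N where "\<forall>m\<ge>N. \<forall>n\<ge>N. q (u m - u n) \<le> e / 2"
    using assms[of "e / 2"] by auto
  then have "\<forall>m\<ge>N. \<forall>n\<ge>N. q (u m - u n) < e"
    using \<open>e > 0\<close> by (smt (verit) field_sum_of_halves)
  then show "\<exists>N. \<forall>m\<ge>N. \<forall>n\<ge>N. q (u m - u n) < e" ..
qed

lemma gns_Cauchy_const [simp]: "(\<lambda>_. a) \<in> gns_Cauchy \<phi>"
  by (rule gns_CauchyI) auto

lemma gns_Cauchy_add [intro]: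
  assumes "u \<in> gns_Cauchy \<phi>" "v \<in> gns_Cauchy \<phi>"
  shows "(\<lambda>n. u n + v n) \<in> gns_Cauchy \<phi>"
proof (rule gns_CauchyI)
  fix e :: real assume "e > 0"
  then obtain M N where M: "\<And>m n. m \<ge> M \<Longrightarrow> n \<ge> M \<Longrightarrow> q (u m - u n) < e / 2"
    and N: "\<And>m n. m \<ge> N \<Longrightarrow> n \<ge> N \<Longrightarrow> q (v m - v n) < e / 2"
    using gns_CauchyD[OF assms(1), of "e / 2"] gns_CauchyD[OF assms(2), of "e / 2"]
    by (metis half_gt_zero)
  have "q (u m + v m - (u n + v n)) \<le> e" if "m \<ge> max M N" "n \<ge> max M N" for m n
    using q_triangle[of "u m - u n" "v m - v n"] M[of m n] N[of m n] that
    by (simp add: algebra_simps)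
  then show "\<exists>N. \<forall>m\<ge>N. \<forall>n\<ge>N. q (u m + v m - (u n + v n)) \<le> e" by blast
qed

lemma gns_Cauchy_mult_left [intro]:
  assumes "u \<in> gns_Cauchy \<phi>"
  shows "(\<lambda>n. a * u n) \<in> gns_Cauchy \<phi>"
proof (rule gns_CauchyI)
  fix e :: real assume "e > 0"
  then have "e / (norm a + 1) > 0" by (simp add: add_nonneg_pos)
  then obtain N where N: "\<And>m n. m \<ge> N \<Longrightarrow> n \<ge> N \<Longrightarrow> q (u m - u n) < e / (norm a + 1)"
    using gns_CauchyD[OF assms] by metis
  have "q (a * u m - a * u n) \<le> e" if "m \<ge> N" "n \<ge> N" for m n
  proof -
    have "q (a * u m - a * u n) \<le> norm a * q (u m - u n)"
      using q_mult[of a "u m - u n"] by (simp add: algebra_simps)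
    also have "\<dots> \<le> (norm a + 1) * (e / (norm a + 1))"
      using N[OF that] by (intro mult_mono) auto
    also have "\<dots> = e"
      using norm_ge_zero[of a] by (simp add: divide_simps del: norm_ge_zero)
    finally show ?thesis .
  qed
  then show "\<exists>N. \<forall>m\<ge>N. \<forall>n\<ge>N. q (a * u m - a * u n) \<le> e" by blast
qed

lemma gns_Cauchy_minus [intro]: "u \<in> gns_Cauchy \<phi> \<Longrightarrow> (\<lambda>n. - u n) \<in> gns_Cauchy \<phi>"
  using gns_Cauchy_mult_left[of u "- 1"] by simp

lemma gns_Cauchy_diff [intro]:
  "u \<in> gns_Cauchy \<phi> \<Longrightarrow> v \<in> gns_Cauchy \<phi> \<Longrightarrow> (\<lambda>n. u n - v n) \<in> gns_Cauchy \<phi>"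
  using gns_Cauchy_add[of u "\<lambda>n. - v n"] gns_Cauchy_minus[of v] by simp

lemma abs_q_diff_le: "\<bar>q a - q b\<bar> \<le> q (a - b)"
  using q_triangle[of "a - b" b] q_triangle[of "b - a" a] q_commute[of a b] by simp

lemma q_convergent:
  assumes "u \<in> gns_Cauchy \<phi>"
  shows "convergent (\<lambda>n. q (u n))"
proof (rule Cauchy_convergent, rule metric_CauchyI)
  fix e :: real assume "e > 0"
  then obtain N where "\<And>m n. m \<ge> N \<Longrightarrow> n \<ge> N \<Longrightarrow> q (u m - u n) < e"
    using gns_CauchyD[OF assms] by metis
  then show "\<exists>M. \<forall>m\<ge>M. \<forall>n\<ge>M. dist (q (u m)) (q (u n)) < e"
    using abs_q_diff_le by (metis dist_real_def order_le_less_trans)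
qed

lemma q_bounded:
  assumes "u \<in> gns_Cauchy \<phi>"
  obtains B where "B > 0" "\<And>n. q (u n) \<le> B"
proof -
  have "Bseq (\<lambda>n. q (u n))"
    using q_convergent[OF assms] by (rule convergent_imp_Bseq)
  then show ?thesis using that by (auto elim!: BseqE)
qed

text \<open>Multiplication by a bounded Cauchy sequence is the multiplication operator by a
  bounded measurable function in disguise.\<close>

definition multiplier :: "(nat \<Rightarrow> 'a \<Rightarrow>\<^sub>C complex) \<Rightarrow> bool" where
  "multiplier k \<longleftrightarrow> k \<in> gns_Cauchy \<phi> \<and> (\<exists>C. \<forall>n. norm (k n) \<le> C)"

lemma multiplier_const [simp]: "multiplier (\<lambda>_. a)"
  by (auto simp: multiplier_def)

lemma multiplier_bound:
  assumes "multiplier k"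
  obtains C where "C > 0" "\<And>n. norm (k n) \<le> C"
proof -
  obtain C where C: "\<And>n. norm (k n) \<le> C" using assms by (auto simp: multiplier_def)
  show ?thesis
  proof (rule that[of "\<bar>C\<bar> + 1"])
    show "norm (k n) \<le> \<bar>C\<bar> + 1" for n using C[of n] by linarith
  qed simp
qed

text \<open>The second sequence is frozen at \<open>u N1\<close>: that is a single bounded function,
  against which mean-square smallness of \<open>k m - k n\<close> suffices, while the error
  \<open>u n - u N1\<close> is met by the uniform bound on the multiplier.\<close>

lemma multiplier_tail:
  assumes "multiplier k" "u \<in> gns_Cauchy \<phi>" "e > 0"
  obtains N where "\<And>m n. m \<ge> N \<Longrightarrow> n \<ge> N \<Longrightarrow> q ((k m - k n) * u n) \<le> e"
proof -
  obtain C where C: "C > 0" "\<And>n. norm (k n) \<le> C" by (rule multiplier_bound[OF assms(1)]) blast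
  \<comment> \<open>Half of \<open>e\<close>, divided by the bound \<open>2 * C\<close> for the norm
    of a difference of two terms of the multiplier.\<close>
  have "e / (4 * C) > 0" using assms C by simp
  then obtain N1 where N1: "\<And>m n. m \<ge> N1 \<Longrightarrow> n \<ge> N1 \<Longrightarrow> q (u m - u n) < e / (4 * C)"
    using gns_CauchyD[OF assms(2)] by metis
  define w where "w = norm (u N1) + 1"
  have w: "w > 0" "norm (u N1) \<le> w" by (auto simp: w_def add_nonneg_pos)
  have "e / (2 * w) > 0" using assms w by simp
  then obtain N2 where N2: "\<And>m n. m \<ge> N2 \<Longrightarrow> n \<ge> N2 \<Longrightarrow> q (k m - k n) < e / (2 * w)"
    using gns_CauchyD[of k] assms(1) multiplier_def by metis
  show ?thesis
  proof (rule that[of "max N1 N2"])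
    fix m n assume mn: "m \<ge> max N1 N2" "n \<ge> max N1 N2"
    have "(k m - k n) * u n = u N1 * (k m - k n) + (k m - k n) * (u n - u N1)"
      by (simp add: algebra_simps)
    then have "q ((k m - k n) * u n) \<le> q (u N1 * (k m - k n)) + q ((k m - k n) * (u n - u N1))"
      using q_triangle by metis
    also have "q (u N1 * (k m - k n)) \<le> norm (u N1) * q (k m - k n)"
      by (rule q_mult)
    also have "\<dots> \<le> w * (e / (2 * w))"
      using N2[of m n] mn w by (intro mult_mono) auto
    also have "q ((k m - k n) * (u n - u N1)) \<le> norm (k m - k n) * q (u n - u N1)"
      by (rule q_mult)
    also have "\<dots> \<le> (2 * C) * (e / (4 * C))"
    proof (rule mult_mono)
      show "norm (k m - k n) \<le> 2 * C"
        using norm_triangle_ineq4[of "k m" "k n"] C(2)[of m] C(2)[of n] by linarith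
    qed (use N1[of n N1] mn C in auto)
    finally show "q ((k m - k n) * u n) \<le> e"
      using w C by simp
  qed
qed

lemma multiplier_Cauchy [intro]:
  assumes "multiplier k" "u \<in> gns_Cauchy \<phi>"
  shows "(\<lambda>n. k n * u n) \<in> gns_Cauchy \<phi>"
proof (rule gns_CauchyI)
  fix e :: real assume e: "e > 0"
  obtain C where C: "C > 0" "\<And>n. norm (k n) \<le> C" by (rule multiplier_bound[OF assms(1)]) blast
  have "e / (2 * C) > 0" using e C by simp
  then obtain N1 where N1: "\<And>m n. m \<ge> N1 \<Longrightarrow> n \<ge> N1 \<Longrightarrow> q (u m - u n) < e / (2 * C)"
    using gns_CauchyD[OF assms(2)] by metis
  obtain N2 where N2: "\<And>m n. m \<ge> N2 \<Longrightarrow> n \<ge> N2 \<Longrightarrow> q ((k m - k n) * u n) \<le> e / 2"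
    using multiplier_tail[OF assms, of "e / 2"] e by auto
  have "q (k m * u m - k n * u n) \<le> e" if mn: "m \<ge> max N1 N2" "n \<ge> max N1 N2" for m n
  proof -
    have "k m * u m - k n * u n = k m * (u m - u n) + (k m - k n) * u n"
      by (simp add: algebra_simps)
    then have "q (k m * u m - k n * u n) \<le> q (k m * (u m - u n)) + q ((k m - k n) * u n)"
      using q_triangle by metis
    also have "q (k m * (u m - u n)) \<le> norm (k m) * q (u m - u n)"
      by (rule q_mult)
    also have "\<dots> \<le> C * (e / (2 * C))"
      using N1[of m n] mn C by (intro mult_mono) auto
    also have "q ((k m - k n) * u n) \<le> e / 2"
      using N2 mn by simp
    finally show ?thesis using C by simp
  qed
  then show "\<exists>N. \<forall>m\<ge>N. \<forall>n\<ge>N. q (k m * u m - k n * u n) \<le> e" by blast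
qed

lemma multiplier_vanish:
  assumes "multiplier k" "(\<lambda>n. q (u n)) \<longlonglongrightarrow> 0"
  shows "(\<lambda>n. q (k n * u n)) \<longlonglongrightarrow> 0"
proof -
  obtain C where C: "C > 0" "\<And>n. norm (k n) \<le> C" by (rule multiplier_bound[OF assms(1)]) blast
  have lim: "(\<lambda>n. C * q (u n)) \<longlonglongrightarrow> 0" using tendsto_mult_right_zero[OF assms(2)] .
  have "q (k n * u n) \<le> C * q (u n)" for n
    using order_trans[OF q_mult mult_right_mono[OF C(2)]] by simp
  then show ?thesis by (intro tendsto_sandwich[OF _ _ tendsto_const lim]) auto
qed

text \<open>Mean-square decay of a multiplier annihilates every vector, not only the cyclic one:
  \<open>u\<close> is replaced by its fixed bounded term \<open>u N\<close>, and the replacement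
  error is handled by the sup-norm bound.\<close>

lemma null_multiplier:
  assumes k: "multiplier k" "(\<lambda>n. q (k n)) \<longlonglongrightarrow> 0" and u: "u \<in> gns_Cauchy \<phi>"
  shows "(\<lambda>n. q (k n * u n)) \<longlonglongrightarrow> 0"
proof (rule LIMSEQ_I)
  fix e :: real assume e: "e > 0"
  obtain C where C: "C > 0" "\<And>n. norm (k n) \<le> C" by (rule multiplier_bound[OF k(1)]) blast
  have "e / (2 * C) > 0" using e C by simp
  then obtain N where N: "\<And>m n. m \<ge> N \<Longrightarrow> n \<ge> N \<Longrightarrow> q (u m - u n) < e / (2 * C)"
    using gns_CauchyD[OF u] by metis
  have "(\<lambda>n. norm (u N) * q (k n)) \<longlonglongrightarrow> 0" using tendsto_mult_right_zero[OF k(2)] .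
  from LIMSEQ_D[OF this, of "e / 2"] e obtain M
    where M: "\<And>n. n \<ge> M \<Longrightarrow> \<bar>norm (u N) * q (k n)\<bar> < e / 2" by auto
  have "norm (q (k n * u n) - 0) < e" if n: "n \<ge> max N M" for n
  proof -
    have "k n * u n = k n * (u n - u N) + u N * k n"
      by (simp add: algebra_simps)
    then have "q (k n * u n) \<le> q (k n * (u n - u N)) + q (u N * k n)"
      using q_triangle by metis
    also have "q (k n * (u n - u N)) \<le> norm (k n) * q (u n - u N)" by (rule q_mult)
    also have "\<dots> \<le> C * (e / (2 * C))" using C N[of n N] n by (intro mult_mono) auto
    also have "\<dots> = e / 2" using C by simp
    also have "q (u N * k n) < e / 2" using q_mult[of "u N" "k n"] M[of n] n by auto
    finally show ?thesis by simp
  qed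
  then show "\<exists>N. \<forall>n\<ge>N. norm (q (k n * u n) - 0) < e" by blast
qed

section \<open>The quotient and its operations\<close>

lemma gns_relI:
  "u \<in> gns_Cauchy \<phi> \<Longrightarrow> v \<in> gns_Cauchy \<phi> \<Longrightarrow> (\<lambda>n. q (u n - v n)) \<longlonglongrightarrow> 0 \<Longrightarrow> (u, v) \<in> gns_rel \<phi>"
  by (simp add: gns_rel_def)

lemma gns_relD:
  assumes "(u, v) \<in> gns_rel \<phi>"
  shows "u \<in> gns_Cauchy \<phi>" "v \<in> gns_Cauchy \<phi>" "(\<lambda>n. q (u n - v n)) \<longlonglongrightarrow> 0"
  using assms by (auto simp: gns_rel_def)

lemma equiv_gns: "equiv (gns_Cauchy \<phi>) (gns_rel \<phi>)"
proof (rule equivI)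
  show "gns_rel \<phi> \<subseteq> gns_Cauchy \<phi> \<times> gns_Cauchy \<phi>" by (auto simp: gns_rel_def)
  show "refl_on (gns_Cauchy \<phi>) (gns_rel \<phi>)"
    by (auto simp: refl_on_def gns_rel_def)
  show "sym (gns_rel \<phi>)"
  proof (rule symI)
    fix u v assume "(u, v) \<in> gns_rel \<phi>"
    from gns_relD[OF this] show "(v, u) \<in> gns_rel \<phi>"
      using q_commute[of "u n" "v n" for n] by (intro gns_relI) auto
  qed
  show "trans (gns_rel \<phi>)"
  proof (rule transI)
    fix u v w assume uv: "(u, v) \<in> gns_rel \<phi>" and vw: "(v, w) \<in> gns_rel \<phi>"
    have "(\<lambda>n. q (u n - v n) + q (v n - w n)) \<longlonglongrightarrow> 0"
      using tendsto_add[OF gns_relD(3)[OF uv] gns_relD(3)[OF vw]] by simp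
    then have "(\<lambda>n. q (u n - w n)) \<longlonglongrightarrow> 0"
      by (intro tendsto_sandwich[OF _ _ tendsto_const \<open>(\<lambda>n. q (u n - v n) + q (v n - w n)) \<longlonglongrightarrow> 0\<close>]
          always_eventually allI q_triangle_diff q_nonneg)
    then show "(u, w) \<in> gns_rel \<phi>"
      using uv vw by (auto intro: gns_relI dest: gns_relD)
  qed
qed

lemma vecs_iff: "h \<in> vecs H \<longleftrightarrow> (\<exists>u\<in>gns_Cauchy \<phi>. h = gns_class \<phi> u)"
  by (auto simp: gns_space_def gns_class_def quotient_def)

lemma vecsE:
  assumes "h \<in> vecs H"
  obtains u where "u \<in> gns_Cauchy \<phi>" "h = gns_class \<phi> u"
  using assms vecs_iff by blast

lemma class_in_vecs [intro]: "u \<in> gns_Cauchy \<phi> \<Longrightarrow> gns_class \<phi> u \<in> vecs H"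
  using vecs_iff by blast

lemma gns_vec_in [simp]: "gns_vec \<phi> \<in> vecs H"
  by (auto simp: gns_vec_def)

lemma class_eq_iff:
  assumes "u \<in> gns_Cauchy \<phi>" "v \<in> gns_Cauchy \<phi>"
  shows "gns_class \<phi> u = gns_class \<phi> v \<longleftrightarrow> (\<lambda>n. q (u n - v n)) \<longlonglongrightarrow> 0"
  using assms eq_equiv_class_iff[OF equiv_gns] by (auto simp: gns_class_def gns_rel_def)

lemma class_mem: "u' \<in> gns_class \<phi> u \<Longrightarrow> (u, u') \<in> gns_rel \<phi>"
  by (simp add: gns_class_def)

lemma class_self: "u \<in> gns_Cauchy \<phi> \<Longrightarrow> u \<in> gns_class \<phi> u"
  by (auto simp: gns_class_def gns_rel_def)

text \<open>The operations of \<open>gns_space\<close> are unions over all representatives.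
  Compatibility with the relation makes every set in the union the same class, so the union
  collapses.\<close>

lemma UN_class:
  assumes u: "u \<in> gns_Cauchy \<phi>"
    and "\<And>u. u \<in> gns_Cauchy \<phi> \<Longrightarrow> F u \<in> gns_Cauchy \<phi>"
    and "\<And>u v. (u, v) \<in> gns_rel \<phi> \<Longrightarrow> (\<lambda>n. q (F u n - F v n)) \<longlonglongrightarrow> 0"
  shows "(\<Union>u\<in>gns_class \<phi> u. gns_class \<phi> (F u)) = gns_class \<phi> (F u)"
proof -
  have "gns_class \<phi> (F v) = gns_class \<phi> (F u)" if "v \<in> gns_class \<phi> u" for v
  proof -
    have "(v, u) \<in> gns_rel \<phi>"
      using class_mem[OF that] equiv_gns by (meson equivE symE)
    from assms(3)[OF this] show ?thesis
      using assms(2) gns_relD[OF class_mem[OF that]] by (subst class_eq_iff) auto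
  qed
  then show ?thesis using class_self[OF u] by blast
qed

lemma vadd_class:
  assumes "u \<in> gns_Cauchy \<phi>" "v \<in> gns_Cauchy \<phi>"
  shows "vadd H (gns_class \<phi> u) (gns_class \<phi> v) = gns_class \<phi> (\<lambda>n. u n + v n)"
proof -
  have "gns_class \<phi> (\<lambda>n. u' n + v' n) = gns_class \<phi> (\<lambda>n. u n + v n)"
    if "u' \<in> gns_class \<phi> u" "v' \<in> gns_class \<phi> v" for u' v'
  proof -
    note r = class_mem[OF that(1)] class_mem[OF that(2)]
    have lim: "(\<lambda>n. q (u n - u' n) + q (v n - v' n)) \<longlonglongrightarrow> 0"
      using tendsto_add[OF gns_relD(3)[OF r(1)] gns_relD(3)[OF r(2)]] by simp
    have "q ((u n + v n) - (u' n + v' n)) \<le> q (u n - u' n) + q (v n - v' n)" for n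
      using q_triangle[of "u n - u' n" "v n - v' n"] by (simp add: algebra_simps)
    then have "(\<lambda>n. q ((u n + v n) - (u' n + v' n))) \<longlonglongrightarrow> 0"
      by (intro tendsto_sandwich[OF _ _ tendsto_const lim]) auto
    then have "gns_class \<phi> (\<lambda>n. u n + v n) = gns_class \<phi> (\<lambda>n. u' n + v' n)"
      using assms r gns_relD by (subst class_eq_iff) auto
    then show ?thesis ..
  qed
  then have "(\<Union>u'\<in>gns_class \<phi> u. \<Union>v'\<in>gns_class \<phi> v. gns_class \<phi> (\<lambda>n. u' n + v' n)) =
      (\<Union>u'\<in>gns_class \<phi> u. \<Union>v'\<in>gns_class \<phi> v. gns_class \<phi> (\<lambda>n. u n + v n))"
    by (intro SUP_cong refl)
  moreover have "gns_class \<phi> u \<noteq> {}" "gns_class \<phi> v \<noteq> {}"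
    using class_self[OF assms(1)] class_self[OF assms(2)] by blast+
  ultimately show ?thesis by (simp add: gns_space_def)
qed

text \<open>Constant multipliers give scalar multiplication and the GNS representation, so their
  well-definedness is settled here together with that of the limit operators.\<close>

lemma multiplier_class:
  assumes "multiplier k" "u \<in> gns_Cauchy \<phi>"
  shows "(\<Union>u\<in>gns_class \<phi> u. gns_class \<phi> (\<lambda>n. k n * u n)) = gns_class \<phi> (\<lambda>n. k n * u n)"
proof (rule UN_class[where F = "\<lambda>u n. k n * u n"])
  fix u v assume "(u, v) \<in> gns_rel \<phi>"
  then have "(\<lambda>n. q (k n * (u n - v n))) \<longlonglongrightarrow> 0"
    by (intro multiplier_vanish assms gns_relD)
  then show "(\<lambda>n. q (k n * u n - k n * v n)) \<longlonglongrightarrow> 0"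
    by (simp add: algebra_simps)
qed (use assms in auto)

lemma vscale_class:
  "u \<in> gns_Cauchy \<phi> \<Longrightarrow> vscale H c (gns_class \<phi> u) = gns_class \<phi> (\<lambda>n. const_bcontfun c * u n)"
  using multiplier_class[of "\<lambda>_. const_bcontfun c"] by (simp add: gns_space_def)

lemma gns_rep_class:
  "u \<in> gns_Cauchy \<phi> \<Longrightarrow> gns_rep \<phi> a (gns_class \<phi> u) = gns_class \<phi> (\<lambda>n. a * u n)"
  using multiplier_class[of "\<lambda>_. a"] by (simp add: gns_rep_def class_in_vecs)

lemma inner_diff: "cmod (\<phi> (adj v * u) - \<phi> (adj v' * u')) \<le> q (u - u') * q v + q u' * q (v - v')"
proof -
  have "\<phi> (adj v * u) - \<phi> (adj v' * u') = \<phi> (adj v * (u - u')) + \<phi> (adj (v - v') * u')"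
    by (simp add: algebra_simps)
  also have "cmod \<dots> \<le> q (u - u') * q v + q u' * q (v - v')"
    by (intro norm_triangle_le add_mono q_CS)
  finally show ?thesis .
qed

lemma inner_convergent:
  assumes u: "u \<in> gns_Cauchy \<phi>" and v: "v \<in> gns_Cauchy \<phi>"
  shows "convergent (\<lambda>n. \<phi> (adj (v n) * u n))"
proof (rule Cauchy_convergent, rule metric_CauchyI)
  fix e :: real assume e: "e > 0"
  obtain A B where AB: "A > 0" "\<And>n. q (u n) \<le> A" "B > 0" "\<And>n. q (v n) \<le> B"
    using q_bounded[OF u] q_bounded[OF v] by metis
  have "e / (2 * B) > 0" "e / (2 * A) > 0" using e AB by auto
  then obtain M N where M: "\<And>m n. m \<ge> M \<Longrightarrow> n \<ge> M \<Longrightarrow> q (u m - u n) < e / (2 * B)"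
    and N: "\<And>m n. m \<ge> N \<Longrightarrow> n \<ge> N \<Longrightarrow> q (v m - v n) < e / (2 * A)"
    using gns_CauchyD[OF u] gns_CauchyD[OF v] by metis
  have "dist (\<phi> (adj (v m) * u m)) (\<phi> (adj (v n) * u n)) < e"
    if "m \<ge> max M N" "n \<ge> max M N" for m n
  proof -
    have "dist (\<phi> (adj (v m) * u m)) (\<phi> (adj (v n) * u n)) \<le>
      q (u m - u n) * q (v m) + q (u n) * q (v m - v n)"
      unfolding dist_norm by (rule inner_diff)
    also have "\<dots> \<le> q (u m - u n) * B + A * q (v m - v n)"
      using AB by (intro add_mono mult_mono) auto
    also have "\<dots> < e / (2 * B) * B + A * (e / (2 * A))"
      using AB M[of m n] N[of m n] that by (intro add_strict_mono mult_strict_right_mono mult_strict_left_mono) auto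
    finally show ?thesis using AB by simp
  qed
  then show "\<exists>M. \<forall>m\<ge>M. \<forall>n\<ge>M. dist (\<phi> (adj (v m) * u m)) (\<phi> (adj (v n) * u n)) < e" by blast
qed

text \<open>Cauchy--Schwarz bounds the effect of changing representatives by the seminorms of the
  differences, so the limit is unique and is what the definite description in \<open>vinner\<close>
  denotes.\<close>

lemma inner_class:
  assumes u: "u \<in> gns_Cauchy \<phi>" and v: "v \<in> gns_Cauchy \<phi>"
  shows "(\<lambda>n. \<phi> (adj (v n) * u n)) \<longlonglongrightarrow> vinner H (gns_class \<phi> u) (gns_class \<phi> v)"
proof -
  obtain z where z: "(\<lambda>n. \<phi> (adj (v n) * u n)) \<longlonglongrightarrow> z"
    using inner_convergent[OF assms] by (auto simp: convergent_def)
  have "(\<lambda>n. \<phi> (adj (v' n) * u' n)) \<longlonglongrightarrow> z"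
    if "u' \<in> gns_class \<phi> u" "v' \<in> gns_class \<phi> v" for u' v'
  proof -
    note r = class_mem[OF that(1)] class_mem[OF that(2)]
    obtain A B where AB: "A > 0" "\<And>n. q (u' n) \<le> A" "B > 0" "\<And>n. q (v n) \<le> B"
      using q_bounded[OF gns_relD(2)[OF r(1)]] q_bounded[OF v] by metis
    have lim: "(\<lambda>n. q (u n - u' n) * B + A * q (v n - v' n)) \<longlonglongrightarrow> 0"
      using tendsto_add[OF tendsto_mult_left_zero[OF gns_relD(3)[OF r(1)], of B]
          tendsto_mult_right_zero[OF gns_relD(3)[OF r(2)], of A]] by simp
    have "cmod (\<phi> (adj (v n) * u n) - \<phi> (adj (v' n) * u' n)) \<le> q (u n - u' n) * B + A * q (v n - v' n)" for n
      using AB by (intro order_trans[OF inner_diff] add_mono mult_mono) auto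
    then have "(\<lambda>n. \<phi> (adj (v n) * u n) - \<phi> (adj (v' n) * u' n)) \<longlonglongrightarrow> 0"
      by (intro Lim_null_comparison[OF _ lim] always_eventually) auto
    from tendsto_diff[OF z this] show ?thesis by simp
  qed
  then have "(THE z. \<exists>u'\<in>gns_class \<phi> u. \<exists>v'\<in>gns_class \<phi> v. (\<lambda>n. \<phi> (adj (v' n) * u' n)) \<longlonglongrightarrow> z) = z"
    using class_self[OF u] class_self[OF v] by (intro the_equality) (auto intro: LIMSEQ_unique)
  then show ?thesis using z by (simp add: gns_space_def)
qed

lemma vnorm_class:
  assumes u: "u \<in> gns_Cauchy \<phi>"
  shows "(\<lambda>n. q (u n)) \<longlonglongrightarrow> vnorm H (gns_class \<phi> u)"
  unfolding vnorm_def gns_seminorm_def using inner_class[OF u u] by (intro tendsto_intros)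

lemma vnorm_ge_0 [simp]: "h \<in> vecs H \<Longrightarrow> 0 \<le> vnorm H h"
  by (elim vecsE) (auto intro!: LIMSEQ_le_const[OF vnorm_class])

lemma vnorm_0_imp_eq:
  assumes "u \<in> gns_Cauchy \<phi>" "v \<in> gns_Cauchy \<phi>" "vnorm H (gns_class \<phi> (\<lambda>n. u n - v n)) = 0"
  shows "gns_class \<phi> u = gns_class \<phi> v"
  using assms vnorm_class[OF gns_Cauchy_diff[OF assms(1,2)]] class_eq_iff by simp

section \<open>Multiplication operators\<close>

definition multop :: "(nat \<Rightarrow> 'a \<Rightarrow>\<^sub>C complex) \<Rightarrow>
    (nat \<Rightarrow> 'a \<Rightarrow>\<^sub>C complex) set \<Rightarrow> (nat \<Rightarrow> 'a \<Rightarrow>\<^sub>C complex) set" where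
  "multop k = (\<lambda>h\<in>vecs H. \<Union>u\<in>h. gns_class \<phi> (\<lambda>n. k n * u n))"

lemma multop_class:
  assumes "multiplier k" "u \<in> gns_Cauchy \<phi>"
  shows "multop k (gns_class \<phi> u) = gns_class \<phi> (\<lambda>n. k n * u n)"
  using multiplier_class[OF assms] assms by (simp add: multop_def class_in_vecs)

lemma gns_rep_eq_multop: "gns_rep \<phi> a = multop (\<lambda>_. a)"
  by (simp add: gns_rep_def multop_def)

lemma multop_bounded_ops [intro]:
  assumes k: "multiplier k"
  shows "multop k \<in> bounded_ops H"
  unfolding bounded_ops_def
proof (intro CollectI conjI allI ballI)
  show "multop k \<in> vecs H \<rightarrow>\<^sub>E vecs H"
  proof
    fix h assume "h \<in> vecs H"
    then show "multop k h \<in> vecs H"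
      using k by (elim vecsE) (auto simp: multop_class)
  qed (simp add: multop_def)
next
  fix h h' assume "h \<in> vecs H" "h' \<in> vecs H"
  then obtain u v where "u \<in> gns_Cauchy \<phi>" "h = gns_class \<phi> u" "v \<in> gns_Cauchy \<phi>" "h' = gns_class \<phi> v"
    by (meson vecsE)
  then show "multop k (vadd H h h') = vadd H (multop k h) (multop k h')"
    using k by (simp add: vadd_class multop_class gns_Cauchy_add multiplier_Cauchy ring_distribs)
next
  fix c h assume "h \<in> vecs H"
  then obtain u where "u \<in> gns_Cauchy \<phi>" "h = gns_class \<phi> u" by (rule vecsE)
  then show "multop k (vscale H c h) = vscale H c (multop k h)"
    using k by (simp add: vscale_class multop_class gns_Cauchy_mult_left multiplier_Cauchy mult.left_commute)
next
  obtain C where C: "C > 0" "\<And>n. norm (k n) \<le> C" by (rule multiplier_bound[OF k]) blast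
  have "vnorm H (multop k h) \<le> C * vnorm H h" if "h \<in> vecs H" for h
  proof -
    obtain u where u: "u \<in> gns_Cauchy \<phi>" "h = gns_class \<phi> u" using \<open>h \<in> vecs H\<close> by (rule vecsE)
    have "q (k n * u n) \<le> C * q (u n)" for n
      using order_trans[OF q_mult mult_right_mono[OF C(2)]] by simp
    then show ?thesis
      using vnorm_class[OF multiplier_Cauchy[OF k u(1)]] tendsto_mult[OF tendsto_const vnorm_class[OF u(1)], of C]
      by (auto simp: u(2) multop_class[OF k u(1)] intro: LIMSEQ_le)
  qed
  then show "\<exists>K. \<forall>h\<in>vecs H. vnorm H (multop k h) \<le> K * vnorm H h" by blast
qed

text \<open>Commutativity of the algebra places its image inside its own commutant; hence elements
  of the bicommutant commute with every \<open>gns_rep \<phi> a\<close>.\<close>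

lemma gns_rep_in_commutant: "gns_rep \<phi> a \<in> commutant H (range (gns_rep \<phi>))"
  unfolding commutant_def
proof (intro CollectI conjI ballI)
  show "gns_rep \<phi> a \<in> bounded_ops H" by (simp add: gns_rep_eq_multop multop_bounded_ops)
  fix U h assume "U \<in> range (gns_rep \<phi>)" "h \<in> vecs H"
  then show "gns_rep \<phi> a (U h) = U (gns_rep \<phi> a h)"
    by (elim vecsE rangeE) (simp add: gns_rep_class gns_Cauchy_mult_left mult.left_commute)
qed

text \<open>A multiplication operator is the strong limit of the operators representing the terms of its
  multiplier, which is why it lies in the bicommutant.\<close>

lemma multop_in_bicommutant:
  assumes k: "multiplier k"
  shows "multop k \<in> commutant H (commutant H (range (gns_rep \<phi>)))"
  unfolding commutant_def[of _ "commutant H (range (gns_rep \<phi>))"]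
proof (intro CollectI conjI ballI)
  show "multop k \<in> bounded_ops H" using k by blast
  fix T h assume T: "T \<in> commutant H (range (gns_rep \<phi>))" and h: "h \<in> vecs H"
  have Tb: "T \<in> vecs H \<rightarrow>\<^sub>E vecs H"
    "\<And>h k. h \<in> vecs H \<Longrightarrow> k \<in> vecs H \<Longrightarrow> T (vadd H h k) = vadd H (T h) (T k)"
    "\<And>c h. h \<in> vecs H \<Longrightarrow> T (vscale H c h) = vscale H c (T h)"
    and Tc: "\<And>a h. h \<in> vecs H \<Longrightarrow> T (gns_rep \<phi> a h) = gns_rep \<phi> a (T h)"
    using T by (auto simp: commutant_def bounded_ops_def)
  obtain K0 where "\<forall>h\<in>vecs H. vnorm H (T h) \<le> K0 * vnorm H h"
    using T by (auto simp: commutant_def bounded_ops_def)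
  \<comment> \<open>The bound supplied by \<open>bounded_ops\<close> may be zero or negative; it is
    enlarged to a positive one.\<close>
  moreover define K where "K = \<bar>K0\<bar> + 1"
  moreover have "K0 * vnorm H h \<le> K * vnorm H h" if "h \<in> vecs H" for h
    unfolding K_def using that by (intro mult_right_mono) auto
  ultimately have K: "K > 0" "\<And>h. h \<in> vecs H \<Longrightarrow> vnorm H (T h) \<le> K * vnorm H h"
    by (auto intro: order_trans)
  have Tvecs: "T h \<in> vecs H" if "h \<in> vecs H" for h using that Tb(1) by blast
  obtain u where u: "u \<in> gns_Cauchy \<phi>" "h = gns_class \<phi> u" using h by (rule vecsE)
  obtain w where w: "w \<in> gns_Cauchy \<phi>" "T h = gns_class \<phi> w" using Tvecs[OF h] by (rule vecsE)
  obtain t where t: "t \<in> gns_Cauchy \<phi>" "T (multop k h) = gns_class \<phi> t"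
  proof -
    have "multop k h \<in> vecs H" using k u by (simp add: multop_class class_in_vecs multiplier_Cauchy)
    from Tvecs[OF this] show thesis by (rule vecsE) (rule that)
  qed
  have kw: "(\<lambda>n. k n * w n) \<in> gns_Cauchy \<phi>" and ku: "(\<lambda>n. k n * u n) \<in> gns_Cauchy \<phi>"
    using k u w by auto
  \<comment> \<open>Let \<open>a\<close> be a late term of the multiplier, so that \<open>T\<close>
    commutes with \<open>gns_rep \<phi> a\<close>. The difference of \<open>T (multop k h)\<close>
    and \<open>multop k (T h)\<close> splits into \<open>T\<close> applied to
    \<open>(k - a) u\<close>, of norm at most \<open>K * e\<close>, and \<open>(a - k) w\<close>, of
    norm at most \<open>e\<close>.\<close>
  have key: "vnorm H (gns_class \<phi> (\<lambda>n. t n - k n * w n)) \<le> (K + 1) * e" if e: "e > 0" for e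
  proof -
    obtain N1 where N1: "\<And>m n. m \<ge> N1 \<Longrightarrow> n \<ge> N1 \<Longrightarrow> q ((k m - k n) * u n) \<le> e"
      using multiplier_tail[OF k u(1) e] by metis
    obtain N2 where N2: "\<And>m n. m \<ge> N2 \<Longrightarrow> n \<ge> N2 \<Longrightarrow> q ((k m - k n) * w n) \<le> e"
      using multiplier_tail[OF k w(1) e] by metis
    define a where "a = k (max N1 N2)"
    have au: "(\<lambda>n. k n * u n - a * u n) \<in> gns_Cauchy \<phi>" using ku u by auto
    have aw: "(\<lambda>n. a * w n - k n * w n) \<in> gns_Cauchy \<phi>" using kw w by auto
    have ta: "(\<lambda>n. t n - a * w n) \<in> gns_Cauchy \<phi>" using t w by auto
    have 1: "vnorm H (gns_class \<phi> (\<lambda>n. k n * u n - a * u n)) \<le> e"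
    proof (rule LIMSEQ_le_const2[OF vnorm_class[OF au]], intro exI allI impI)
      fix n assume "n \<ge> max N1 N2"
      then have "q ((a - k n) * u n) \<le> e" unfolding a_def by (intro N1) auto
      then show "q (k n * u n - a * u n) \<le> e"
        by (subst q_commute) (simp only: left_diff_distrib)
    qed
    have 2: "vnorm H (gns_class \<phi> (\<lambda>n. a * w n - k n * w n)) \<le> e"
    proof (rule LIMSEQ_le_const2[OF vnorm_class[OF aw]], intro exI allI impI)
      fix n assume "n \<ge> max N1 N2"
      then have "q ((a - k n) * w n) \<le> e" unfolding a_def by (intro N2) auto
      then show "q (a * w n - k n * w n) \<le> e"
        by (simp only: left_diff_distrib)
    qed
    have "T (gns_class \<phi> (\<lambda>n. k n * u n - a * u n)) = gns_class \<phi> (\<lambda>n. t n - a * w n)"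
    proof -
      have "gns_class \<phi> (\<lambda>n. k n * u n - a * u n) =
          vadd H (multop k h) (vscale H (- 1) (gns_rep \<phi> a h))"
        using u k ku by (simp add: multop_class gns_rep_class vscale_class vadd_class
            gns_Cauchy_mult_left gns_Cauchy_minus)
      also have "T \<dots> = vadd H (T (multop k h)) (vscale H (- 1) (gns_rep \<phi> a (T h)))"
      proof -
        have "multop k h \<in> vecs H" "gns_rep \<phi> a h \<in> vecs H" "vscale H (- 1) (gns_rep \<phi> a h) \<in> vecs H"
          using u k ku by (auto simp: multop_class gns_rep_class vscale_class gns_Cauchy_mult_left
              gns_Cauchy_minus)
        then show ?thesis by (simp only: Tb(2,3) Tc[OF h])
      qed
      also have "\<dots> = gns_class \<phi> (\<lambda>n. t n - a * w n)"
        using t w by (simp add: gns_rep_class vscale_class vadd_class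
            gns_Cauchy_mult_left gns_Cauchy_minus)
      finally show ?thesis .
    qed
    then have 3: "vnorm H (gns_class \<phi> (\<lambda>n. t n - a * w n)) \<le> K * e"
      using order_trans[OF K(2)[OF class_in_vecs[OF au]] mult_left_mono[OF 1 less_imp_le[OF K(1)]]]
      by (simp only:)
    have "vnorm H (gns_class \<phi> (\<lambda>n. t n - k n * w n)) \<le>
      vnorm H (gns_class \<phi> (\<lambda>n. t n - a * w n)) + vnorm H (gns_class \<phi> (\<lambda>n. a * w n - k n * w n))"
      by (rule LIMSEQ_le[OF vnorm_class[OF gns_Cauchy_diff[OF t(1) kw]]
            tendsto_add[OF vnorm_class[OF ta] vnorm_class[OF aw]]])
        (intro exI[of _ 0] allI impI q_triangle_diff)
    also have "\<dots> \<le> K * e + e" by (rule add_mono[OF 3 2])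
    finally show ?thesis by (simp only: distrib_right mult_1)
  qed
  have "vnorm H (gns_class \<phi> (\<lambda>n. t n - k n * w n)) \<le> 0" (is "?z \<le> 0")
  proof (rule field_le_epsilon)
    fix e :: real assume "e > 0"
    then have "e / (K + 1) > 0" "(K + 1) * (e / (K + 1)) = e" using K(1) by auto
    then show "?z \<le> 0 + e"
      using key[of "e / (K + 1)"] by (simp only: add_0)
  qed
  then have "gns_class \<phi> t = gns_class \<phi> (\<lambda>n. k n * w n)"
    using t kw vnorm_ge_0[OF class_in_vecs[OF gns_Cauchy_diff[OF t(1) kw]]]
    by (intro vnorm_0_imp_eq) auto
  then show "multop k (T h) = T (multop k h)"
    using t w k by (simp add: multop_class)
qed

end

subsection \<open>Approximate kernels\<close>

text \<open>A unital positive map seen as a continuous field of states. Having a state at each point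
  reduces complete positivity to one point at a time.\<close>

definition markov :: "(('a::topological_space \<Rightarrow>\<^sub>C complex) \<Rightarrow> 'a \<Rightarrow>\<^sub>C complex) \<Rightarrow> bool" where
  "markov k \<longleftrightarrow> (\<forall>x. (\<lambda>f. apply_bcontfun (k f) x) \<in> state_space)"

lemma markov_state: "markov k \<Longrightarrow> state (\<lambda>f. apply_bcontfun (k f) x)"
  by (simp add: markov_def state_def)

lemma markov_add: "markov k \<Longrightarrow> k (a + b) = k a + k b"
  using state.add[OF markov_state] by (intro bcontfun_eqI) simp

lemma markov_diff: "markov k \<Longrightarrow> k (a - b) = k a - k b"
  using state.diff[OF markov_state] by (intro bcontfun_eqI) simp

lemma markov_scale: "markov k \<Longrightarrow> k (const_bcontfun c * a) = const_bcontfun c * k a"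
  using state.scale[OF markov_state] by (intro bcontfun_eqI) simp

lemma markov_one: "markov k \<Longrightarrow> k 1 = 1"
  using state.one[OF markov_state] by (intro bcontfun_eqI) simp

lemma norm_markov_le: "markov k \<Longrightarrow> norm (k a) \<le> norm a"
  using state.norm_le[OF markov_state] by (intro norm_bound) auto

lemma sum_nonneg_Reals:
  fixes g :: "'i \<Rightarrow> complex"
  shows "(\<And>i. i \<in> I \<Longrightarrow> g i \<in> \<real>\<^sub>\<ge>\<^sub>0) \<Longrightarrow> sum g I \<in> \<real>\<^sub>\<ge>\<^sub>0"
  by (induction I rule: infinite_finite_induct) auto

text \<open>The limit of \<open>k n f\<close> is in general not continuous, so the kernel is kept as
  a sequence. The Markov property bounds it uniformly, which turns a mean-square Cauchy sequence
  into a multiplier.\<close>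

locale approximate_kernel = state \<phi> for \<phi> :: "'a::topological_space functional" +
  fixes k :: "nat \<Rightarrow> ('a \<Rightarrow>\<^sub>C complex) \<Rightarrow> 'a \<Rightarrow>\<^sub>C complex"
  assumes markov: "markov (k n)"
    and Cauchy: "(\<lambda>n. k n f) \<in> gns_Cauchy \<phi>"
begin

lemma multiplier: "multiplier (\<lambda>n. k n f)"
  unfolding multiplier_def using Cauchy norm_markov_le[OF markov] by blast

lemma convergent: "convergent (\<lambda>n. \<phi> (k n f))"
  using inner_convergent[OF Cauchy[of f] gns_Cauchy_const[of 1]] by simp

lemma limit: "(\<lambda>n. \<phi> (k n f)) \<longlonglongrightarrow> lim (\<lambda>n. \<phi> (k n f))"
  using convergent convergent_LIMSEQ_iff by blast

lemma limit_state: "(\<lambda>f. lim (\<lambda>n. \<phi> (k n f))) \<in> state_space"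
  unfolding state_space_def
proof (intro CollectI conjI allI)
  fix a b c
  show "lim (\<lambda>n. \<phi> (k n (a + b))) = lim (\<lambda>n. \<phi> (k n a)) + lim (\<lambda>n. \<phi> (k n b))"
    using tendsto_add[OF limit[of a] limit[of b]] by (intro limI) (simp add: markov_add[OF markov])
  show "lim (\<lambda>n. \<phi> (k n (const_bcontfun c * a))) = c * lim (\<lambda>n. \<phi> (k n a))"
    using tendsto_mult_left[OF limit[of a]] by (intro limI) (simp add: markov_scale[OF markov])
  have "\<phi> (k n (adj a * a)) \<in> \<real>\<^sub>\<ge>\<^sub>0" for n
    using state.pos_square[OF markov_state[OF markov]] by (intro positive)
  then show "lim (\<lambda>n. \<phi> (k n (adj a * a))) \<in> \<real>\<^sub>\<ge>\<^sub>0"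
    by (intro Lim_in_closed_set[OF closed_nonneg_Reals_complex _ _ limit]) auto
  show "lim (\<lambda>n. \<phi> (k n 1)) = 1"
    by (intro limI) (simp add: markov_one[OF markov])
qed

text \<open>A positive matrix over a commutative algebra stays positive after a state is applied to
  its entries, which gives complete positivity pointwise, before taking limits.\<close>

lemma ucp: "ucp_map H (\<lambda>f. multop (\<lambda>n. k n f))"
  unfolding ucp_map_def
proof (intro conjI allI ballI impI)
  fix a show "multop (\<lambda>n. k n a) \<in> bounded_ops H"
    using multiplier by blast
next
  fix a b h assume "h \<in> vecs H"
  then show "multop (\<lambda>n. k n (a + b)) h = vadd H (multop (\<lambda>n. k n a) h) (multop (\<lambda>n. k n b) h)"
    using multiplier[of "a + b"]
    by (elim vecsE) (simp add: multop_class multiplier vadd_class multiplier_Cauchy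
        markov_add[OF markov] distrib_right)
next
  fix c a h assume "h \<in> vecs H"
  then show "multop (\<lambda>n. k n (const_bcontfun c * a)) h = vscale H c (multop (\<lambda>n. k n a) h)"
    using multiplier[of "const_bcontfun c * a"]
    by (elim vecsE) (simp add: multop_class multiplier vscale_class multiplier_Cauchy
        markov_scale[OF markov] mult.assoc)
next
  fix h assume "h \<in> vecs H"
  then show "multop (\<lambda>n. k n 1) h = h"
    by (elim vecsE) (simp add: multop_class multiplier markov_one[OF markov])
next
  fix d x assume "pos_matrix d (x :: nat \<Rightarrow> nat \<Rightarrow> 'a \<Rightarrow>\<^sub>C complex)"
  then obtain b where x: "\<And>i j. i < d \<Longrightarrow> j < d \<Longrightarrow> x i j = (\<Sum>l<d. adj (b l i) * b l j)"
    unfolding pos_matrix_def by blast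
  show "pos_op_matrix H d (\<lambda>i j. multop (\<lambda>n. k n (x i j)))"
    unfolding pos_op_matrix_def
  proof (intro allI impI)
    fix h assume "\<forall>i<d. h i \<in> vecs H"
    then have "\<forall>i. \<exists>w. i < d \<longrightarrow> w \<in> gns_Cauchy \<phi> \<and> h i = gns_class \<phi> w"
      using vecs_iff by blast
    from choice[OF this] obtain u
      where u: "\<And>i. i < d \<Longrightarrow> u i \<in> gns_Cauchy \<phi>" "\<And>i. i < d \<Longrightarrow> h i = gns_class \<phi> (u i)"
      by blast
    \<comment> \<open>\<open>\<phi> (F n)\<close> is the quadratic form of the operator matrix
      before the limit, so it suffices that \<open>F n\<close> is pointwise nonnegative.\<close>
    define F where "F n = (\<Sum>i<d. \<Sum>j<d. adj (u i n) * (k n (x i j) * u j n))" for n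
    have "(\<lambda>n. \<Sum>i<d. \<Sum>j<d. \<phi> (adj (u i n) * (k n (x i j) * u j n)))
        \<longlonglongrightarrow> (\<Sum>i<d. \<Sum>j<d. vinner H (multop (\<lambda>n. k n (x i j)) (h j)) (h i))"
    proof (intro tendsto_sum)
      fix i j assume "i \<in> {..<d}" "j \<in> {..<d}"
      then show "(\<lambda>n. \<phi> (adj (u i n) * (k n (x i j) * u j n))) \<longlonglongrightarrow>
          vinner H (multop (\<lambda>n. k n (x i j)) (h j)) (h i)"
        using inner_class[OF multiplier_Cauchy[OF multiplier u(1)] u(1)]
        by (simp add: u multop_class multiplier)
    qed
    then have lim: "(\<lambda>n. \<phi> (F n)) \<longlonglongrightarrow>
        (\<Sum>i<d. \<Sum>j<d. vinner H (multop (\<lambda>n. k n (x i j)) (h j)) (h i))"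
      by (simp add: F_def)
    have "apply_bcontfun (F n) y \<in> \<real>\<^sub>\<ge>\<^sub>0" for n y
    proof -
      define \<kappa> where "\<kappa> = (\<lambda>f. apply_bcontfun (k n f) y)"
      interpret \<kappa>: state \<kappa> unfolding \<kappa>_def by (rule markov_state[OF markov])
      define v where "v i = apply_bcontfun (u i n) y" for i
      \<comment> \<open>At the point \<open>y\<close> the vectors are plain numbers
        \<open>v j\<close>. With \<open>c = b v\<close>, the quadratic form of the positive matrix
        becomes the sum of the squares of the \<open>c l\<close>.\<close>
      define c where "c l = (\<Sum>j<d. const_bcontfun (v j) * b l j)" for l
      have "apply_bcontfun (F n) y = (\<Sum>i<d. \<Sum>j<d. cnj (v i) * v j * \<kappa> (x i j))"
        by (simp add: F_def v_def \<kappa>_def mult_ac)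
      also have "\<dots> = \<kappa> (\<Sum>i<d. \<Sum>j<d. const_bcontfun (cnj (v i) * v j) * x i j)"
        by simp
      also have "(\<Sum>i<d. \<Sum>j<d. const_bcontfun (cnj (v i) * v j) * x i j) = (\<Sum>l<d. adj (c l) * c l)"
      proof (rule bcontfun_eqI)
        fix z
        define B where "B l j = apply_bcontfun (b l j) z" for l j
        have "(\<Sum>i<d. \<Sum>j<d. cnj (v i) * v j * (\<Sum>l<d. cnj (B l i) * B l j)) =
            (\<Sum>i<d. \<Sum>j<d. \<Sum>l<d. (cnj (v i) * cnj (B l i)) * (v j * B l j))"
          by (simp add: sum_distrib_left mult_ac)
        also have "\<dots> = (\<Sum>i<d. \<Sum>l<d. \<Sum>j<d. (cnj (v i) * cnj (B l i)) * (v j * B l j))"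
          by (intro sum.cong refl sum.swap)
        also have "\<dots> = (\<Sum>l<d. \<Sum>i<d. \<Sum>j<d. (cnj (v i) * cnj (B l i)) * (v j * B l j))"
          by (rule sum.swap)
        also have "\<dots> = (\<Sum>l<d. (\<Sum>i<d. cnj (v i) * cnj (B l i)) * (\<Sum>j<d. v j * B l j))"
          by (simp add: sum_product)
        finally show "apply_bcontfun (\<Sum>i<d. \<Sum>j<d. const_bcontfun (cnj (v i) * v j) * x i j) z =
            apply_bcontfun (\<Sum>l<d. adj (c l) * c l) z"
          by (simp add: x c_def B_def)
      qed
      finally have "apply_bcontfun (F n) y = (\<Sum>l<d. \<kappa> (adj (c l) * c l))" by simp
      then show ?thesis
        using sum_nonneg_Reals[of "{..<d}" "\<lambda>l. \<kappa> (adj (c l) * c l)"] \<kappa>.pos_square by simp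
    qed
    then have "\<phi> (F n) \<in> \<real>\<^sub>\<ge>\<^sub>0" for n by (rule positive)
    then show "(\<Sum>i<d. \<Sum>j<d. vinner H (multop (\<lambda>n. k n (x i j)) (h j)) (h i)) \<in> \<real>\<^sub>\<ge>\<^sub>0"
      by (intro Lim_in_closed_set[OF closed_nonneg_Reals_complex _ _ lim]) auto
  qed
qed

text \<open>The limit operators must agree with \<open>gns_rep \<phi> s\<close> on every vector. The
  first assumption concerns only the cyclic vector; \<open>null_multiplier\<close> carries it to all
  others.\<close>

theorem strong_dilation:
  assumes S: "\<And>s. s \<in> S \<Longrightarrow> (\<lambda>n. q (k n s - s)) \<longlonglongrightarrow> 0"
    and \<psi>: "\<And>f. (\<lambda>n. \<phi> (k n f)) \<longlonglongrightarrow> \<psi> f"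
  shows "strong_dilation_le S \<phi> \<psi>"
  unfolding strong_dilation_le_def dilates_def
proof (intro exI[of _ "\<lambda>f. multop (\<lambda>n. k n f)"] conjI ballI allI)
  show "ucp_map H (\<lambda>f. multop (\<lambda>n. k n f))" by (rule ucp)
  show "range (\<lambda>f. multop (\<lambda>n. k n f)) \<subseteq> commutant H (commutant H (range (gns_rep \<phi>)))"
    using multop_in_bicommutant[OF multiplier] by blast
  show "multop (\<lambda>n. k n s) = gns_rep \<phi> s" if s: "s \<in> S" for s
  proof
    fix h
    show "multop (\<lambda>n. k n s) h = gns_rep \<phi> s h"
    proof (cases "h \<in> vecs H")
      case True
      then obtain u where u: "u \<in> gns_Cauchy \<phi>" "h = gns_class \<phi> u" by (rule vecsE)
      have 1: "multiplier (\<lambda>n. k n s - s)"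
      proof -
        have "norm (k n s - s) \<le> norm s + norm s" for n
          using norm_triangle_ineq4[of "k n s" s] norm_markov_le[OF markov, of n s] by linarith
        then show ?thesis using Cauchy[of s] by (auto simp: multiplier_def)
      qed
      have "(\<lambda>n. q ((k n s - s) * u n)) \<longlonglongrightarrow> 0"
        by (rule null_multiplier[OF 1 S[OF s] u(1)])
      then show ?thesis
        using u by (simp add: multop_class[OF multiplier] gns_rep_class class_eq_iff multiplier_Cauchy[OF multiplier]
            gns_Cauchy_mult_left left_diff_distrib)
    qed (simp add: multop_def gns_rep_def)
  qed
  show "\<psi> f = vinner H (multop (\<lambda>n. k n f) (gns_vec \<phi>)) (gns_vec \<phi>)" for f
    using LIMSEQ_unique[OF \<psi>] inner_class[OF Cauchy[of f] gns_Cauchy_const[of 1]]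
    by (simp add: gns_vec_def multop_class[OF multiplier])
qed

end

subsection \<open>The Hahn--Banach theorem\<close>

definition sublinear :: "('v::real_vector \<Rightarrow> real) \<Rightarrow> bool" where
  "sublinear p \<longleftrightarrow> (\<forall>x y. p (x + y) \<le> p x + p y) \<and> (\<forall>c>0. \<forall>x. p (c *\<^sub>R x) = c * p x)"

lemma sublinearI:
  assumes "\<And>x y. p (x + y) \<le> p x + p y" "\<And>c x. c > 0 \<Longrightarrow> p (c *\<^sub>R x) \<le> c * p x"
  shows "sublinear p"
proof -
  have "c * p x \<le> p (c *\<^sub>R x)" if "c > 0" for c x
    using assms(2)[of "1 / c" "c *\<^sub>R x"] that by (simp add: field_simps)
  then show ?thesis using assms unfolding sublinear_def by (meson order_antisym)
qed

lemma sublinear_add: "sublinear p \<Longrightarrow> p (x + y) \<le> p x + p y"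
  and sublinear_scale: "sublinear p \<Longrightarrow> c > 0 \<Longrightarrow> p (c *\<^sub>R x) = c * p x"
  by (auto simp: sublinear_def)

lemma sublinear_zero: "sublinear p \<Longrightarrow> p 0 = 0"
  using sublinear_scale[of p 2 0] by simp

lemma sublinear_lower: "sublinear p \<Longrightarrow> - p (- x) \<le> p x"
  using sublinear_add[of p x "- x"] sublinear_zero[of p] by simp

text \<open>A minimal sublinear functional is linear: for fixed \<open>y\<close>, the functional
  \<open>x \<mapsto> inf\<^sub>t (r (x + t y) - t r(y))\<close> is sublinear and below \<open>r\<close>, hence equal to \<open>r\<close>.\<close>

theorem hahn_banach:
  fixes p :: "'v::real_vector \<Rightarrow> real"
  assumes p: "sublinear p"
  obtains l where "linear l" "\<And>x. l x \<le> p x"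
proof -
  define A where "A = {r. sublinear r \<and> r \<le> p}"
  \<comment> \<open>The order is reversed, so the maximal element supplied by Zorn's lemma is a
    minimal sublinear functional.\<close>
  define R where "R = (\<lambda>r s :: 'v \<Rightarrow> real. s \<le> r)"
  have "\<exists>m\<in>A. \<forall>r\<in>A. R m r \<longrightarrow> r = m"
  proof (rule predicate_Zorn)
    show "partial_order_on A (relation_of R A)"
      by (rule partial_order_on_relation_ofI) (auto simp: R_def)
    fix C assume C: "C \<in> Chains (relation_of R A)"
    show "\<exists>u\<in>A. \<forall>a\<in>C. R a u"
    proof (cases "C = {}")
      case True
      then show ?thesis using p by (auto simp: A_def)
    next
      case False
      have CA: "\<And>r. r \<in> C \<Longrightarrow> sublinear r" "\<And>r x. r \<in> C \<Longrightarrow> r x \<le> p x"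
        and total: "\<And>r s. r \<in> C \<Longrightarrow> s \<in> C \<Longrightarrow> r \<le> s \<or> s \<le> r"
        using C by (auto simp: Chains_def relation_of_def A_def R_def le_fun_def)
      define u where "u x = (INF r\<in>C. r x)" for x
      have bdd: "bdd_below ((\<lambda>r. r x) ` C)" for x
      proof (rule bdd_belowI2)
        fix r assume "r \<in> C"
        then show "- p (- x) \<le> r x"
          using sublinear_lower[of r x] CA(1)[of r] CA(2)[of r "- x"] by linarith
      qed
      have ur: "u x \<le> r x" if "r \<in> C" for r x
        unfolding u_def using bdd that by (rule cINF_lower)
      have "sublinear u"
      proof (rule sublinearI)
        fix x y
        show "u (x + y) \<le> u x + u y"
        proof (rule field_le_epsilon)
          fix e :: real assume "e > 0"
          obtain r where r: "r \<in> C" "r x < u x + e / 2"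
            using cINF_less_iff[OF False bdd, of x "u x + e / 2"] \<open>e > 0\<close> unfolding u_def by auto
          obtain s where s: "s \<in> C" "s y < u y + e / 2"
            using cINF_less_iff[OF False bdd, of y "u y + e / 2"] \<open>e > 0\<close> unfolding u_def by auto
          \<comment> \<open>A chain is totally ordered, so the smaller of \<open>r\<close> and
            \<open>s\<close> is nearly infimal at both points.\<close>
          obtain t where t: "t \<in> C" "t x \<le> r x" "t y \<le> s y"
            using total[OF r(1) s(1)] r s by (metis le_fun_def order_refl)
          show "u (x + y) \<le> u x + u y + e"
            using ur[OF t(1), of "x + y"] sublinear_add[OF CA(1)[OF t(1)], of x y] r s t by linarith
        qed
      next
        fix c :: real and x assume c: "c > 0"
        have "u (c *\<^sub>R x) / c \<le> u x"
          unfolding u_def[of x] using False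
        proof (rule cINF_greatest)
          fix r assume "r \<in> C"
          then show "u (c *\<^sub>R x) / c \<le> r x"
            using ur[of r "c *\<^sub>R x"] sublinear_scale[OF CA(1) c, of r x] c by (simp add: field_simps)
        qed
        then show "u (c *\<^sub>R x) \<le> c * u x" using c by (simp add: field_simps)
      qed
      moreover have "u \<le> p"
        using False ur CA(2) by (metis all_not_in_conv le_funI order_trans)
      ultimately show ?thesis using ur by (auto simp: A_def R_def le_fun_def)
    qed
  qed
  then obtain r where rA: "r \<in> A" and rmin: "\<And>s. s \<in> A \<Longrightarrow> R r s \<Longrightarrow> s = r" by blast
  then have r: "sublinear r" "\<And>x. r x \<le> p x" by (auto simp: A_def le_fun_def)
  have min: "s = r" if "sublinear s" "\<And>x. s x \<le> r x" for s
    using that r order_trans[OF that(2) r(2)] by (intro rmin) (auto simp: A_def R_def le_fun_def)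
  have "r x + r y \<le> r (x + y)" for x y
  proof -
    define s where "s x = (INF t\<in>{0::real..}. r (x + t *\<^sub>R y) - t * r y)" for x
    have bdd: "bdd_below ((\<lambda>t. r (x + t *\<^sub>R y) - t * r y) ` {0..})" for x
    proof (rule bdd_belowI2)
      fix t :: real assume "t \<in> {0..}"
      then have "r (t *\<^sub>R y) = t * r y"
        using sublinear_scale[OF r(1), of t y] sublinear_zero[OF r(1)] by (cases "t = 0") auto
      then show "- r (- x) \<le> r (x + t *\<^sub>R y) - t * r y"
        using sublinear_add[OF r(1), of "x + t *\<^sub>R y" "- x"] by simp
    qed
    have s_le: "s x \<le> r (x + t *\<^sub>R y) - t * r y" if "t \<ge> 0" for x t
      unfolding s_def using bdd by (rule cINF_lower) (use that in auto)
    have "sublinear s"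
    proof (rule sublinearI)
      fix a b
      show "s (a + b) \<le> s a + s b"
      proof (rule field_le_epsilon)
        fix e :: real assume "e > 0"
        obtain t where t: "t \<ge> 0" "r (a + t *\<^sub>R y) - t * r y < s a + e / 2"
          using cINF_less_iff[OF _ bdd, of a "s a + e / 2"] \<open>e > 0\<close> unfolding s_def by auto
        obtain t' where t': "t' \<ge> 0" "r (b + t' *\<^sub>R y) - t' * r y < s b + e / 2"
          using cINF_less_iff[OF _ bdd, of b "s b + e / 2"] \<open>e > 0\<close> unfolding s_def by auto
        have "r ((a + b) + (t + t') *\<^sub>R y) \<le> r (a + t *\<^sub>R y) + r (b + t' *\<^sub>R y)"
          using sublinear_add[OF r(1), of "a + t *\<^sub>R y" "b + t' *\<^sub>R y"] by (simp add: algebra_simps)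
        then show "s (a + b) \<le> s a + s b + e"
          using s_le[of "t + t'" "a + b"] t t' by (simp add: algebra_simps)
      qed
    next
      fix c :: real and a assume c: "c > 0"
      have "s (c *\<^sub>R a) / c \<le> s a"
        unfolding s_def[of a]
      proof (rule cINF_greatest)
        fix t :: real assume t: "t \<in> {0..}"
        have "r (c *\<^sub>R a + (c * t) *\<^sub>R y) = c * r (a + t *\<^sub>R y)"
          using sublinear_scale[OF r(1) c, of "a + t *\<^sub>R y"] by (simp add: algebra_simps)
        then show "s (c *\<^sub>R a) / c \<le> r (a + t *\<^sub>R y) - t * r y"
          using s_le[of "c * t" "c *\<^sub>R a"] c t by (simp add: field_simps)
      qed auto
      then show "s (c *\<^sub>R a) \<le> c * s a" using c by (simp add: field_simps)
    qed
    moreover have "s x \<le> r x" for x using s_le[of 0 x] by simp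
    ultimately have "s = r" by (rule min)
    \<comment> \<open>Minimality gives \<open>r x = s x\<close>, and \<open>t = 1\<close> in the
      infimum bounds this by \<open>r (x + y) - r y\<close>: superadditivity.\<close>
    then show ?thesis using s_le[of 1 x] by simp
  qed
  then have add: "r (x + y) = r x + r y" for x y
    using sublinear_add[OF r(1)] by (meson order_antisym)
  have "r (- x) = - r x" for x
    using add[of x "- x"] sublinear_zero[OF r(1)] by simp
  then have "r (c *\<^sub>R x) = c * r x" for c x
    using sublinear_scale[OF r(1), of c x] sublinear_scale[OF r(1), of "- c" "x"] sublinear_zero[OF r(1)]
    by (cases c "0::real" rule: linorder_cases) (auto simp: minus_equation_iff)
  then have "linear r" using add by (intro linearI) auto
  then show ?thesis using r(2) by (rule that)
qed

subsection \<open>Couplings\<close>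

locale borel_prob = prob_space \<mu> for \<mu> :: "'a::topological_space measure" +
  assumes sets_eq: "sets \<mu> = sets borel"
begin

lemma integrable_bcontfun [simp]:
  fixes f :: "'a \<Rightarrow>\<^sub>C 'b::{banach, second_countable_topology}"
  shows "integrable \<mu> (apply_bcontfun f)"
proof (rule integrable_const_bound)
  have "apply_bcontfun f \<in> borel_measurable borel"
    by (rule borel_measurable_continuous_onI) simp
  then show "apply_bcontfun f \<in> borel_measurable \<mu>"
    using measurable_cong_sets[OF sets_eq refl] by blast
  show "AE x in \<mu>. norm (apply_bcontfun f x) \<le> norm f"
    by (simp add: norm_bounded)
qed

lemma integral_bcontfun_mono:
  fixes f g :: "'a \<Rightarrow>\<^sub>C real"
  assumes "\<And>x. apply_bcontfun f x \<le> apply_bcontfun g x"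
  shows "(\<integral>x. apply_bcontfun f x \<partial>\<mu>) \<le> (\<integral>x. apply_bcontfun g x \<partial>\<mu>)"
  using assms by (intro integral_mono) auto

lemma integral_linear:
  fixes f g :: "'a \<Rightarrow>\<^sub>C 'b::{banach, second_countable_topology}"
  shows "(\<integral>x. apply_bcontfun (f + g) x \<partial>\<mu>) = (\<integral>x. apply_bcontfun f x \<partial>\<mu>) + (\<integral>x. apply_bcontfun g x \<partial>\<mu>)"
    "(\<integral>x. apply_bcontfun (c *\<^sub>R f) x \<partial>\<mu>) = c *\<^sub>R (\<integral>x. apply_bcontfun f x \<partial>\<mu>)"
    "(\<integral>x. apply_bcontfun (- f) x \<partial>\<mu>) = - (\<integral>x. apply_bcontfun f x \<partial>\<mu>)"
  by simp_all

lemma integral_square: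
  "(\<integral>x. apply_bcontfun (adj a * a) x \<partial>\<mu>) = of_real (\<integral>x. (cmod (apply_bcontfun a x))\<^sup>2 \<partial>\<mu>)"
proof -
  have "apply_bcontfun (adj a * a) x = of_real ((cmod (apply_bcontfun a x))\<^sup>2)" for x
    using complex_norm_square[of "apply_bcontfun a x"] by (simp add: mult.commute)
  then show ?thesis by (simp only: integral_complex_of_real)
qed

lemma state_of_state: "state_of \<mu> \<in> state_space"
  unfolding state_space_def state_of_def
proof (intro CollectI conjI allI)
  fix a :: "'a \<Rightarrow>\<^sub>C complex"
  show "(\<integral>x. apply_bcontfun (adj a * a) x \<partial>\<mu>) \<in> \<real>\<^sub>\<ge>\<^sub>0"
    by (simp only: integral_square nonneg_Reals_of_real_iff) simp
qed (simp_all add: prob_space)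

sublocale state "state_of \<mu>"
  by unfold_locales (rule state_of_state)

lemma state_of_of_real_fun: "state_of \<mu> (of_real_fun f) = of_real (\<integral>x. apply_bcontfun f x \<partial>\<mu>)"
  by (simp add: state_of_def)

end

section \<open>Functions on the product space\<close>

lift_definition tensor :: "('a::topological_space \<Rightarrow>\<^sub>C complex) \<Rightarrow> ('b::topological_space \<Rightarrow>\<^sub>C complex)
    \<Rightarrow> ('a \<times> 'b) \<Rightarrow>\<^sub>C complex"
  is "\<lambda>f g z. f (fst z) * g (snd z)"
proof -
  fix f :: "'a \<Rightarrow> complex" and g :: "'b \<Rightarrow> complex"
  assume f: "f \<in> bcontfun" and g: "g \<in> bcontfun"
  obtain B C where B: "\<And>x. norm (f x) \<le> B" and C: "\<And>x. norm (g x) \<le> C"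
    using f g by (auto simp: bcontfun_def bounded_iff)
  have "norm (f (fst z) * g (snd z)) \<le> B * C" for z
    by (meson B C mult_mono norm_ge_zero norm_mult_ineq order_trans)
  moreover have "continuous_on UNIV (\<lambda>z. f (fst z) * g (snd z))"
    using f g continuous_on_compose2[of UNIV f UNIV fst] continuous_on_compose2[of UNIV g UNIV snd]
    by (intro continuous_on_mult) (simp_all add: bcontfun_def continuous_on_fst continuous_on_snd)
  ultimately show "(\<lambda>z. f (fst z) * g (snd z)) \<in> bcontfun"
    by (intro bcontfun_normI)
qed

lift_definition diagonal :: "(('a::topological_space \<times> 'a) \<Rightarrow>\<^sub>C 'b::metric_space) \<Rightarrow> 'a \<Rightarrow>\<^sub>C 'b"
  is "\<lambda>G x. G (x, x)"
proof -
  fix G :: "'a \<times> 'a \<Rightarrow> 'b" assume G: "G \<in> bcontfun"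
  have "continuous_on UNIV (\<lambda>x. G (x, x))"
    using G continuous_on_compose2[of UNIV G UNIV "\<lambda>x. (x, x)"]
    by (simp add: bcontfun_def continuous_on_Pair)
  moreover have "bounded (range (\<lambda>x. G (x, x)))"
    by (rule bounded_subset[of "range G"]) (use G in \<open>auto simp: bcontfun_def\<close>)
  ultimately show "(\<lambda>x. G (x, x)) \<in> bcontfun" by (simp add: bcontfun_def)
qed

lift_definition pullback_snd :: "('b::topological_space \<Rightarrow>\<^sub>C 'c::metric_space) \<Rightarrow> ('a::topological_space \<times> 'b) \<Rightarrow>\<^sub>C 'c"
  is "\<lambda>f z. f (snd z)"
proof -
  fix f :: "'b \<Rightarrow> 'c" assume f: "f \<in> bcontfun"
  have "continuous_on UNIV (\<lambda>z :: 'a \<times> 'b. f (snd z))"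
    using f continuous_on_compose2[of UNIV f UNIV snd] by (simp add: bcontfun_def continuous_on_snd)
  moreover have "bounded (range (\<lambda>z :: 'a \<times> 'b. f (snd z)))"
    by (rule bounded_subset[of "range f"]) (use f in \<open>auto simp: bcontfun_def\<close>)
  ultimately show "(\<lambda>z :: 'a \<times> 'b. f (snd z)) \<in> bcontfun" by (simp add: bcontfun_def)
qed

lemmas [simp] = tensor.rep_eq diagonal.rep_eq pullback_snd.rep_eq

lemma real_elements_scale:
  assumes "function_system S" "s \<in> real_elements S"
  shows "const_bcontfun (of_real c) * s \<in> real_elements S"
  using assms by (auto simp: function_system_def real_elements_def)

lemma real_elements_uminus:
  assumes "function_system S" "s \<in> real_elements S"
  shows "- s \<in> real_elements S"
  using real_elements_scale[OF assms, of "- 1"] by simp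

lemma real_elements_add:
  assumes "function_system S" "s \<in> real_elements S" "t \<in> real_elements S"
  shows "s + t \<in> real_elements S"
  using assms by (auto simp: function_system_def real_elements_def)

lemma of_real_fun_Re_Im_in_real_elements:
  assumes "function_system S" "s \<in> S"
  shows "of_real_fun (Re_fun s) \<in> real_elements S" "of_real_fun (Im_fun s) \<in> real_elements S"
proof -
  have "of_real_fun (Re_fun s) = const_bcontfun (1 / 2) * (s + adj s)"
    "of_real_fun (Im_fun s) = const_bcontfun (- \<i> / 2) * (s + - adj s)"
    by (auto intro!: bcontfun_eqI simp: complex_eq_iff)
  moreover have "- adj s \<in> S"
  proof -
    have "const_bcontfun (- 1) * adj s \<in> S" using assms unfolding function_system_def by blast
    then show ?thesis by simp
  qed
  ultimately have "of_real_fun (Re_fun s) \<in> S" "of_real_fun (Im_fun s) \<in> S"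
    using assms unfolding function_system_def by metis+
  then show "of_real_fun (Re_fun s) \<in> real_elements S" "of_real_fun (Im_fun s) \<in> real_elements S"
    by (auto simp: real_elements_def)
qed

lemma ex_bcontfun_Max:
  fixes F :: "('a::topological_space \<Rightarrow>\<^sub>C complex) set"
  assumes "finite F" "F \<noteq> {}"
  shows "\<exists>f :: 'a \<Rightarrow>\<^sub>C real. \<forall>x. apply_bcontfun f x = Max ((\<lambda>s. Re (apply_bcontfun s x)) ` F)"
  using assms
proof (induction rule: finite_ne_induct)
  case (singleton s)
  show ?case by (intro exI[of _ "Re_fun s"]) simp
next
  case (insert s F)
  then obtain f :: "'a \<Rightarrow>\<^sub>C real"
    where f: "\<And>x. apply_bcontfun f x = Max ((\<lambda>s. Re (apply_bcontfun s x)) ` F)" by blast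
  have "\<bar>max (Re (apply_bcontfun s x)) (apply_bcontfun f x)\<bar> \<le> norm (Re_fun s) + norm f" for x
    using norm_bounded[of "Re_fun s" x] norm_bounded[of f x] by auto
  then have "(\<lambda>x. max (Re (apply_bcontfun s x)) (apply_bcontfun f x)) \<in> bcontfun"
    by (intro bcontfun_normI) (auto intro!: continuous_intros)
  then obtain g where "(\<lambda>x. max (Re (apply_bcontfun s x)) (apply_bcontfun f x)) = apply_bcontfun g"
    by (rule bcontfunE)
  then have "apply_bcontfun g x = Max ((\<lambda>s. Re (apply_bcontfun s x)) ` insert s F)" for x
    using insert f by (auto dest: fun_cong[where x = x])
  then show ?case by blast
qed

locale choquet_pair = \<mu>: borel_prob \<mu> + \<nu>: borel_prob \<nu>
  for \<mu> \<nu> :: "'a::t2_space measure" +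
  fixes S :: "('a \<Rightarrow>\<^sub>C complex) set"
  assumes compact: "compact (UNIV :: 'a set)"
    and S: "function_system S"
    and maxima_le: "f \<in> maxima S \<Longrightarrow> (\<integral>x. apply_bcontfun f x \<partial>\<mu>) \<le> (\<integral>x. apply_bcontfun f x \<partial>\<nu>)"
begin

text \<open>The functions on which the coupling is prescribed by \<mu>. The condition on fibres
  admits \<open>c \<otimes> s\<close> for real \<open>c\<close> and real \<open>s \<in> S\<close>,
  is stable under linear combinations, and asks for no representation as a finite sum of
  tensors.\<close>

definition fibred :: "(('a \<times> 'a) \<Rightarrow>\<^sub>C real) \<Rightarrow> bool" where
  "fibred G \<longleftrightarrow> (\<forall>x. \<exists>s\<in>real_elements S. \<forall>y. apply_bcontfun G (x, y) = Re (apply_bcontfun s y))"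

lemma fibredE:
  assumes "fibred G"
  obtains s where "\<And>x. s x \<in> real_elements S" "\<And>x y. apply_bcontfun G (x, y) = Re (apply_bcontfun (s x) y)"
  using assms unfolding fibred_def by metis

text \<open>The value that the coupling must take at \<open>G + pullback_snd f\<close>: given the
  first variable, elements of \<open>S\<close> in the second one average back to their value at the
  first, which leaves the diagonal of \<open>G\<close>.\<close>

definition bound_value :: "(('a \<times> 'a) \<Rightarrow>\<^sub>C real) \<Rightarrow> ('a \<Rightarrow>\<^sub>C real) \<Rightarrow> real" where
  "bound_value G f = (\<integral>x. apply_bcontfun (diagonal G) x \<partial>\<mu>) + (\<integral>x. apply_bcontfun f x \<partial>\<nu>)"

text \<open>By compactness finitely many fibres \<open>G(z, \<cdot>)\<close> have a minimum below \<open>G(x, x) + e\<close>; this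
  is the only place where the Choquet order enters.\<close>

lemma bound_value_nonneg:
  assumes G: "fibred G" and pos: "\<And>x y. 0 \<le> apply_bcontfun G (x, y) + apply_bcontfun f y"
  shows "0 \<le> bound_value G f"
proof (rule field_le_epsilon)
  fix e :: real assume e: "e > 0"
  define U where "U z = {x. apply_bcontfun G (z, x) < apply_bcontfun (diagonal G) x + e}" for z
  have opn: "open (U z)" for z
    unfolding U_def
  proof (intro open_Collect_less continuous_intros)
    show "continuous_on UNIV (\<lambda>x. apply_bcontfun G (z, x))"
      by (rule continuous_on_compose2[OF continuous_on_apply_bcontfun[of UNIV G]])
        (auto intro!: continuous_intros)
  qed (rule continuous_on_apply_bcontfun)
  have "UNIV \<subseteq> (\<Union>z\<in>UNIV. U z)" using e by (auto simp: U_def)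
  from compactE_image[OF compact opn this] obtain Z where Z: "finite Z" "UNIV \<subseteq> (\<Union>z\<in>Z. U z)"
    by metis
  then have "Z \<noteq> {}" by auto
  obtain s where s: "\<And>z. s z \<in> real_elements S" "\<And>z y. apply_bcontfun G (z, y) = Re (apply_bcontfun (s z) y)"
    by (rule fibredE[OF G]) blast
  \<comment> \<open>The maximum \<open>m\<close> of the functions \<open>- G(z, \<cdot>)\<close>
    with \<open>z \<in> Z\<close> lies between \<open>- G(x, x) - e\<close> and \<open>f\<close>;
    comparing its integrals against \<mu> and \<nu> links the two ends.\<close>
  define F where "F = (\<lambda>z. - s z) ` Z"
  have F: "finite F" "F \<noteq> {}" "F \<subseteq> real_elements S"
    using Z \<open>Z \<noteq> {}\<close> real_elements_uminus[OF S s(1)] by (auto simp: F_def)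
  obtain m :: "'a \<Rightarrow>\<^sub>C real" where m: "\<And>x. apply_bcontfun m x = Max ((\<lambda>s. Re (apply_bcontfun s x)) ` F)"
    using ex_bcontfun_Max[OF F(1,2)] by blast
  have "m \<in> maxima S" using F m by (auto simp: maxima_def)
  have "apply_bcontfun m x \<le> apply_bcontfun f x" for x
  proof -
    have "Re (apply_bcontfun (- s z) x) \<le> apply_bcontfun f x" for z
      using pos[of z x] by (simp add: s(2))
    then show ?thesis unfolding m using F by (subst Max_le_iff) (auto simp: F_def)
  qed
  moreover have "apply_bcontfun (- diagonal G - const_bcontfun e) x \<le> apply_bcontfun m x" for x
  proof -
    obtain z where "z \<in> Z" "x \<in> U z" using Z by auto
    then have "- apply_bcontfun (diagonal G) x - e \<le> Re (apply_bcontfun (- s z) x)"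
      by (simp add: U_def s(2))
    moreover have "- s z \<in> F" using \<open>z \<in> Z\<close> by (simp add: F_def)
    then have "Re (apply_bcontfun (- s z) x) \<le> apply_bcontfun m x"
      unfolding m using F(1) by (intro Max_ge finite_imageI imageI)
    ultimately show ?thesis by simp
  qed
  ultimately have "(\<integral>x. apply_bcontfun (- diagonal G - const_bcontfun e) x \<partial>\<mu>) \<le> (\<integral>x. apply_bcontfun f x \<partial>\<nu>)"
    using maxima_le[OF \<open>m \<in> maxima S\<close>]
      \<mu>.integral_bcontfun_mono[of "- diagonal G - const_bcontfun e" m] \<nu>.integral_bcontfun_mono[of m f]
    by (meson order_trans)
  also have "(\<integral>x. apply_bcontfun (- diagonal G - const_bcontfun e) x \<partial>\<mu>) =
      - (\<integral>x. apply_bcontfun (diagonal G) x \<partial>\<mu>) - e"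
    using \<mu>.integrable_bcontfun[of "diagonal G"] by (simp add: \<mu>.prob_space del: diagonal.rep_eq)
  finally show "0 \<le> bound_value G f + e" by (simp add: bound_value_def)
qed

lemma fibred_add:
  assumes "fibred G" "fibred G'"
  shows "fibred (G + G')"
proof -
  obtain s t where "\<And>x. s x \<in> real_elements S" "\<And>x y. apply_bcontfun G (x, y) = Re (apply_bcontfun (s x) y)"
    "\<And>x. t x \<in> real_elements S" "\<And>x y. apply_bcontfun G' (x, y) = Re (apply_bcontfun (t x) y)"
    using fibredE[OF assms(1)] fibredE[OF assms(2)] by metis
  then show ?thesis
    unfolding fibred_def
    using real_elements_add[OF S, of "s x" "t x" for x]
    by (intro allI) (rule_tac x = "s x + t x" in bexI, simp_all)
qed

lemma fibred_scale:
  assumes "fibred G"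
  shows "fibred (c *\<^sub>R G)"
proof -
  obtain s where "\<And>x. s x \<in> real_elements S" "\<And>x y. apply_bcontfun G (x, y) = Re (apply_bcontfun (s x) y)"
    by (rule fibredE[OF assms]) blast
  then show ?thesis
    unfolding fibred_def
    using real_elements_scale[OF S, of "s x" c for x]
    by (intro allI) (rule_tac x = "const_bcontfun (of_real c) * s x" in bexI, simp_all)
qed

lemma fibred_zero: "fibred 0"
proof -
  have "const_bcontfun 0 * 1 \<in> S" using S unfolding function_system_def by blast
  then show ?thesis
    unfolding fibred_def by (intro allI bexI[of _ 0]) (auto simp: real_elements_def)
qed

text \<open>Each element is an upper bound that positivity and the prescribed values force on a
  coupling at \<open>F\<close>. The infimum serves as the sublinear functional.\<close>

definition majorants :: "(('a \<times> 'a) \<Rightarrow>\<^sub>C real) \<Rightarrow> real set" where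
  "majorants F = {bound_value G f |G f. fibred G \<and>
     (\<forall>x y. apply_bcontfun F (x, y) \<le> apply_bcontfun G (x, y) + apply_bcontfun f y)}"

lemma majorantsI:
  "fibred G \<Longrightarrow> (\<And>x y. apply_bcontfun F (x, y) \<le> apply_bcontfun G (x, y) + apply_bcontfun f y) \<Longrightarrow>
    bound_value G f \<in> majorants F"
  by (auto simp: majorants_def)

lemma bound_value_add: "bound_value (G + G') (f + f') = bound_value G f + bound_value G' f'"
  using \<mu>.integral_linear(1)[of "diagonal G" "diagonal G'"] \<nu>.integral_linear(1)[of f f']
  by (simp add: bound_value_def)

lemma bound_value_scale: "bound_value (c *\<^sub>R G) (c *\<^sub>R f) = c * bound_value G f"
  using \<mu>.integral_linear(2)[of c "diagonal G"] \<nu>.integral_linear(2)[of c f]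
  by (simp add: bound_value_def algebra_simps)

lemma majorants_nonempty: "norm F \<in> majorants F"
proof -
  have "bound_value 0 (const_bcontfun (norm F)) \<in> majorants F"
  proof (rule majorantsI[OF fibred_zero])
    fix x y show "apply_bcontfun F (x, y) \<le> apply_bcontfun 0 (x, y) + apply_bcontfun (const_bcontfun (norm F)) y"
      using norm_bounded[of F "(x, y)"] by auto
  qed
  then show ?thesis by (simp add: bound_value_def \<nu>.prob_space)
qed

text \<open>Adding the constant \<open>norm F\<close> to \<open>f\<close> makes the majorant
  nonnegative, so \<open>bound_value_nonneg\<close> applies. The Choquet order thus acts as
  finiteness of the infimum.\<close>

lemma majorants_bdd: "bdd_below (majorants F)"
proof (rule bdd_belowI)
  fix r assume "r \<in> majorants F"
  then obtain G f where G: "fibred G" "\<And>x y. apply_bcontfun F (x, y) \<le> apply_bcontfun G (x, y) + apply_bcontfun f y"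
    and r: "r = bound_value G f" by (auto simp: majorants_def)
  have "0 \<le> bound_value G (f + const_bcontfun (norm F))"
  proof (rule bound_value_nonneg[OF G(1)])
    fix x y show "0 \<le> apply_bcontfun G (x, y) + apply_bcontfun (f + const_bcontfun (norm F)) y"
      using G(2)[of x y] norm_bounded[of F "(x, y)"] by auto
  qed
  also have "\<dots> = r + norm F"
    using bound_value_add[of G 0 f "const_bcontfun (norm F)"]
    by (simp add: r) (simp add: bound_value_def \<nu>.prob_space)
  finally show "- norm F \<le> r" by simp
qed

lemma sublinear_Inf_majorants: "sublinear (\<lambda>F. Inf (majorants F))"
proof (rule sublinearI)
  fix F F' :: "('a \<times> 'a) \<Rightarrow>\<^sub>C real"
  show "Inf (majorants (F + F')) \<le> Inf (majorants F) + Inf (majorants F')"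
  proof (rule field_le_epsilon)
    fix e :: real assume "e > 0"
    obtain r where r: "r \<in> majorants F" "r < Inf (majorants F) + e / 2"
      using cInf_lessD[of "majorants F" "Inf (majorants F) + e / 2"] majorants_nonempty[of F] \<open>e > 0\<close> by auto
    obtain r' where r': "r' \<in> majorants F'" "r' < Inf (majorants F') + e / 2"
      using cInf_lessD[of "majorants F'" "Inf (majorants F') + e / 2"] majorants_nonempty[of F'] \<open>e > 0\<close> by auto
    obtain G f where G: "fibred G" "\<And>x y. apply_bcontfun F (x, y) \<le> apply_bcontfun G (x, y) + apply_bcontfun f y"
      "r = bound_value G f" using r(1) by (auto simp: majorants_def)
    obtain G' f' where G': "fibred G'" "\<And>x y. apply_bcontfun F' (x, y) \<le> apply_bcontfun G' (x, y) + apply_bcontfun f' y"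
      "r' = bound_value G' f'" using r'(1) by (auto simp: majorants_def)
    have "bound_value (G + G') (f + f') \<in> majorants (F + F')"
    proof (rule majorantsI[OF fibred_add[OF G(1) G'(1)]])
      fix x y show "apply_bcontfun (F + F') (x, y) \<le> apply_bcontfun (G + G') (x, y) + apply_bcontfun (f + f') y"
        using G(2)[of x y] G'(2)[of x y] by simp
    qed
    then have "Inf (majorants (F + F')) \<le> r + r'"
      using cInf_lower[OF _ majorants_bdd] by (simp add: bound_value_add G(3) G'(3))
    then show "Inf (majorants (F + F')) \<le> Inf (majorants F) + Inf (majorants F') + e"
      using r(2) r'(2) by simp
  qed
next
  fix c :: real and F :: "('a \<times> 'a) \<Rightarrow>\<^sub>C real" assume c: "c > 0"
  have "Inf (majorants (c *\<^sub>R F)) / c \<le> Inf (majorants F)"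
  proof (rule cInf_greatest)
    fix r assume "r \<in> majorants F"
    then obtain G f where G: "fibred G" "\<And>x y. apply_bcontfun F (x, y) \<le> apply_bcontfun G (x, y) + apply_bcontfun f y"
      and r: "r = bound_value G f" by (auto simp: majorants_def)
    have "bound_value (c *\<^sub>R G) (c *\<^sub>R f) \<in> majorants (c *\<^sub>R F)"
    proof (rule majorantsI[OF fibred_scale[OF G(1)]])
      fix x y show "apply_bcontfun (c *\<^sub>R F) (x, y) \<le> apply_bcontfun (c *\<^sub>R G) (x, y) + apply_bcontfun (c *\<^sub>R f) y"
        using mult_left_mono[OF G(2)[of x y], of c] c by (simp add: algebra_simps)
    qed
    then have "Inf (majorants (c *\<^sub>R F)) \<le> c * r"
      using cInf_lower[OF _ majorants_bdd] by (simp add: bound_value_scale r)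
    then show "Inf (majorants (c *\<^sub>R F)) / c \<le> r" using c by (simp add: field_simps)
  qed (use majorants_nonempty in blast)
  then show "Inf (majorants (c *\<^sub>R F)) \<le> c * Inf (majorants F)" using c by (simp add: field_simps)
qed

text \<open>Majorants give only upper bounds. The prescribed functions form subspaces, so the bound
  at the negative of a function turns each into an equality; positivity comes from the majorant zero
  of a nonpositive function.\<close>

lemma real_coupling:
  obtains l :: "(('a \<times> 'a) \<Rightarrow>\<^sub>C real) \<Rightarrow> real" where "linear l"
    "\<And>F. (\<And>z. 0 \<le> apply_bcontfun F z) \<Longrightarrow> 0 \<le> l F"
    "\<And>G. fibred G \<Longrightarrow> l G = (\<integral>x. apply_bcontfun G (x, x) \<partial>\<mu>)"
    "\<And>f. l (pullback_snd f) = (\<integral>x. apply_bcontfun f x \<partial>\<nu>)"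
proof -
  obtain l :: "(('a \<times> 'a) \<Rightarrow>\<^sub>C real) \<Rightarrow> real" where l: "linear l" "\<And>F. l F \<le> Inf (majorants F)"
    by (rule hahn_banach[OF sublinear_Inf_majorants]) blast
  have le: "l F \<le> bound_value G f"
    if "fibred G" "\<And>x y. apply_bcontfun F (x, y) \<le> apply_bcontfun G (x, y) + apply_bcontfun f y" for F G f
    using l(2)[of F] cInf_lower[OF majorantsI[OF that] majorants_bdd] by linarith
  have minus: "l (- F) = - l F" for F using linear_neg[OF l(1)] .
  have 1: "0 \<le> l F" if "\<And>z. 0 \<le> apply_bcontfun F z" for F
    using le[OF fibred_zero, of "- F" 0] that by (simp add: minus bound_value_def)
  have 2: "l G \<le> (\<integral>x. apply_bcontfun G (x, x) \<partial>\<mu>)" if "fibred G" for G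
    using le[OF that, of G 0] by (simp add: bound_value_def)
  have 3: "l (pullback_snd f) \<le> (\<integral>x. apply_bcontfun f x \<partial>\<nu>)" for f
    using le[OF fibred_zero, of "pullback_snd f" f] by (simp add: bound_value_def)
  show thesis
  proof (rule that[OF l(1) 1])
    show "l G = (\<integral>x. apply_bcontfun G (x, x) \<partial>\<mu>)" if "fibred G" for G
      using 2[OF that] 2[OF fibred_scale[OF that, of "- 1"]] by (simp add: minus)
    have "pullback_snd (- f) = - (pullback_snd f :: ('a \<times> 'a) \<Rightarrow>\<^sub>C real)" for f :: "'a \<Rightarrow>\<^sub>C real"
      by (rule bcontfun_eqI) simp
    then show "l (pullback_snd f) = (\<integral>x. apply_bcontfun f x \<partial>\<nu>)" for f
      using 3[of f] 3[of "- f"] by (simp add: minus)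
  qed
qed

text \<open>Complexification. The diagonal formula is obtained for real \<open>c\<close> and real
  \<open>s\<close>; bilinearity and self-adjointness of \<open>S\<close> extend it.\<close>

theorem coupling:
  obtains L where "L \<in> state_space"
    "\<And>c s. s \<in> S \<Longrightarrow> L (tensor c s) = state_of \<mu> (c * s)"
    "\<And>f. L (tensor 1 f) = state_of \<nu> f"
proof -
  obtain l :: "(('a \<times> 'a) \<Rightarrow>\<^sub>C real) \<Rightarrow> real" where l: "linear l"
    "\<And>F. (\<And>z. 0 \<le> apply_bcontfun F z) \<Longrightarrow> 0 \<le> l F"
    "\<And>G. fibred G \<Longrightarrow> l G = (\<integral>x. apply_bcontfun G (x, x) \<partial>\<mu>)"
    "\<And>f. l (pullback_snd f) = (\<integral>x. apply_bcontfun f x \<partial>\<nu>)"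
    by (rule real_coupling) blast
  define L where "L F = Complex (l (Re_fun F)) (l (Im_fun F))" for F
  have L_add: "L (a + b) = L a + L b" for a b
  proof -
    have "Re_fun (a + b) = Re_fun a + Re_fun b" "Im_fun (a + b) = Im_fun a + Im_fun b"
      by (auto intro!: bcontfun_eqI)
    then show ?thesis by (simp add: L_def linear_add[OF l(1)] complex_eq_iff)
  qed
  have L_scale: "L (const_bcontfun c * a) = c * L a" for c a
  proof -
    have "Re_fun (const_bcontfun c * a) = Re c *\<^sub>R Re_fun a - Im c *\<^sub>R Im_fun a"
      "Im_fun (const_bcontfun c * a) = Re c *\<^sub>R Im_fun a + Im c *\<^sub>R Re_fun a"
      by (auto intro!: bcontfun_eqI)
    then show ?thesis
      by (simp add: L_def linear_add[OF l(1)] linear_diff[OF l(1)] linear_cmul[OF l(1)] complex_eq_iff)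
  qed
  have L_real: "L (of_real_fun f) = of_real (l f)" for f
  proof -
    have "Re_fun (of_real_fun f) = f" "Im_fun (of_real_fun f) = 0"
      by (auto intro!: bcontfun_eqI)
    then show ?thesis by (simp add: L_def linear_0[OF l(1)] complex_eq_iff)
  qed
  have L_one: "L (tensor 1 (of_real_fun f)) = state_of \<nu> (of_real_fun f)" for f
  proof -
    have "tensor (1 :: 'a \<Rightarrow>\<^sub>C complex) (of_real_fun f) = of_real_fun (pullback_snd f)"
      by (rule bcontfun_eqI) simp
    then show ?thesis by (simp add: L_real l(4) \<nu>.state_of_of_real_fun)
  qed
  have decomp: "f = of_real_fun (Re_fun f) + const_bcontfun \<i> * of_real_fun (Im_fun f)"
    for f :: "'b::topological_space \<Rightarrow>\<^sub>C complex"
    by (rule bcontfun_eqI) (simp add: complex_eq_iff)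
  have tensor: "tensor (c + d) s = tensor c s + tensor d s" "tensor (const_bcontfun z * c) s = const_bcontfun z * tensor c s"
    "tensor c (s + t) = tensor c s + tensor c t" "tensor c (const_bcontfun z * s) = const_bcontfun z * tensor c s"
    for c d s t :: "'a \<Rightarrow>\<^sub>C complex" and z
    by (auto intro!: bcontfun_eqI simp: algebra_simps)
  have 3: "L (tensor 1 f) = state_of \<nu> f" for f
    by (subst (1 2) decomp[of f]) (simp add: tensor L_add L_scale L_one)
  have 2: "L (tensor (of_real_fun c) s) = state_of \<mu> (of_real_fun c * s)" if "s \<in> real_elements S" for c s
  proof -
    define G where "G = Re_fun (tensor (of_real_fun c) s)"
    have s: "Im (apply_bcontfun s y) = 0" for y
      using that by (simp add: real_elements_def complex_is_Real_iff)
    have "fibred G" unfolding fibred_def G_def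
      by (intro allI, rule_tac x = "const_bcontfun (of_real (apply_bcontfun c x)) * s" in bexI)
        (simp_all add: real_elements_scale[OF S that])
    moreover have "tensor (of_real_fun c) s = of_real_fun G"
      by (rule bcontfun_eqI) (simp add: G_def complex_eq_iff s)
    moreover have "of_real_fun c * s = of_real_fun (diagonal G)"
      by (rule bcontfun_eqI) (simp add: G_def complex_eq_iff s)
    ultimately show ?thesis
      by (simp add: L_real l(3) \<mu>.state_of_of_real_fun)
  qed
  show thesis
  proof (rule that)
    show "L \<in> state_space"
      unfolding state_space_def
    proof (intro CollectI conjI allI L_add L_scale)
      fix a :: "('a \<times> 'a) \<Rightarrow>\<^sub>C complex"
      have "adj a * a = of_real_fun (Re_fun (adj a * a))"
        by (rule bcontfun_eqI) (simp add: complex_eq_iff)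
      moreover have "0 \<le> l (Re_fun (adj a * a))" by (rule l(2)) simp
      ultimately show "L (adj a * a) \<in> \<real>\<^sub>\<ge>\<^sub>0" by (metis L_real nonneg_Reals_of_real_iff)
    next
      have "L (tensor 1 1) = 1" using 3[of 1] by simp
      moreover have "tensor 1 1 = (1 :: ('a \<times> 'a) \<Rightarrow>\<^sub>C complex)" by (rule bcontfun_eqI) simp
      ultimately show "L 1 = 1" by simp
    qed
    show "L (tensor c s) = state_of \<mu> (c * s)" if "s \<in> S" for c s
    proof -
      note r = of_real_fun_Re_Im_in_real_elements[OF S that]
      have "L (tensor c t) = state_of \<mu> (c * t)" if "t \<in> real_elements S" for t
        by (subst (1 2) decomp[of c]) (simp add: tensor L_add L_scale 2[OF that] distrib_right mult.assoc)
      note this[OF r(1)] this[OF r(2)]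
      moreover have "c * (const_bcontfun \<i> * of_real_fun (Im_fun s)) = const_bcontfun \<i> * (c * of_real_fun (Im_fun s))"
        by (rule mult.left_commute)
      ultimately have "L (tensor c (of_real_fun (Re_fun s) + const_bcontfun \<i> * of_real_fun (Im_fun s))) =
          state_of \<mu> (c * (of_real_fun (Re_fun s) + const_bcontfun \<i> * of_real_fun (Im_fun s)))"
        by (simp only: tensor L_add L_scale distrib_left \<mu>.add \<mu>.scale)
      then show ?thesis
        by (simp only: decomp[of s, symmetric])
    qed
  qed (rule 3)
qed

end

subsection \<open>Averaging over fine partitions of unity\<close>

locale fine_partitions =
  fixes Z :: "nat \<Rightarrow> 'a::topological_space set" and p :: "nat \<Rightarrow> 'a \<Rightarrow> 'a \<Rightarrow>\<^sub>C real"
  assumes finite: "finite (Z n)"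
    and nonneg: "0 \<le> apply_bcontfun (p n z) x"
    and sum_one: "(\<Sum>z\<in>Z n. apply_bcontfun (p n z) x) = 1"
    and fine: "e > 0 \<Longrightarrow> \<exists>N. \<forall>n\<ge>N. \<forall>z\<in>Z n. \<forall>x.
      apply_bcontfun (p n z) x \<noteq> 0 \<longrightarrow> cmod (apply_bcontfun g x - apply_bcontfun g z) < e"

text \<open>Tents of radius \<open>\<rho> n\<close> around a finite \<open>\<rho> n\<close>-net,
  divided by their sum. For a given function the radius is compared with a Lebesgue number of a
  cover on which it oscillates little.\<close>

lemma fine_partitions_exist:
  assumes compact: "compact (UNIV :: 'a::t2_space set)"
    and "metrizable_space (euclidean :: 'a::t2_space topology)"
  obtains Z and p :: "nat \<Rightarrow> 'a::t2_space \<Rightarrow> 'a \<Rightarrow>\<^sub>C real" where "fine_partitions Z p"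
proof -
  obtain M d where "Metric_space M d" and top: "(euclidean :: 'a topology) = Metric_space.mtopology M d"
    using assms(2) unfolding metrizable_space_def by blast
  then have M: "M = UNIV"
    using Metric_space.topspace_mtopology by (metis topspace_euclidean)
  interpret M: Metric_space UNIV d using \<open>Metric_space M d\<close> M by simp
  note top = top[unfolded M]
  have open_ball: "open (M.mball x r)" for x r
    using M.openin_mball top by (metis open_openin)
  have ball_sub: "\<exists>r>0. M.mball x r \<subseteq> U" if "open U" "x \<in> U" for U x
    using that M.openin_mtopology top by (metis open_openin)
  have cont: "continuous_on UNIV (\<lambda>x. d z x)" for z
    unfolding continuous_on_topological
  proof (intro ballI allI impI)
    fix x and B :: "real set" assume "open B" "d z x \<in> B"
    then obtain e where e: "e > 0" "ball (d z x) e \<subseteq> B" by (auto simp: open_contains_ball)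
    have "d z y \<in> B" if "y \<in> M.mball x e" for y
    proof -
      have "\<bar>d z x - d z y\<bar> < e"
        using that M.triangle[of z x y] M.triangle[of z y x] M.commute[of x y] by (simp add: abs_if)
      then show ?thesis using e(2) by (auto simp: dist_real_def)
    qed
    then show "\<exists>A. open A \<and> x \<in> A \<and> (\<forall>y\<in>UNIV. y \<in> A \<longrightarrow> d z y \<in> B)"
      using open_ball e(1) by (intro exI[of _ "M.mball x e"]) auto
  qed
  define \<rho> where "\<rho> n = 1 / real (Suc n)" for n
  have \<rho>: "\<rho> n > 0" for n by (simp add: \<rho>_def)
  have "\<exists>Z. finite Z \<and> UNIV \<subseteq> (\<Union>z\<in>Z. M.mball z (\<rho> n))" for n
  proof -
    have "UNIV \<subseteq> (\<Union>z\<in>UNIV. M.mball z (\<rho> n))" using \<rho> by auto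
    from compactE_image[OF compact open_ball this] show ?thesis by metis
  qed
  then obtain Z where Z: "\<And>n. finite (Z n)" "\<And>n. UNIV \<subseteq> (\<Union>z\<in>Z n. M.mball z (\<rho> n))" by metis
  define w where "w n z x = max 0 (\<rho> n - d z x)" for n z x
  define W where "W n x = (\<Sum>z\<in>Z n. w n z x)" for n x
  have w0: "0 \<le> w n z x" for n z x by (simp add: w_def)
  have W: "W n x > 0" for n x
  proof -
    obtain z where "z \<in> Z n" "x \<in> M.mball z (\<rho> n)" using Z(2)[of n] by blast
    then show ?thesis
      unfolding W_def using w0 by (intro sum_pos2[OF Z(1), of z]) (auto simp: w_def)
  qed
  have Wle: "w n z x \<le> W n x" if "z \<in> Z n" for n z x
    unfolding W_def using that Z(1) w0 by (intro member_le_sum) auto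
  have wcont: "continuous_on UNIV (\<lambda>x. w n z x)" for n z
    unfolding w_def by (intro continuous_intros cont)
  have Wcont: "continuous_on UNIV (\<lambda>x. W n x)" for n
    unfolding W_def by (intro continuous_intros wcont)
  have "\<exists>f :: 'a \<Rightarrow>\<^sub>C real. \<forall>x. apply_bcontfun f x = (if z \<in> Z n then w n z x / W n x else 0)" for n z
  proof (cases "z \<in> Z n")
    case True
    have "continuous_on UNIV (\<lambda>x. w n z x / W n x)"
      by (rule continuous_on_divide[OF wcont Wcont]) (use W in \<open>auto simp: less_le\<close>)
    moreover have "norm (w n z x / W n x) \<le> 1" for x
      using W[of n x] Wle[OF True] w0 by (simp add: abs_of_nonneg)
    ultimately have "(\<lambda>x. w n z x / W n x) \<in> bcontfun" by (rule bcontfun_normI)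
    then obtain f where "(\<lambda>x. w n z x / W n x) = apply_bcontfun f" by (rule bcontfunE)
    then show ?thesis using True by (metis (mono_tags))
  qed (auto intro: exI[of _ 0])
  then have "\<exists>p :: nat \<Rightarrow> 'a \<Rightarrow> 'a \<Rightarrow>\<^sub>C real.
      \<forall>n z x. apply_bcontfun (p n z) x = (if z \<in> Z n then w n z x / W n x else 0)"
    by (intro choice allI)
  then obtain p :: "nat \<Rightarrow> 'a \<Rightarrow> 'a \<Rightarrow>\<^sub>C real"
    where p: "\<And>n z x. apply_bcontfun (p n z) x = (if z \<in> Z n then w n z x / W n x else 0)" by blast
  have "fine_partitions Z p"
  proof
    show "finite (Z n)" for n by (rule Z(1))
    show "0 \<le> apply_bcontfun (p n z) x" for n z x
      using w0 W[of n x] by (simp add: p)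
    have "(\<Sum>z\<in>Z n. apply_bcontfun (p n z) x) = W n x / W n x" for n x
      by (simp add: p W_def[of n x, symmetric] flip: sum_divide_distrib)
    then show "(\<Sum>z\<in>Z n. apply_bcontfun (p n z) x) = 1" for n x
      using W[of n x] by simp
    fix g :: "'a \<Rightarrow>\<^sub>C complex" and e :: real assume e: "e > 0"
    define U where "U c = {y. cmod (apply_bcontfun g y - apply_bcontfun g c) < e / 2}" for c
    have "open (U c)" for c
      unfolding U_def by (intro open_Collect_less continuous_intros continuous_on_apply_bcontfun)
    then have "\<exists>r>0. M.mball c r \<subseteq> U c" for c
      using e by (intro ball_sub) (auto simp: U_def)
    then obtain r where r: "\<And>c. r c > 0" "\<And>c. M.mball c (r c) \<subseteq> U c" by metis
    have cov: "UNIV \<subseteq> (\<Union>c\<in>UNIV. M.mball c (r c / 2))" using r(1) by auto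
    obtain C where C: "finite C" "UNIV \<subseteq> (\<Union>c\<in>C. M.mball c (r c / 2))"
      using compactE_image[OF compact open_ball cov] by metis
    \<comment> \<open>The Lebesgue number: if \<open>x\<close> is within \<open>r c / 2\<close> of
      \<open>c\<close>, then every point within \<open>\<delta>\<close> of \<open>x\<close> is still
      in the ball of radius \<open>r c\<close>, where the function is within \<open>e / 2\<close> of
      its value at \<open>c\<close>.\<close>
    define \<delta> where "\<delta> = Min ((\<lambda>c. r c / 2) ` C)"
    have "C \<noteq> {}" using C(2) by auto
    have "\<delta> > 0" unfolding \<delta>_def using C(1) \<open>C \<noteq> {}\<close> r(1) by (subst Min_gr_iff) auto
    then obtain N where N: "\<rho> N < \<delta>" unfolding \<rho>_def using nat_approx_posE by metis
    show "\<exists>N. \<forall>n\<ge>N. \<forall>z\<in>Z n. \<forall>x.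
      apply_bcontfun (p n z) x \<noteq> 0 \<longrightarrow> cmod (apply_bcontfun g x - apply_bcontfun g z) < e"
    proof (intro exI allI ballI impI)
      fix n z x assume n: "n \<ge> N" and z: "z \<in> Z n" and "apply_bcontfun (p n z) x \<noteq> 0"
      then have "d z x < \<rho> n" by (auto simp: p w_def max_def split: if_splits)
      also have "\<rho> n \<le> \<rho> N" using n by (simp add: \<rho>_def frac_le)
      finally have zx: "d z x < \<delta>" using N by simp
      obtain c where "c \<in> C" "x \<in> M.mball c (r c / 2)" using C(2) by blast
      then have c: "c \<in> C" "d c x < r c / 2" by auto
      have "\<delta> \<le> r c / 2" unfolding \<delta>_def using c C(1) by (intro Min_le) auto
      then have "d c z < r c" "d c x < r c"
        using M.triangle[of c x z] M.commute[of x z] c zx r(1)[of c] by auto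
      then have "z \<in> U c" "x \<in> U c" using r(2)[of c] by auto
      then have "cmod (apply_bcontfun g x - apply_bcontfun g c) < e / 2"
        "cmod (apply_bcontfun g z - apply_bcontfun g c) < e / 2" by (simp_all add: U_def)
      then show "cmod (apply_bcontfun g x - apply_bcontfun g z) < e"
        by (metis norm_minus_commute norm_triangle_half_r dist_norm dist_commute)
    qed
  qed
  then show thesis by (rule that)
qed

locale averaged_coupling = choquet_pair \<mu> \<nu> S + fine_partitions Z p
  for \<mu> \<nu> :: "'a::t2_space measure" and S :: "('a \<Rightarrow>\<^sub>C complex) set"
    and Z :: "nat \<Rightarrow> 'a set" and p :: "nat \<Rightarrow> 'a \<Rightarrow> 'a \<Rightarrow>\<^sub>C real" +
  fixes L :: "('a \<times> 'a) functional"
  assumes L: "L \<in> state_space"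
    and L_S: "s \<in> S \<Longrightarrow> L (tensor c s) = state_of \<mu> (c * s)"
    and L_one: "L (tensor 1 f) = state_of \<nu> f"
begin

sublocale L: state L by unfold_locales (rule L)

lemma tensor_simps:
  "tensor (c + d) s = tensor c s + tensor d s" "tensor (const_bcontfun z * c) s = const_bcontfun z * tensor c s"
  "tensor c (s + t) = tensor c s + tensor c t" "tensor c (const_bcontfun z * s) = const_bcontfun z * tensor c s"
  "adj (tensor c s) = tensor (adj c) (adj s)" "tensor c s * tensor d t = tensor (c * d) (s * t)"
  for c d s t :: "'a \<Rightarrow>\<^sub>C complex" and z
  by (auto intro!: bcontfun_eqI simp: algebra_simps)

lemma tensor_sum: "tensor (\<Sum>i\<in>I. f i) s = (\<Sum>i\<in>I. tensor (f i) s)"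
  for f :: "'i \<Rightarrow> 'a \<Rightarrow>\<^sub>C complex" and s :: "'a \<Rightarrow>\<^sub>C complex"
  by (rule bcontfun_eqI) (simp add: sum_distrib_right)

lemma L_first: "L (tensor c 1) = state_of \<mu> c"
  using L_S[of 1 c] S by (simp add: function_system_def)

text \<open>As \<open>1 \<in> S\<close>, the first marginal of \<open>L\<close> is \<mu>.
  Cauchy--Schwarz for \<open>L\<close> then bounds \<open>c \<mapsto> L (c \<otimes> f)\<close> in
  mean square, which is what gives it a density.\<close>

lemma L_CS: "cmod (L (tensor c f)) \<le> norm f * gns_seminorm (state_of \<mu>) (adj c)"
proof -
  have "tensor c f = adj (tensor (adj c) 1) * tensor 1 f" by (simp add: tensor_simps)
  then have "cmod (L (tensor c f)) \<le> gns_seminorm L (tensor 1 f) * gns_seminorm L (tensor (adj c) 1)"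
    using L.q_CS by metis
  also have "gns_seminorm L (tensor (adj c) 1) = gns_seminorm (state_of \<mu>) (adj c)"
    by (simp add: gns_seminorm_def tensor_simps L_first)
  also have "gns_seminorm L (tensor 1 f) \<le> norm f"
    by (rule order_trans[OF L.q_le_norm]) (rule norm_bound, simp add: norm_bounded)
  finally show ?thesis by (simp add: mult_right_mono)
qed

text \<open>The Riesz representation of \<open>c \<mapsto> L (c \<otimes> f)\<close> on \<open>L\<^sup>2(\<mu>)\<close> by an almost minimiser of the
  associated quadratic functional; a minimiser need not be continuous.\<close>

lemma approximate_density:
  assumes e: "e > 0"
  obtains g where "\<And>c. cmod (L (tensor c f) - state_of \<mu> (c * g)) \<le> e * norm c"
proof -
  let ?q = "gns_seminorm (state_of \<mu>)"
  \<comment> \<open>By completing the square, \<open>J g\<close> is the squared distance of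
    \<open>g\<close> from the unknown density, up to a constant.\<close>
  define J where "J g = (?q g)\<^sup>2 - 2 * Re (L (tensor (adj g) f))" for g
  have "J g \<ge> - (norm f)\<^sup>2" for g
  proof -
    have "Re (L (tensor (adj g) f)) \<le> norm f * ?q g"
      using L_CS[of "adj g" f] complex_Re_le_cmod[of "L (tensor (adj g) f)"] by simp
    moreover have "0 \<le> (?q g - norm f)\<^sup>2" by simp
    ultimately show ?thesis by (simp add: J_def power2_diff algebra_simps)
  qed
  then have "bdd_below (range J)" by (intro bdd_belowI2)
  then obtain g where g: "J g < Inf (range J) + e\<^sup>2"
    using cInf_lessD[of "range J" "Inf (range J) + e\<^sup>2"] e by auto
  have J: "J g \<le> J h + e\<^sup>2" for h
    using g cInf_lower[OF rangeI \<open>bdd_below (range J)\<close>, of h] by simp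
  have "cmod (L (tensor c f) - state_of \<mu> (c * g)) \<le> e * norm c" for c
  proof (cases "c = 0")
    case True
    have "tensor 0 f = (0 :: ('a \<times> 'a) \<Rightarrow>\<^sub>C complex)" by (rule bcontfun_eqI) simp
    then show ?thesis using True by simp
  next
    case False
    define v where "v = L (tensor c f) - state_of \<mu> (c * g)"
    \<comment> \<open>The trial step \<open>h\<close> has seminorm at most \<open>e\<close>, and its
      phase makes the first-order decrease equal to \<open>2 * (t * cmod v)\<close>. Almost
      minimality up to \<open>e^2\<close> bounds \<open>t * cmod v\<close> by \<open>e^2\<close>,
      which is the claim for this \<open>t\<close>.\<close>
    define t where "t = e / norm c"
    have t: "t > 0" using e False by (simp add: t_def)
    define l where "l = of_real t * sgn v"
    define h where "h = const_bcontfun l * adj c"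
    have "cmod (sgn v) \<le> 1" by (simp add: norm_sgn)
    then have "cmod l \<le> t" using t by (simp add: l_def norm_mult mult_left_le)
    have "state_of \<mu> (adj g * h) = cnj (state_of \<mu> (adj h * g))"
      using \<mu>.adj[of "adj h * g"] by (simp add: mult.commute)
    then have "(?q (g + h))\<^sup>2 = (?q g)\<^sup>2 + (?q h)\<^sup>2 + 2 * Re (state_of \<mu> (adj h * g))"
      by (simp add: \<mu>.q_square algebra_simps)
    moreover have "adj h = const_bcontfun (cnj l) * c" by (simp add: h_def)
    then have "state_of \<mu> (adj h * g) = cnj l * state_of \<mu> (c * g)"
      "L (tensor (adj (g + h)) f) = L (tensor (adj g) f) + cnj l * L (tensor c f)"
      by (simp_all only: mult.assoc \<mu>.scale adj_simps tensor_simps L.add L.scale)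
    ultimately have "J (g + h) = J g + (?q h)\<^sup>2 - 2 * Re (cnj l * v)"
      by (simp only: J_def v_def right_diff_distrib minus_complex.sel plus_complex.sel) simp
    moreover have "cnj l * v = of_real (t * cmod v)"
      using complex_norm_square[of v]
      by (cases "v = 0") (simp_all add: l_def sgn_div_norm scaleR_conv_of_real power2_eq_square field_simps)
    ultimately have "2 * (t * cmod v) \<le> (?q h)\<^sup>2 + e\<^sup>2"
      using J[of "g + h"] by simp
    moreover have "(?q h)\<^sup>2 \<le> e\<^sup>2"
    proof (rule power_mono)
      have "?q h = cmod l * ?q (adj c)" by (simp add: h_def)
      also have "\<dots> \<le> t * norm c"
        using \<open>cmod l \<le> t\<close> \<mu>.q_le_norm[of "adj c"] t by (intro mult_mono) auto
      also have "\<dots> = e" using False by (simp add: t_def)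
      finally show "?q h \<le> e" .
    qed simp
    ultimately have "t * cmod v \<le> e\<^sup>2" by simp
    then show ?thesis
      using False e unfolding v_def[symmetric] t_def by (simp add: field_simps power2_eq_square)
  qed
  then show thesis by (rule that)
qed

abbreviation P where "P n z \<equiv> of_real_fun (p n z)"

definition mass where "mass n z = (\<integral>x. apply_bcontfun (p n z) x \<partial>\<mu>)"

text \<open>Where the mass vanishes the value of \<open>avg\<close> is irrelevant; it is only required to be a state.\<close>

definition avg where
  "avg n z f = (if mass n z = 0 then apply_bcontfun f z else L (tensor (P n z) f) / of_real (mass n z))"

text \<open>A conditional expectation of the second variable given the cell of the first,
  interpolated continuously by the weights.\<close>

definition kernel where
  "kernel n f = (\<Sum>z\<in>Z n. const_bcontfun (avg n z f) * P n z)"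

lemma p_le_one: "z \<in> Z n \<Longrightarrow> apply_bcontfun (p n z) x \<le> 1"
  using sum_one[of n x] member_le_sum[of z "Z n" "\<lambda>z. apply_bcontfun (p n z) x"] nonneg finite by simp

lemma mass_nonneg: "0 \<le> mass n z"
  unfolding mass_def using nonneg by (intro Bochner_Integration.integral_nonneg) auto

lemma state_P: "state_of \<mu> (P n z) = of_real (mass n z)"
  by (simp add: mass_def \<mu>.state_of_of_real_fun)

lemma avg_state: "avg n z \<in> state_space"
proof (cases "mass n z = 0")
  case True
  then have "avg n z = (\<lambda>f. apply_bcontfun f z)" by (simp add: avg_def fun_eq_iff)
  moreover have "cnj w * w \<in> \<real>\<^sub>\<ge>\<^sub>0" for w :: complex
    using complex_norm_square[of w] by (metis mult.commute nonneg_Reals_of_real_iff zero_le_power2)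
  ultimately show ?thesis by (simp add: state_space_def)
next
  case False
  then have "mass n z > 0" using mass_nonneg[of n z] by simp
  then show ?thesis
    unfolding state_space_def
  proof (intro CollectI conjI allI)
    fix a :: "'a \<Rightarrow>\<^sub>C complex"
    have "L (tensor (P n z) (adj a * a)) \<in> \<real>\<^sub>\<ge>\<^sub>0"
    proof (rule L.positive)
      fix y :: "'a \<times> 'a"
      have "apply_bcontfun (tensor (P n z) (adj a * a)) y =
          of_real (apply_bcontfun (p n z) (fst y) * (cmod (apply_bcontfun a (snd y)))\<^sup>2)"
        using complex_norm_square[of "apply_bcontfun a (snd y)"] by (simp add: mult.commute)
      then show "apply_bcontfun (tensor (P n z) (adj a * a)) y \<in> \<real>\<^sub>\<ge>\<^sub>0"
        using nonneg[of n z "fst y"] by (simp only: nonneg_Reals_of_real_iff) simp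
    qed
    then show "avg n z (adj a * a) \<in> \<real>\<^sub>\<ge>\<^sub>0"
      using False \<open>mass n z > 0\<close> by (auto simp: avg_def complex_nonneg_Reals_iff)
  qed (use False in \<open>auto simp: avg_def tensor_simps add_divide_distrib L_first state_P\<close>)
qed

text \<open>The default value of \<open>avg\<close> is harmless: as
  \<open>0 \<le> p \<le> 1\<close>, a cell without mass has seminorm zero, and Cauchy--Schwarz makes
  the right-hand side vanish.\<close>

lemma avg_mass:
  assumes "z \<in> Z n"
  shows "avg n z f * of_real (mass n z) = L (tensor (P n z) f)"
proof (cases "mass n z = 0")
  case True
  have "(gns_seminorm (state_of \<mu>) (adj (P n z)))\<^sup>2 = Re (state_of \<mu> (P n z * P n z))"
    by (simp add: \<mu>.q_square mult.commute)
  also have "\<dots> \<le> Re (state_of \<mu> (P n z))"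
    using nonneg[of n z] p_le_one[OF assms] by (intro \<mu>.mono) (auto simp: mult_left_le simp flip: of_real_mult)
  finally have "gns_seminorm (state_of \<mu>) (adj (P n z)) = 0"
    using True by (simp add: state_P)
  then show ?thesis using True L_CS[of "P n z" f] by simp
qed (simp add: avg_def)

lemma kernel_apply:
  "apply_bcontfun (kernel n f) x = (\<Sum>z\<in>Z n. of_real (apply_bcontfun (p n z) x) * avg n z f)"
  by (simp add: kernel_def mult.commute)

lemma markov_kernel: "markov (kernel n)"
  unfolding markov_def state_space_def kernel_apply
proof (intro allI CollectI conjI)
  fix x and a b :: "'a \<Rightarrow>\<^sub>C complex" and c
  interpret avg: state "avg n z" for z by unfold_locales (rule avg_state)
  show "(\<Sum>z\<in>Z n. of_real (apply_bcontfun (p n z) x) * avg n z (a + b)) =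
      (\<Sum>z\<in>Z n. of_real (apply_bcontfun (p n z) x) * avg n z a) +
      (\<Sum>z\<in>Z n. of_real (apply_bcontfun (p n z) x) * avg n z b)"
    by (simp add: distrib_left sum.distrib)
  show "(\<Sum>z\<in>Z n. of_real (apply_bcontfun (p n z) x) * avg n z (const_bcontfun c * a)) =
      c * (\<Sum>z\<in>Z n. of_real (apply_bcontfun (p n z) x) * avg n z a)"
    by (simp add: sum_distrib_left mult.left_commute)
  show "(\<Sum>z\<in>Z n. of_real (apply_bcontfun (p n z) x) * avg n z (adj a * a)) \<in> \<real>\<^sub>\<ge>\<^sub>0"
    using nonneg avg.pos_square by (intro sum_nonneg_Reals nonneg_Reals_mult_I) auto
  show "(\<Sum>z\<in>Z n. of_real (apply_bcontfun (p n z) x) * avg n z 1) = 1"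
    using sum_one[of n x] by (simp flip: of_real_sum)
qed

text \<open>Weighting the averages by the masses undoes the division, and the weights sum to one.
  Exactness at every stage is what survives integration over a subdivision.\<close>

lemma state_of_kernel: "state_of \<mu> (kernel n f) = state_of \<nu> f"
proof -
  have "state_of \<mu> (kernel n f) = (\<Sum>z\<in>Z n. L (tensor (P n z) f))"
    by (simp add: kernel_def state_P avg_mass)
  also have "\<dots> = L (tensor (\<Sum>z\<in>Z n. P n z) f)"
    by (simp add: tensor_sum)
  also have "(\<Sum>z\<in>Z n. P n z) = 1"
    using sum_one[of n] by (intro bcontfun_eqI) (simp flip: of_real_sum)
  finally show ?thesis by (simp add: L_one)
qed

text \<open>For an approximate density \<open>g\<close>, the average over a cell is near the value
  of \<open>g\<close> at its centre. The defects \<open>D z\<close> contribute \<open>e\<close> in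
  total; the oscillation of \<open>g\<close> contributes \<open>e' / 2\<close> twice, inside the
  averages and in moving from the centre to the point.\<close>

lemma kernel_L1:
  assumes g: "\<And>c. cmod (L (tensor c f) - state_of \<mu> (c * g)) \<le> e * norm c" and e: "e \<ge> 0" and e': "e' > 0"
  shows "\<exists>N. \<forall>n\<ge>N. (\<integral>x. cmod (apply_bcontfun (kernel n f - g) x) \<partial>\<mu>) \<le> e + e'"
proof -
  obtain N where N: "\<And>n z x. n \<ge> N \<Longrightarrow> z \<in> Z n \<Longrightarrow> apply_bcontfun (p n z) x \<noteq> 0 \<Longrightarrow>
      cmod (apply_bcontfun g x - apply_bcontfun g z) < e' / 2"
    using fine[of "e' / 2" g] e' by auto
  have "(\<integral>x. cmod (apply_bcontfun (kernel n f - g) x) \<partial>\<mu>) \<le> e + e'" if n: "n \<ge> N" for n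
  proof -
    define D where "D z = L (tensor (P n z) f) - state_of \<mu> (P n z * g)" for z
    have osc: "apply_bcontfun (p n z) x * cmod (apply_bcontfun g x - apply_bcontfun g z) \<le> apply_bcontfun (p n z) x * (e' / 2)"
      if "z \<in> Z n" for z x
      using N[OF n that, of x] nonneg[of n z x] by (cases "apply_bcontfun (p n z) x = 0") auto
    have ptw: "cmod (apply_bcontfun (kernel n f - g) x) \<le>
        (\<Sum>z\<in>Z n. apply_bcontfun (p n z) x * cmod (avg n z f - apply_bcontfun g z)) + e' / 2" for x
    proof -
      have "apply_bcontfun (kernel n f - g) x =
          (\<Sum>z\<in>Z n. of_real (apply_bcontfun (p n z) x) * (avg n z f - apply_bcontfun g x))"
        using sum_one[of n x] by (simp add: kernel_apply right_diff_distrib sum_subtractf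
            flip: sum_distrib_right of_real_sum)
      also have "cmod \<dots> \<le> (\<Sum>z\<in>Z n. apply_bcontfun (p n z) x * cmod (avg n z f - apply_bcontfun g x))"
        by (rule order_trans[OF norm_sum]) (simp add: norm_mult nonneg)
      also have "\<dots> \<le> (\<Sum>z\<in>Z n. apply_bcontfun (p n z) x * cmod (avg n z f - apply_bcontfun g z) +
            apply_bcontfun (p n z) x * (e' / 2))"
      proof (rule sum_mono)
        fix z assume z: "z \<in> Z n"
        have "cmod (avg n z f - apply_bcontfun g x) \<le>
            cmod (avg n z f - apply_bcontfun g z) + cmod (apply_bcontfun g x - apply_bcontfun g z)"
          using norm_triangle_ineq4[of "avg n z f - apply_bcontfun g z" "apply_bcontfun g x - apply_bcontfun g z"] by simp
        from mult_left_mono[OF this nonneg[of n z x]]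
        show "apply_bcontfun (p n z) x * cmod (avg n z f - apply_bcontfun g x) \<le>
            apply_bcontfun (p n z) x * cmod (avg n z f - apply_bcontfun g z) + apply_bcontfun (p n z) x * (e' / 2)"
          using osc[OF z, of x] by (simp add: distrib_left)
      qed
      also have "\<dots> = (\<Sum>z\<in>Z n. apply_bcontfun (p n z) x * cmod (avg n z f - apply_bcontfun g z)) + e' / 2"
        using sum_one[of n x] by (simp add: sum.distrib flip: sum_distrib_right sum_divide_distrib)
      finally show ?thesis .
    qed
    have mass: "mass n z * cmod (avg n z f - apply_bcontfun g z) \<le> cmod (D z) + mass n z * (e' / 2)"
      if z: "z \<in> Z n" for z
    proof -
      have "of_real (mass n z) * (avg n z f - apply_bcontfun g z) =
          D z + state_of \<mu> (P n z * (g - const_bcontfun (apply_bcontfun g z)))"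
        using avg_mass[OF z, of f]
        by (simp add: D_def algebra_simps state_P \<mu>.scale[of "apply_bcontfun g z" "P n z", simplified mult.commute])
      then have "mass n z * cmod (avg n z f - apply_bcontfun g z) \<le>
          cmod (D z) + cmod (state_of \<mu> (P n z * (g - const_bcontfun (apply_bcontfun g z))))"
        using mass_nonneg[of n z] norm_triangle_ineq by (metis norm_mult norm_of_real abs_of_nonneg)
      also have "cmod (state_of \<mu> (P n z * (g - const_bcontfun (apply_bcontfun g z)))) \<le>
          (\<integral>x. cmod (apply_bcontfun (P n z * (g - const_bcontfun (apply_bcontfun g z))) x) \<partial>\<mu>)"
        unfolding state_of_def by (rule integral_norm_bound)
      also have "\<dots> \<le> (\<integral>x. apply_bcontfun (p n z) x * (e' / 2) \<partial>\<mu>)"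
      proof (intro integral_mono integrable_norm integrable_mult_left \<mu>.integrable_bcontfun)
        fix x
        show "cmod (apply_bcontfun (P n z * (g - const_bcontfun (apply_bcontfun g z))) x) \<le> apply_bcontfun (p n z) x * (e' / 2)"
          using osc[OF z, of x] nonneg[of n z x] by (simp add: norm_mult)
      qed
      also have "\<dots> = mass n z * (e' / 2)" by (simp add: mass_def)
      finally show ?thesis by simp
    qed
    have "(\<Sum>z\<in>Z n. cmod (D z)) \<le> e"
    proof -
      \<comment> \<open>Conjugate phases of the \<open>D z\<close> assemble one test function of
        norm at most one, so the assumption on \<open>g\<close> bounds the sum of all defects by a
        single \<open>e\<close>, however many cells there are.\<close>
      define c where "c = (\<Sum>z\<in>Z n. const_bcontfun (cnj (sgn (D z))) * P n z)"
      have "cnj (sgn v) * v = of_real (cmod v)" for v :: complex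
        using complex_norm_square[of v]
        by (cases "v = 0") (simp_all add: sgn_div_norm scaleR_conv_of_real power2_eq_square field_simps)
      then have "of_real (\<Sum>z\<in>Z n. cmod (D z)) = (\<Sum>z\<in>Z n. cnj (sgn (D z)) * D z)" by simp
      also have "\<dots> = L (tensor c f) - state_of \<mu> (c * g)"
        by (simp add: c_def D_def tensor_sum tensor_simps sum_distrib_right mult.assoc right_diff_distrib sum_subtractf)
      finally have "(\<Sum>z\<in>Z n. cmod (D z)) = cmod (L (tensor c f) - state_of \<mu> (c * g))"
        by (metis abs_of_nonneg norm_ge_zero norm_of_real sum_nonneg)
      also have "\<dots> \<le> e * norm c" by (rule g)
      also have "norm c \<le> 1"
      proof (rule norm_bound)
        fix x
        have "cmod (apply_bcontfun c x) \<le> (\<Sum>z\<in>Z n. cmod (cnj (sgn (D z)) * of_real (apply_bcontfun (p n z) x)))"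
          by (simp add: c_def norm_sum)
        also have "\<dots> \<le> (\<Sum>z\<in>Z n. apply_bcontfun (p n z) x)"
          using nonneg by (intro sum_mono) (auto simp: norm_mult norm_sgn)
        finally show "cmod (apply_bcontfun c x) \<le> 1" using sum_one by simp
      qed
      finally show ?thesis using e by (simp add: mult_left_mono)
    qed
    moreover have "(\<Sum>z\<in>Z n. mass n z) = 1"
    proof -
      have "(\<Sum>z\<in>Z n. mass n z) = (\<integral>x. (\<Sum>z\<in>Z n. apply_bcontfun (p n z) x) \<partial>\<mu>)"
        unfolding mass_def by (subst Bochner_Integration.integral_sum) auto
      then show ?thesis by (simp add: sum_one \<mu>.prob_space)
    qed
    moreover have "(\<integral>x. cmod (apply_bcontfun (kernel n f - g) x) \<partial>\<mu>) \<le>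
        (\<integral>x. (\<Sum>z\<in>Z n. apply_bcontfun (p n z) x * cmod (avg n z f - apply_bcontfun g z)) + e' / 2 \<partial>\<mu>)"
      using ptw by (intro integral_mono integrable_norm \<mu>.integrable_bcontfun) auto
    moreover have "\<dots> = (\<Sum>z\<in>Z n. mass n z * cmod (avg n z f - apply_bcontfun g z)) + e' / 2"
      by (simp add: mass_def \<mu>.prob_space)
    moreover have "\<dots> \<le> (\<Sum>z\<in>Z n. cmod (D z) + mass n z * (e' / 2)) + e' / 2"
      using mass by (intro add_mono sum_mono) auto
    ultimately show ?thesis by (simp add: sum.distrib flip: sum_distrib_right sum_divide_distrib)
  qed
  then show ?thesis by blast
qed

text \<open>With the uniform bound on \<open>kernel n f\<close>, this upgrades convergence in mean,
  which the dual estimate provides, to mean-square convergence.\<close>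

lemma q_square_le_L1: "(gns_seminorm (state_of \<mu>) a)\<^sup>2 \<le> norm a * (\<integral>x. cmod (apply_bcontfun a x) \<partial>\<mu>)"
proof -
  have eq: "state_of \<mu> (adj a * a) = of_real (\<integral>x. (cmod (apply_bcontfun a x))\<^sup>2 \<partial>\<mu>)"
    unfolding state_of_def by (rule \<mu>.integral_square)
  have "integrable \<mu> (\<lambda>x. apply_bcontfun (Re_fun (adj a * a)) x)" by (rule \<mu>.integrable_bcontfun)
  then have "integrable \<mu> (\<lambda>x. (cmod (apply_bcontfun a x))\<^sup>2)"
    by (simp add: cmod_def power2_eq_square)
  then have "(\<integral>x. (cmod (apply_bcontfun a x))\<^sup>2 \<partial>\<mu>) \<le> (\<integral>x. norm a * cmod (apply_bcontfun a x) \<partial>\<mu>)"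
    by (intro integral_mono integrable_mult_right integrable_norm \<mu>.integrable_bcontfun)
      (auto simp: power2_eq_square norm_bounded mult_right_mono)
  then show ?thesis by (simp add: \<mu>.q_square eq)
qed

lemma kernel_Cauchy: "(\<lambda>n. kernel n f) \<in> gns_Cauchy (state_of \<mu>)"
proof (rule \<mu>.gns_CauchyI)
  fix e :: real assume e: "e > 0"
  define B where "B = 2 * norm f + 1"
  have B: "B > 0" using norm_ge_zero[of f] unfolding B_def by linarith
  \<comment> \<open>Two kernels within \<open>2 * r\<close> of the same \<open>g\<close> are at most
    \<open>4 * r\<close> apart in mean, \<open>B\<close> bounds their difference uniformly, and
    \<open>B * (4 * r) = e^2\<close>. The function \<open>g\<close> depends on \<open>e\<close> and
    need not be a limit.\<close>
  define r where "r = e\<^sup>2 / (4 * B)"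
  have r: "r > 0" using e B by (simp add: r_def)
  obtain g where g: "\<And>c. cmod (L (tensor c f) - state_of \<mu> (c * g)) \<le> r * norm c"
    by (rule approximate_density[OF r]) blast
  obtain N where N: "\<And>n. n \<ge> N \<Longrightarrow> (\<integral>x. cmod (apply_bcontfun (kernel n f - g) x) \<partial>\<mu>) \<le> r + r"
    using kernel_L1[OF g less_imp_le[OF r] r] by blast
  have "gns_seminorm (state_of \<mu>) (kernel m f - kernel n f) \<le> e" if "m \<ge> N" "n \<ge> N" for m n
  proof (rule power2_le_imp_le)
    let ?a = "kernel m f - kernel n f"
    have "(\<integral>x. cmod (apply_bcontfun ?a x) \<partial>\<mu>) \<le>
      (\<integral>x. cmod (apply_bcontfun (kernel m f - g) x) + cmod (apply_bcontfun (kernel n f - g) x) \<partial>\<mu>)"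
    proof (intro integral_mono Bochner_Integration.integrable_add integrable_norm \<mu>.integrable_bcontfun)
      fix x show "cmod (apply_bcontfun ?a x) \<le> cmod (apply_bcontfun (kernel m f - g) x) + cmod (apply_bcontfun (kernel n f - g) x)"
        using norm_triangle_ineq4[of "apply_bcontfun (kernel m f - g) x" "apply_bcontfun (kernel n f - g) x"] by simp
    qed
    also have "\<dots> = (\<integral>x. cmod (apply_bcontfun (kernel m f - g) x) \<partial>\<mu>) + (\<integral>x. cmod (apply_bcontfun (kernel n f - g) x) \<partial>\<mu>)"
      by (intro Bochner_Integration.integral_add integrable_norm \<mu>.integrable_bcontfun)
    also have "\<dots> \<le> 4 * r" using N[OF that(1)] N[OF that(2)] by simp
    finally have "(\<integral>x. cmod (apply_bcontfun ?a x) \<partial>\<mu>) \<le> 4 * r" .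
    moreover have "norm ?a \<le> B"
      using norm_triangle_ineq4[of "kernel m f" "kernel n f"] norm_markov_le[OF markov_kernel, of m f]
        norm_markov_le[OF markov_kernel, of n f] by (simp add: B_def)
    ultimately have "norm ?a * (\<integral>x. cmod (apply_bcontfun ?a x) \<partial>\<mu>) \<le> B * (4 * r)"
      using B by (intro mult_mono) (auto intro: Bochner_Integration.integral_nonneg)
    also have "\<dots> = e\<^sup>2" using B by (simp add: r_def)
    finally show "(gns_seminorm (state_of \<mu>) ?a)\<^sup>2 \<le> e\<^sup>2"
      using q_square_le_L1[of ?a] by linarith
  qed (use e in simp)
  then show "\<exists>N. \<forall>m\<ge>N. \<forall>n\<ge>N. gns_seminorm (state_of \<mu>) (kernel m f - kernel n f) \<le> e" by blast
qed

text \<open>On \<open>S\<close> the density is known and continuous: \<open>s\<close> itself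
  satisfies the assumption of \<open>kernel_L1\<close> with error zero.\<close>

lemma kernel_S:
  assumes s: "s \<in> S"
  shows "(\<lambda>n. gns_seminorm (state_of \<mu>) (kernel n s - s)) \<longlonglongrightarrow> 0"
proof (rule LIMSEQ_I)
  fix e :: real assume e: "e > 0"
  define B where "B = 2 * norm s + 1"
  have B: "B > 0" using norm_ge_zero[of s] unfolding B_def by linarith
  define r where "r = (e / 2)\<^sup>2 / B"
  have r: "r > 0" using e B by (simp add: r_def)
  obtain N where N: "\<And>n. n \<ge> N \<Longrightarrow> (\<integral>x. cmod (apply_bcontfun (kernel n s - s) x) \<partial>\<mu>) \<le> 0 + r"
    using kernel_L1[of s s 0 r] r L_S[OF s] by auto
  have "gns_seminorm (state_of \<mu>) (kernel n s - s) \<le> e / 2" if "n \<ge> N" for n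
  proof (rule power2_le_imp_le)
    have "norm (kernel n s - s) \<le> B"
      using norm_triangle_ineq4[of "kernel n s" s] norm_markov_le[OF markov_kernel, of n s] by (simp add: B_def)
    then have "norm (kernel n s - s) * (\<integral>x. cmod (apply_bcontfun (kernel n s - s) x) \<partial>\<mu>) \<le> B * r"
      using N[OF that] B by (intro mult_mono) (auto intro: Bochner_Integration.integral_nonneg)
    also have "\<dots> = (e / 2)\<^sup>2" using B by (simp add: r_def)
    finally show "(gns_seminorm (state_of \<mu>) (kernel n s - s))\<^sup>2 \<le> (e / 2)\<^sup>2"
      using q_square_le_L1[of "kernel n s - s"] by linarith
  qed (use e in simp)
  then have "norm (gns_seminorm (state_of \<mu>) (kernel n s - s) - 0) < e" if "n \<ge> N" for n
    using that e by (smt (verit) \<mu>.q_nonneg field_sum_of_halves real_norm_def)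
  then show "\<exists>N. \<forall>n\<ge>N. norm (gns_seminorm (state_of \<mu>) (kernel n s - s) - 0) < e" by blast
qed

lemma approximate_kernel: "approximate_kernel (state_of \<mu>) kernel"
  by unfold_locales (rule markov_kernel kernel_Cauchy)+

lemma strong: "strong_dilation_le S (state_of \<mu>) (state_of \<nu>)"
proof (rule approximate_kernel.strong_dilation[OF approximate_kernel kernel_S])
  fix f
  have "state_of \<mu> (kernel n f) = state_of \<nu> f" for n by (rule state_of_kernel)
  then show "(\<lambda>n. state_of \<mu> (kernel n f)) \<longlonglongrightarrow> state_of \<nu> f" by simp
qed

end

subsection \<open>Separability\<close>

definition dense_seq :: "(nat \<Rightarrow> 'v::metric_space) \<Rightarrow> 'v set \<Rightarrow> bool" where
  "dense_seq d V \<longleftrightarrow> range d \<subseteq> V \<and> (\<forall>v\<in>V. \<forall>e>0. \<exists>i. dist v (d i) < e)"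

text \<open>For each \<open>i\<close> and each precision \<open>1 / (k + 1)\<close>, a point of
  \<open>V\<close> near \<open>d i\<close> is chosen if there is one. The sequence has to lie in
  \<open>V\<close> because, for \<open>V = S\<close>, only elements of \<open>S\<close> are fixed in
  the limit.\<close>

lemma dense_seq_subset:
  fixes d :: "nat \<Rightarrow> 'v::metric_space" and V :: "'v set"
  assumes d: "dense_seq d UNIV" and "V \<noteq> {}"
  obtains s where "dense_seq s V"
proof -
  obtain v0 where v0: "v0 \<in> V" using assms by blast
  define near where "near i k v \<longleftrightarrow> v \<in> V \<and> dist v (d i) < 1 / real (Suc k)" for i k and v :: 'v
  define c where "c i k = (if Ex (near i k) then Eps (near i k) else v0)" for i k
  have near: "near i k (c i k)" if "near i k v" for i k v
    using that someI[of "near i k"] by (auto simp: c_def)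
  have cV: "c i k \<in> V" for i k
    using v0 near unfolding c_def by (metis near_def)
  have "dense_seq (\<lambda>n. case prod_decode n of (i, k) \<Rightarrow> c i k) V"
    unfolding dense_seq_def
  proof (intro conjI ballI allI impI)
    fix v e assume v: "v \<in> V" and e: "(e :: real) > 0"
    obtain k where k: "1 / real (Suc k) < e / 2" using nat_approx_posE[of "e / 2"] e by auto
    have "1 / real (Suc k) > 0" by simp
    then obtain i where i: "dist v (d i) < 1 / real (Suc k)"
      using d unfolding dense_seq_def by blast
    have "dist (c i k) (d i) < 1 / real (Suc k)"
      using near[of i k v] i v by (auto simp: near_def)
    then have "dist v (c i k) < e"
      using i k dist_triangle2[of v "c i k" "d i"] by linarith
    then show "\<exists>n. dist v (case prod_decode n of (i, k) \<Rightarrow> c i k) < e"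
      by (intro exI[of _ "prod_encode (i, k)"]) simp
  qed (auto simp: cV split: prod.splits)
  then show thesis by (rule that)
qed

text \<open>Small oscillation on the cells lets combinations of the weights, with coefficients from
  a countable dense set, approximate every function. Coefficient families are extensional on the
  finite set \<open>Z n\<close>, which keeps them countable.\<close>

lemma (in fine_partitions) separable:
  obtains d :: "nat \<Rightarrow> 'a \<Rightarrow>\<^sub>C complex" where "dense_seq d UNIV"
proof -
  obtain Q :: "complex set" where Q: "countable Q" "\<And>X. open X \<Longrightarrow> X \<noteq> {} \<Longrightarrow> \<exists>c\<in>Q. c \<in> X"
    using countable_dense_exists[where 'a = complex] by blast
  define A where "A n c = (\<Sum>z\<in>Z n. const_bcontfun (c z) * of_real_fun (p n z))" for n c
  define D where "D = (\<Union>n. A n ` (Z n \<rightarrow>\<^sub>E Q))"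
  have "countable D"
    unfolding D_def using Q(1) finite by (intro countable_UN countable_image countable_PiE) auto
  have dense: "\<exists>d\<in>D. dist f d < e" if e: "e > 0" for f e
  proof -
    have "e / 2 > 0" using e by simp
    then obtain n where n: "\<And>z x. z \<in> Z n \<Longrightarrow> apply_bcontfun (p n z) x \<noteq> 0 \<Longrightarrow>
        cmod (apply_bcontfun f x - apply_bcontfun f z) < e / 4"
      using fine[of "e / 4" f] e by auto
    have "\<exists>c\<in>Q. c \<in> ball (apply_bcontfun f z) (e / 4)" for z
      using Q(2)[of "ball (apply_bcontfun f z) (e / 4)"] e by auto
    then obtain c where c: "\<And>z. c z \<in> Q" "\<And>z. dist (apply_bcontfun f z) (c z) < e / 4"
      by (metis mem_ball)
    define c' where "c' = restrict c (Z n)"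
    have "A n c' \<in> D" unfolding D_def c'_def using c(1) by (intro UN_I[of n] imageI) auto
    moreover have "dist f (A n c') \<le> e / 2"
    proof (rule dist_bound)
      fix x
      have "apply_bcontfun (A n c') x = (\<Sum>z\<in>Z n. of_real (apply_bcontfun (p n z) x) * c z)"
        by (simp add: A_def c'_def mult.commute)
      then have "apply_bcontfun f x - apply_bcontfun (A n c') x =
          (\<Sum>z\<in>Z n. of_real (apply_bcontfun (p n z) x) * (apply_bcontfun f x - c z))"
        using sum_one[of n x] by (simp add: right_diff_distrib sum_subtractf flip: sum_distrib_right of_real_sum)
      then have "dist (apply_bcontfun f x) (apply_bcontfun (A n c') x) \<le>
          (\<Sum>z\<in>Z n. cmod (of_real (apply_bcontfun (p n z) x) * (apply_bcontfun f x - c z)))"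
        by (simp add: dist_norm norm_sum)
      also have "\<dots> \<le> (\<Sum>z\<in>Z n. apply_bcontfun (p n z) x * (e / 2))"
      proof (rule sum_mono)
        fix z assume z: "z \<in> Z n"
        show "cmod (of_real (apply_bcontfun (p n z) x) * (apply_bcontfun f x - c z)) \<le> apply_bcontfun (p n z) x * (e / 2)"
        proof (cases "apply_bcontfun (p n z) x = 0")
          case False
          have "cmod (apply_bcontfun f x - c z) \<le>
              cmod (apply_bcontfun f x - apply_bcontfun f z) + cmod (apply_bcontfun f z - c z)"
            using norm_triangle_ineq[of "apply_bcontfun f x - apply_bcontfun f z" "apply_bcontfun f z - c z"] by simp
          also have "\<dots> \<le> e / 2" using n[OF z False] c(2)[of z] by (simp add: dist_norm)
          finally have "apply_bcontfun (p n z) x * cmod (apply_bcontfun f x - c z) \<le> apply_bcontfun (p n z) x * (e / 2)"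
            using nonneg by (rule mult_left_mono)
          then show ?thesis using nonneg[of n z x] by (simp add: norm_mult)
        qed simp
      qed
      also have "\<dots> = e / 2" using sum_one[of n x] by (simp flip: sum_distrib_right sum_divide_distrib)
      finally show "dist (apply_bcontfun f x) (apply_bcontfun (A n c') x) \<le> e / 2" .
    qed
    ultimately show ?thesis using e by (intro bexI[of _ "A n c'"]) auto
  qed
  then have "D \<noteq> {}" using zero_less_one by blast
  then have "dense_seq (from_nat_into D) UNIV"
    unfolding dense_seq_def
  proof (intro conjI ballI allI impI)
    fix v e assume "(e :: real) > 0"
    then obtain d where "d \<in> D" "dist v d < e" using dense by blast
    then show "\<exists>i. dist v (from_nat_into D i) < e"
      using from_nat_into_surj[OF \<open>countable D\<close>, of d] by auto
  qed simp
  then show thesis by (rule that)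
qed

subsection \<open>Disintegration along a barycenter\<close>

context state
begin

lemma gns_Cauchy_summable:
  assumes "summable (\<lambda>j. q (u j - u (Suc j)))"
  shows "u \<in> gns_Cauchy \<phi>"
proof (rule gns_CauchyI)
  fix e :: real assume "e > 0"
  then obtain N where N: "\<And>m n. m \<ge> N \<Longrightarrow> norm (sum (\<lambda>j. q (u j - u (Suc j))) {m..<n}) < e"
    using assms unfolding summable_Cauchy by blast
  have "q (u m - u n) \<le> sum (\<lambda>j. q (u j - u (Suc j))) {m..<n}" if "m \<le> n" for m n
    using that
  proof (induction n rule: dec_induct)
    case (step n)
    then show ?case using q_triangle_diff[of "u m" "u (Suc n)" "u n"] by simp
  qed simp
  then have le: "q (u m - u n) \<le> e" if "N \<le> m" "m \<le> n" for m n
    using N[OF that(1), of n] that by (smt (verit) real_norm_def)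
  have "q (u m - u n) \<le> e" if "m \<ge> N" "n \<ge> N" for m n
    using le[of m n] le[of n m] that q_commute[of "u m" "u n"] by (cases "m \<le> n") auto
  then show "\<exists>N. \<forall>m\<ge>N. \<forall>n\<ge>N. q (u m - u n) \<le> e" by blast
qed

text \<open>Markov maps are contractions for the sup norm, so replacing \<open>f\<close> by
  \<open>d i\<close> costs the same small amount at every stage.\<close>

lemma gns_Cauchy_dense:
  assumes k: "\<And>n. markov (k n)" and d: "dense_seq d UNIV" and u: "\<And>i. (\<lambda>n. k n (d i)) \<in> gns_Cauchy \<phi>"
  shows "(\<lambda>n. k n f) \<in> gns_Cauchy \<phi>"
proof (rule gns_CauchyI)
  fix e :: real assume e: "e > 0"
  then obtain i where i: "dist f (d i) < e / 3"
    using d unfolding dense_seq_def by (metis UNIV_I divide_pos_pos zero_less_numeral)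
  have close: "q (k n f - k n (d i)) \<le> e / 3" for n
    using q_le_norm[of "k n (f - d i)"] norm_markov_le[OF k, of n "f - d i"] i
    by (simp add: markov_diff[OF k] dist_norm)
  obtain N where N: "\<And>m n. m \<ge> N \<Longrightarrow> n \<ge> N \<Longrightarrow> q (k m (d i) - k n (d i)) < e / 3"
    using gns_CauchyD[OF u, of "e / 3" i] e by auto
  have "q (k m f - k n f) \<le> e" if "m \<ge> N" "n \<ge> N" for m n
    using q_triangle_diff[of "k m f" "k n f" "k m (d i)"] q_triangle_diff[of "k m (d i)" "k n f" "k n (d i)"]
      close[of m] close[of n] N[OF that] q_commute[of "k n f" "k n (d i)"] by simp
  then show "\<exists>N. \<forall>m\<ge>N. \<forall>n\<ge>N. q (k m f - k n f) \<le> e" by blast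
qed

lemma fixed_dense:
  assumes k: "\<And>n. markov (k n)" and d: "dense_seq d V" and v: "v \<in> V"
    and u: "\<And>i. (\<lambda>n. q (k n (d i) - d i)) \<longlonglongrightarrow> 0"
  shows "(\<lambda>n. q (k n v - v)) \<longlonglongrightarrow> 0"
proof (rule LIMSEQ_I)
  fix e :: real assume e: "e > 0"
  then obtain i where i: "dist v (d i) < e / 3"
    using d v unfolding dense_seq_def by (metis divide_pos_pos zero_less_numeral)
  have close: "q (k n v - k n (d i)) \<le> e / 3" for n
    using q_le_norm[of "k n (v - d i)"] norm_markov_le[OF k, of n "v - d i"] i
    by (simp add: markov_diff[OF k] dist_norm)
  have close': "q (d i - v) < e / 3"
    using q_le_norm[of "d i - v"] i by (simp add: dist_norm norm_minus_commute)
  obtain N where N: "\<And>n. n \<ge> N \<Longrightarrow> q (k n (d i) - d i) < e / 3"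
    using LIMSEQ_D[OF u, of "e / 3" i] e by auto
  have "norm (q (k n v - v) - 0) < e" if "n \<ge> N" for n
    using q_triangle_diff[of "k n v" v "k n (d i)"] q_triangle_diff[of "k n (d i)" v "d i"]
      close[of n] close' N[OF that] by simp
  then show "\<exists>N. \<forall>n\<ge>N. norm (q (k n v - v) - 0) < e" by blast
qed

end

locale barycentric = prob_space m for m :: "'a::topological_space functional measure" +
  fixes \<phi> :: "'a functional"
  assumes sets_m: "sets m = sets (restrict_space borel state_space)"
    and barycenter: "barycenter m = \<phi>"
begin

lemma space_m: "space m = state_space"
  using sets_eq_imp_space_eq[OF sets_m] by (simp add: space_restrict_space)

lemma measurable_eval [measurable]: "(\<lambda>\<alpha>. \<alpha> a) \<in> borel_measurable m"
proof -
  have "(\<lambda>\<alpha> :: 'a functional. \<alpha> a) \<in> borel_measurable borel"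
    by (rule borel_measurable_continuous_onI) simp
  then have "(\<lambda>\<alpha> :: 'a functional. \<alpha> a) \<in> borel_measurable (restrict_space borel state_space)"
    by (rule measurable_restrict_space1)
  then show ?thesis using measurable_cong_sets[OF sets_m refl] by blast
qed

lemma state_m: "\<alpha> \<in> space m \<Longrightarrow> state \<alpha>"
  by (simp add: space_m state_def)

lemma eval_le: "\<alpha> \<in> space m \<Longrightarrow> cmod (\<alpha> a) \<le> norm a"
  using state.norm_le[OF state_m] .

lemma integrable_eval: "integrable m (\<lambda>\<alpha>. \<alpha> a)"
  by (rule integrable_const_bound[of _ "norm a"]) (auto simp: eval_le)

lemma integral_eval: "(\<integral>\<alpha>. \<alpha> a \<partial>m) = \<phi> a"
  using barycenter unfolding barycenter_def by (metis (mono_tags))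

text \<open>Fast convergence to zero in \<open>L\<^sup>2(\<phi>)\<close> passes to almost every \<open>L\<^sup>2(\<alpha>)\<close>, since
  \<open>\<parallel>a\<parallel>\<^sup>2\<close> in \<open>L\<^sup>2(\<phi>)\<close> is the \<open>m\<close>-average of \<open>\<parallel>a\<parallel>\<^sup>2\<close> in \<open>L\<^sup>2(\<alpha>)\<close>.\<close>

lemma AE_summable:
  assumes a: "\<And>j. gns_seminorm \<phi> (a j) \<le> (1 / 4) ^ j" and \<phi>: "\<phi> \<in> state_space"
  shows "AE \<alpha> in m. summable (\<lambda>j. gns_seminorm \<alpha> (a j))"
proof -
  interpret state \<phi> using \<phi> by unfold_locales
  \<comment> \<open>The weight splits the decay: the integral of \<open>h j\<close> is at most
    \<open>4 ^ j * (1/16) ^ j = (1/4) ^ j\<close>, hence summable, and a finite sum at \<alpha>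
    still leaves seminorms of order \<open>(1/2) ^ j\<close>.\<close>
  define h where "h j \<alpha> = 4 ^ j * Re (\<alpha> (adj (a j) * a j))" for j and \<alpha> :: "'a functional"
  have h_meas [measurable]: "h j \<in> borel_measurable m" for j
    unfolding h_def by measurable
  have h_nonneg: "0 \<le> h j \<alpha>" if "\<alpha> \<in> space m" for j \<alpha>
    using state.pos_square[OF state_m[OF that]] by (simp add: h_def complex_nonneg_Reals_iff)
  have "(\<integral>\<^sup>+\<alpha>. ennreal (h j \<alpha>) \<partial>m) \<le> ennreal ((1 / 4) ^ j)" for j
  proof -
    have int: "integrable m (h j)"
      unfolding h_def using integrable_eval by (intro integrable_mult_right integrable_Re)
    then have "(\<integral>\<^sup>+\<alpha>. ennreal (h j \<alpha>) \<partial>m) = ennreal (\<integral>\<alpha>. h j \<alpha> \<partial>m)"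
      using h_nonneg by (intro nn_integral_eq_integral) auto
    also have "(\<integral>\<alpha>. h j \<alpha> \<partial>m) = 4 ^ j * (gns_seminorm \<phi> (a j))\<^sup>2"
      using integral_Re[OF integrable_eval] by (simp add: h_def q_square integral_eval)
    also have "\<dots> \<le> 4 ^ j * ((1 / 4) ^ j)\<^sup>2"
      using a[of j] by (intro mult_left_mono power_mono) auto
    also have "\<dots> = (1 / 4) ^ j"
      by (simp add: power2_eq_square field_simps)
    finally show ?thesis by (simp add: ennreal_leI)
  qed
  then have "(\<Sum>j. \<integral>\<^sup>+\<alpha>. ennreal (h j \<alpha>) \<partial>m) \<le> (\<Sum>j. ennreal ((1 / 4) ^ j))"
    by (intro suminf_le) auto
  moreover have "(\<Sum>j. ennreal ((1 / 4) ^ j)) \<noteq> top"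
    by (rule ennreal_suminf_neq_top) auto
  ultimately have "(\<integral>\<^sup>+\<alpha>. (\<Sum>j. ennreal (h j \<alpha>)) \<partial>m) \<noteq> \<infinity>"
    by (subst nn_integral_suminf) (auto simp: top_unique)
  then have "AE \<alpha> in m. (\<Sum>j. ennreal (h j \<alpha>)) \<noteq> \<infinity>"
    by (intro nn_integral_PInf_AE) auto
  then show ?thesis
    using AE_space
  proof eventually_elim
    fix \<alpha> assume fin: "(\<Sum>j. ennreal (h j \<alpha>)) \<noteq> \<infinity>" and \<alpha>: "\<alpha> \<in> space m"
    interpret \<alpha>: state \<alpha> by (rule state_m[OF \<alpha>])
    obtain B where B: "B \<ge> 0" "(\<Sum>j. ennreal (h j \<alpha>)) = ennreal B"
      using fin by (cases "(\<Sum>j. ennreal (h j \<alpha>))") auto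
    have hB: "h j \<alpha> \<le> B" for j
    proof -
      have "ennreal (h j \<alpha>) \<le> ennreal B"
        unfolding B(2)[symmetric] using sum_le_suminf[of "\<lambda>j. ennreal (h j \<alpha>)" "{j}"] by simp
      then show ?thesis using B(1) by (simp add: ennreal_le_iff)
    qed
    have bound: "gns_seminorm \<alpha> (a j) \<le> sqrt B * (1 / 2) ^ j" for j
    proof (rule power2_le_imp_le)
      have "4 ^ j * (gns_seminorm \<alpha> (a j))\<^sup>2 \<le> B"
        using hB[of j] by (simp add: h_def \<alpha>.q_square)
      then have "(gns_seminorm \<alpha> (a j))\<^sup>2 \<le> B * (1 / 4) ^ j"
        by (simp add: power_divide field_simps)
      also have "(1 / 4 :: real) ^ j = ((1 / 2) ^ j)\<^sup>2"
        by (simp add: power2_eq_square flip: power_mult_distrib)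
      also have "B * ((1 / 2) ^ j)\<^sup>2 = (sqrt B * (1 / 2) ^ j)\<^sup>2"
        using B(1) by (simp add: power_mult_distrib)
      finally show "(gns_seminorm \<alpha> (a j))\<^sup>2 \<le> (sqrt B * (1 / 2) ^ j)\<^sup>2" .
    qed (use B in simp)
    have "summable (\<lambda>j. sqrt B * (1 / 2) ^ j)"
      by (rule summable_mult, rule summable_geometric) simp
    then show "summable (\<lambda>j. gns_seminorm \<alpha> (a j))"
      by (rule summable_comparison_test'[where N = 0]) (simp add: bound)
  qed
qed

end

text \<open>The same maps that approximate a dilation of \<open>\<phi>\<close> approximate dilations of almost all the
  states over which \<open>\<phi>\<close> is averaged, after passing to a fast subsequence.\<close>

lemma (in approximate_kernel) isd:
  assumes S: "\<And>s. s \<in> S \<Longrightarrow> (\<lambda>n. q (k n s - s)) \<longlonglongrightarrow> 0" and "S \<noteq> {}"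
    and \<psi>: "\<And>f n. \<phi> (k n f) = \<psi> f"
    and d: "dense_seq (d :: nat \<Rightarrow> 'a \<Rightarrow>\<^sub>C complex) UNIV"
  shows "isd_le S \<phi> \<psi>"
  unfolding isd_le_def
proof (intro allI impI, elim conjE)
  fix m assume m: "state_prob m" "barycenter m = \<phi>"
  then interpret m: barycentric m \<phi>
    by (simp add: barycentric_def barycentric_axioms_def state_prob_def)
  obtain s where s: "dense_seq s S" by (rule dense_seq_subset[OF d \<open>S \<noteq> {}\<close>]) blast
  have sS: "s i \<in> S" for i using s by (auto simp: dense_seq_def)
  \<comment> \<open>Diagonal choice: stage \<open>j\<close> controls only the finitely many indices
    \<open>i \<le> j\<close>, so a single \<open>N\<close> serves them all.\<close>
  have "\<exists>N. \<forall>i\<le>j. \<forall>n\<ge>N. (\<forall>n'\<ge>N. q (k n (d i) - k n' (d i)) \<le> (1 / 4) ^ j) \<and> q (k n (s i) - s i) \<le> (1 / 4) ^ j" for j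
  proof -
    have "\<exists>N. \<forall>n\<ge>N. (\<forall>n'\<ge>N. q (k n (d i) - k n' (d i)) \<le> (1 / 4) ^ j) \<and> q (k n (s i) - s i) \<le> (1 / 4) ^ j" for i
    proof -
      obtain N1 where N1: "\<And>n n'. n \<ge> N1 \<Longrightarrow> n' \<ge> N1 \<Longrightarrow> q (k n (d i) - k n' (d i)) < (1 / 4) ^ j"
        using gns_CauchyD[OF Cauchy[of "d i"], of "(1 / 4) ^ j"] by auto
      obtain N2 where N2: "\<And>n. n \<ge> N2 \<Longrightarrow> q (k n (s i) - s i) < (1 / 4) ^ j"
        using LIMSEQ_D[OF S[OF sS], of "(1 / 4) ^ j" i] by auto
      show ?thesis
        by (intro exI[of _ "max N1 N2"]) (auto intro: less_imp_le N1 N2)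
    qed
    then obtain N where N: "\<And>i n. n \<ge> N i \<Longrightarrow> (\<forall>n'\<ge>N i. q (k n (d i) - k n' (d i)) \<le> (1 / 4) ^ j)
        \<and> q (k n (s i) - s i) \<le> (1 / 4) ^ j" by metis
    have "N i \<le> Max (N ` {..j})" if "i \<le> j" for i using that by (intro Max_ge) auto
    then show ?thesis
      using N by (intro exI[of _ "Max (N ` {..j})"]) (meson order_trans)
  qed
  then obtain N where N: "\<And>j i n n'. i \<le> j \<Longrightarrow> n \<ge> N j \<Longrightarrow> n' \<ge> N j \<Longrightarrow> q (k n (d i) - k n' (d i)) \<le> (1 / 4) ^ j"
    "\<And>j i n. i \<le> j \<Longrightarrow> n \<ge> N j \<Longrightarrow> q (k n (s i) - s i) \<le> (1 / 4) ^ j" by metis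
  \<comment> \<open>The running maximum makes \<open>r j'\<close> at least \<open>N j\<close>
    whenever \<open>j \<le> j'\<close>, so consecutive terms can be compared at the earlier
    stage.\<close>
  define r where "r j = Max (N ` {..j})" for j
  have r: "N j \<le> r j'" if "j \<le> j'" for j j' unfolding r_def using that by (intro Max_ge) auto
  define \<kappa> where "\<kappa> j = k (r j)" for j
  have \<kappa>: "markov (\<kappa> j)" for j using markov by (simp add: \<kappa>_def)
  have decr: "(1 / 4 :: real) ^ (j + i) \<le> (1 / 4) ^ j" for j i
    by (rule power_decreasing) auto
  \<comment> \<open>The index is shifted by \<open>i\<close> because \<open>d i\<close> is
    controlled only from stage \<open>i\<close> on; summability is insensitive to the shift.\<close>
  have \<kappa>1: "q (\<kappa> (j + i) (d i) - \<kappa> (Suc (j + i)) (d i)) \<le> (1 / 4) ^ j" for j i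
    unfolding \<kappa>_def by (rule order_trans[OF N(1)[of i "j + i"] decr]) (auto intro: r)
  have \<kappa>2: "q (\<kappa> (j + i) (s i) - s i) \<le> (1 / 4) ^ j" for j i
    unfolding \<kappa>_def by (rule order_trans[OF N(2)[of i "j + i"] decr]) (auto intro: r)
  have "AE \<alpha> in m. \<forall>i. summable (\<lambda>j. gns_seminorm \<alpha> (\<kappa> (j + i) (d i) - \<kappa> (Suc (j + i)) (d i)))"
    "AE \<alpha> in m. \<forall>i. summable (\<lambda>j. gns_seminorm \<alpha> (\<kappa> (j + i) (s i) - s i))"
    unfolding AE_all_countable using \<kappa>1 \<kappa>2 state by (auto intro!: m.AE_summable)
  then have "AE \<alpha> in m. approximate_kernel \<alpha> \<kappa> \<and> (\<forall>v\<in>S. (\<lambda>n. gns_seminorm \<alpha> (\<kappa> n v - v)) \<longlonglongrightarrow> 0)"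
    using AE_space
  proof eventually_elim
    fix \<alpha> assume 1: "\<forall>i. summable (\<lambda>j. gns_seminorm \<alpha> (\<kappa> (j + i) (d i) - \<kappa> (Suc (j + i)) (d i)))"
      and 2: "\<forall>i. summable (\<lambda>j. gns_seminorm \<alpha> (\<kappa> (j + i) (s i) - s i))" and "\<alpha> \<in> space m"
    interpret \<alpha>: state \<alpha> using \<open>\<alpha> \<in> space m\<close> by (rule m.state_m)
    have "(\<lambda>n. \<kappa> n (d i)) \<in> gns_Cauchy \<alpha>" for i
    proof (rule \<alpha>.gns_Cauchy_summable)
      show "summable (\<lambda>j. gns_seminorm \<alpha> (\<kappa> j (d i) - \<kappa> (Suc j) (d i)))"
        using 1 summable_iff_shift[of "\<lambda>j. gns_seminorm \<alpha> (\<kappa> j (d i) - \<kappa> (Suc j) (d i))" i] by simp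
    qed
    then have C: "(\<lambda>n. \<kappa> n f) \<in> gns_Cauchy \<alpha>" for f
      by (rule \<alpha>.gns_Cauchy_dense[where k = \<kappa>, OF \<kappa> d])
    have "(\<lambda>n. gns_seminorm \<alpha> (\<kappa> n (s i) - s i)) \<longlonglongrightarrow> 0" for i
    proof (rule summable_LIMSEQ_zero)
      show "summable (\<lambda>j. gns_seminorm \<alpha> (\<kappa> j (s i) - s i))"
        using 2 summable_iff_shift[of "\<lambda>j. gns_seminorm \<alpha> (\<kappa> j (s i) - s i)" i] by simp
    qed
    then have "\<forall>v\<in>S. (\<lambda>n. gns_seminorm \<alpha> (\<kappa> n v - v)) \<longlonglongrightarrow> 0"
      using \<alpha>.fixed_dense[where k = \<kappa>, OF \<kappa> s] by blast
    moreover have "approximate_kernel \<alpha> \<kappa>"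
      by unfold_locales (rule \<kappa> C)+
    ultimately show "approximate_kernel \<alpha> \<kappa> \<and> (\<forall>v\<in>S. (\<lambda>n. gns_seminorm \<alpha> (\<kappa> n v - v)) \<longlonglongrightarrow> 0)" by simp
  qed
  then obtain N0 where N0: "{\<alpha> \<in> space m. \<not> (approximate_kernel \<alpha> \<kappa> \<and> (\<forall>v\<in>S. (\<lambda>n. gns_seminorm \<alpha> (\<kappa> n v - v)) \<longlonglongrightarrow> 0))} \<subseteq> N0"
    "emeasure m N0 = 0" "N0 \<in> sets m" by (rule AE_E)
  have good: "approximate_kernel \<alpha> \<kappa>" "\<And>v. v \<in> S \<Longrightarrow> (\<lambda>n. gns_seminorm \<alpha> (\<kappa> n v - v)) \<longlonglongrightarrow> 0"
    if "\<alpha> \<in> state_space" "\<alpha> \<notin> N0" for \<alpha>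
    using N0(1) that by (auto simp: m.space_m)
  have AE_N0: "AE \<alpha> in m. \<alpha> \<notin> N0"
    using N0 by (intro AE_not_in) auto
  \<comment> \<open>On the exceptional set the limit may not exist; the default \<alpha> keeps the
    family measurable and inside the state space.\<close>
  define \<Psi> where "\<Psi> \<alpha> = (if \<alpha> \<in> N0 then \<alpha> else (\<lambda>a. lim (\<lambda>n. \<alpha> (\<kappa> n a))))" for \<alpha>
  have \<Psi>_state: "\<Psi> \<alpha> \<in> state_space" if "\<alpha> \<in> state_space" for \<alpha>
    using approximate_kernel.limit_state[OF good(1)[OF that]] that by (simp add: \<Psi>_def)
  have \<Psi>_meas: "(\<lambda>\<alpha>. \<Psi> \<alpha> a) \<in> borel_measurable m" for a
  proof -
    have "(\<lambda>\<alpha>. if \<alpha> \<in> N0 then \<alpha> a else lim (\<lambda>n. \<alpha> (\<kappa> n a))) \<in> borel_measurable m"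
      using N0(3) by measurable
    moreover have "(\<lambda>\<alpha>. \<Psi> \<alpha> a) = (\<lambda>\<alpha>. if \<alpha> \<in> N0 then \<alpha> a else lim (\<lambda>n. \<alpha> (\<kappa> n a)))"
      by (auto simp: \<Psi>_def)
    ultimately show ?thesis by simp
  qed
  have \<Psi>_lim: "(\<lambda>n. \<alpha> (\<kappa> n a)) \<longlonglongrightarrow> \<Psi> \<alpha> a" if "\<alpha> \<in> state_space" "\<alpha> \<notin> N0" for \<alpha> a
    using approximate_kernel.limit[OF good(1)[OF that]] that by (simp add: \<Psi>_def)
  show "\<exists>\<Psi>. (\<forall>\<alpha>\<in>state_space. \<Psi> \<alpha> \<in> state_space) \<and>
      (\<forall>a. (\<lambda>\<alpha>. \<Psi> \<alpha> a) \<in> borel_measurable (completion m)) \<and>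
      (AE \<alpha> in completion m. dilation_le S \<alpha> (\<Psi> \<alpha>)) \<and>
      (\<forall>a. \<psi> a = (\<integral>\<alpha>. \<Psi> \<alpha> a \<partial>completion m))"
  proof (intro exI[of _ \<Psi>] conjI ballI allI \<Psi>_state measurable_completion \<Psi>_meas AE_completion)
    show "AE \<alpha> in m. dilation_le S \<alpha> (\<Psi> \<alpha>)"
      using AE_N0 AE_space
    proof eventually_elim
      fix \<alpha> assume "\<alpha> \<notin> N0" "\<alpha> \<in> space m"
      then have \<alpha>: "\<alpha> \<in> state_space" "\<alpha> \<notin> N0" by (simp_all add: m.space_m)
      have "strong_dilation_le S \<alpha> (\<Psi> \<alpha>)"
        by (rule approximate_kernel.strong_dilation[OF good(1)[OF \<alpha>] good(2)[OF \<alpha>] \<Psi>_lim[OF \<alpha>]])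
      then show "dilation_le S \<alpha> (\<Psi> \<alpha>)"
        unfolding strong_dilation_le_def dilation_le_def by blast
    qed
    fix a
    \<comment> \<open>The sequence on the left is constant: its terms are
      \<open>\<phi> (\<kappa> n a) = \<psi> a\<close>.\<close>
    have "(\<lambda>n. \<integral>\<alpha>. \<alpha> (\<kappa> n a) \<partial>m) \<longlonglongrightarrow> (\<integral>\<alpha>. \<Psi> \<alpha> a \<partial>m)"
    proof (rule integral_dominated_convergence[where w = "\<lambda>_. norm a"])
      show "AE \<alpha> in m. (\<lambda>n. \<alpha> (\<kappa> n a)) \<longlonglongrightarrow> \<Psi> \<alpha> a"
        using AE_N0 AE_space by eventually_elim (rule \<Psi>_lim, simp_all add: m.space_m)
      show "AE \<alpha> in m. norm (\<alpha> (\<kappa> n a)) \<le> norm a" for n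
        using AE_space by eventually_elim (rule order_trans[OF m.eval_le norm_markov_le[OF \<kappa>]])
    qed (auto intro: \<Psi>_meas)
    moreover have "(\<integral>\<alpha>. \<alpha> (\<kappa> n a) \<partial>m) = \<psi> a" for n
      by (simp add: m.integral_eval \<kappa>_def \<psi>)
    ultimately have "\<psi> a = (\<integral>\<alpha>. \<Psi> \<alpha> a \<partial>m)" by (simp add: LIMSEQ_const_iff)
    then show "\<psi> a = (\<integral>\<alpha>. \<Psi> \<alpha> a \<partial>completion m)"
      by (simp add: integral_completion[OF \<Psi>_meas])
  qed
qed

lemma (in averaged_coupling) isd: "isd_le S (state_of \<mu>) (state_of \<nu>)"
proof -
  obtain d :: "nat \<Rightarrow> 'a \<Rightarrow>\<^sub>C complex" where d: "dense_seq d UNIV" by (rule separable) blast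
  have "S \<noteq> {}" using S by (auto simp: function_system_def)
  show ?thesis
    by (rule approximate_kernel.isd[OF approximate_kernel kernel_S \<open>S \<noteq> {}\<close> state_of_kernel d])
qed

subsection \<open>From dilations to the Choquet order\<close>

context state
begin

lemma inner_gns_rep: "vinner H (gns_rep \<phi> a (gns_vec \<phi>)) (gns_vec \<phi>) = \<phi> a"
  using inner_class[OF gns_Cauchy_const[of a] gns_Cauchy_const[of 1]]
  by (simp add: gns_vec_def gns_rep_class LIMSEQ_const_iff)

lemma dilates_eq:
  assumes "dilation_le S \<phi> \<psi>" "s \<in> S"
  shows "\<psi> s = \<phi> s"
  using assms inner_gns_rep by (auto simp: dilation_le_def dilates_def)

lemma inner_vadd:
  assumes "h \<in> vecs H" "h' \<in> vecs H" "v \<in> vecs H"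
  shows "vinner H (vadd H h h') v = vinner H h v + vinner H h' v"
proof -
  obtain u u' w where u: "u \<in> gns_Cauchy \<phi>" "h = gns_class \<phi> u"
    "u' \<in> gns_Cauchy \<phi>" "h' = gns_class \<phi> u'" "w \<in> gns_Cauchy \<phi>" "v = gns_class \<phi> w"
    using assms by (meson vecsE)
  have "(\<lambda>n. \<phi> (adj (w n) * (u n + u' n))) \<longlonglongrightarrow> vinner H h v + vinner H h' v"
    using tendsto_add[OF inner_class[OF u(1) u(5)] inner_class[OF u(3) u(5)]] u
    by (simp add: distrib_left)
  then show ?thesis
    using LIMSEQ_unique inner_class[OF gns_Cauchy_add[OF u(1) u(3)] u(5)] u by (simp add: vadd_class)
qed

lemma dilates_in_vecs:
  assumes "dilates S \<phi> \<psi> \<Phi>" "h \<in> vecs H"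
  shows "\<Phi> a h \<in> vecs H"
proof -
  have "\<Phi> a \<in> bounded_ops H" using assms(1) by (simp add: dilates_def ucp_map_def)
  then show ?thesis using assms(2) unfolding bounded_ops_def by blast
qed

text \<open>\<open>\<Phi> f\<close> commutes with the square root of \<open>g\<close>, so that \<open>\<Phi> f \<ge> \<pi> s\<close> may be compressed to
  the vector \<open>\<pi> (sqrt g) \<xi>\<close>.\<close>

lemma dilation_compression:
  assumes \<Phi>: "dilates S \<phi> \<psi> \<Phi>"
    and bicomm: "range \<Phi> \<subseteq> commutant H (commutant H (range (gns_rep \<phi>)))"
    and s: "s \<in> S" and fs: "\<And>x. apply_bcontfun (f - s) x \<in> \<real>\<^sub>\<ge>\<^sub>0"
    and g: "\<And>x. apply_bcontfun g x \<in> \<real>\<^sub>\<ge>\<^sub>0"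
  shows "Re (\<phi> (g * s)) \<le> Re (vinner H (\<Phi> f (gns_vec \<phi>)) (gns_class \<phi> (\<lambda>_. g)))"
proof -
  obtain b where b: "g = adj b * b" "adj b = b" by (rule nonneg_sqrt_factor[OF g])
  obtain c where c: "f - s = adj c * c" "adj c = c" by (rule nonneg_sqrt_factor[OF fs])
  have ucp: "ucp_map H \<Phi>" and \<Phi>s: "\<Phi> s = gns_rep \<phi> s"
    using \<Phi> s by (auto simp: dilates_def)
  note in_vecs = dilates_in_vecs[OF \<Phi>]
  define h where "h = gns_rep \<phi> b (gns_vec \<phi>)"
  have h: "h = gns_class \<phi> (\<lambda>_. b)"
    by (simp add: h_def gns_vec_def gns_rep_class)
  have hv: "h \<in> vecs H" by (simp add: h class_in_vecs)
  have "pos_matrix 1 (\<lambda>_ _. f - s)"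
    unfolding pos_matrix_def by (intro exI[of _ "\<lambda>_ _. c"]) (simp add: c)
  then have "pos_op_matrix H 1 (\<lambda>_ _. \<Phi> (f - s))"
    using ucp by (simp add: ucp_map_def)
  then have "(\<Sum>i<1 :: nat. \<Sum>j<1 :: nat. vinner H (\<Phi> (f - s) h) h) \<in> \<real>\<^sub>\<ge>\<^sub>0"
    using hv unfolding pos_op_matrix_def by (elim allE[of _ "\<lambda>_. h"]) auto
  then have pos: "0 \<le> Re (vinner H (\<Phi> (f - s) h) h)"
    by (simp add: complex_nonneg_Reals_iff)
  have "\<Phi> ((f - s) + s) h = vadd H (\<Phi> (f - s) h) (\<Phi> s h)"
    using ucp hv by (simp only: ucp_map_def)
  then have "vinner H (\<Phi> f h) h = vinner H (\<Phi> (f - s) h) h + vinner H (\<Phi> s h) h"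
    using hv in_vecs by (simp add: inner_vadd)
  moreover have "vinner H (\<Phi> s h) h = \<phi> (g * s)"
    using inner_class[OF gns_Cauchy_const[of "s * b"] gns_Cauchy_const[of b]]
    by (simp add: \<Phi>s h gns_rep_class b mult_ac LIMSEQ_const_iff)
  moreover have "vinner H (\<Phi> f h) h = vinner H (\<Phi> f (gns_vec \<phi>)) (gns_class \<phi> (\<lambda>_. g))"
  proof -
    \<comment> \<open>Multiplication by \<open>b\<close> lies in the commutant of the
      representation, so \<open>\<Phi> f\<close> may be moved past it and the two factors
      \<open>b\<close> combine to \<open>g\<close>.\<close>
    have "\<Phi> f \<in> commutant H (commutant H (range (gns_rep \<phi>)))" using bicomm by blast
    then have "\<Phi> f h = gns_rep \<phi> b (\<Phi> f (gns_vec \<phi>))"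
      using gns_rep_in_commutant[of b] unfolding commutant_def[of _ "commutant _ _"] h_def by simp
    moreover obtain w where w: "w \<in> gns_Cauchy \<phi>" "\<Phi> f (gns_vec \<phi>) = gns_class \<phi> w"
      using in_vecs[OF gns_vec_in] by (rule vecsE)
    ultimately have "(\<lambda>n. \<phi> (adj b * (b * w n))) \<longlonglongrightarrow> vinner H (\<Phi> f h) h"
      using inner_class[OF gns_Cauchy_mult_left[OF w(1), of b] gns_Cauchy_const[of b]]
      by (simp add: h gns_rep_class)
    moreover have "(\<lambda>n. \<phi> (adj g * w n)) \<longlonglongrightarrow> vinner H (\<Phi> f (gns_vec \<phi>)) (gns_class \<phi> (\<lambda>_. g))"
      using inner_class[OF w(1) gns_Cauchy_const[of g]] by (simp add: w)
    moreover have "adj b * (b * w n) = adj g * w n" for n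
      by (simp add: b mult_ac)
    ultimately show ?thesis using LIMSEQ_unique by simp
  qed
  ultimately show ?thesis using pos by simp
qed

text \<open>The functions \<open>max 0 (s - f + e)\<close>, normalised, form a partition of unity subordinate to the
  sets where \<open>s\<close> nearly attains the maximum \<open>f\<close>.\<close>

lemma strong_dilation_maxima:
  assumes "strong_dilation_le S \<phi> \<psi>" and f: "f \<in> maxima S"
  shows "Re (\<phi> (of_real_fun f)) \<le> Re (\<psi> (of_real_fun f))"
proof (rule field_le_epsilon)
  fix e :: real assume e: "e > 0"
  obtain \<Phi> where \<Phi>: "dilates S \<phi> \<psi> \<Phi>" "range \<Phi> \<subseteq> commutant H (commutant H (range (gns_rep \<phi>)))"
    using assms(1) by (auto simp: strong_dilation_le_def)
  obtain F where F: "finite F" "F \<noteq> {}" "F \<subseteq> real_elements S"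
    and fF: "\<And>x. apply_bcontfun f x = Max ((\<lambda>s. Re (apply_bcontfun s x)) ` F)"
    using f by (auto simp: maxima_def)
  have le: "Re (apply_bcontfun s x) \<le> apply_bcontfun f x" if "s \<in> F" for s x
    unfolding fF using that F by (intro Max_ge) auto
  have real: "Im (apply_bcontfun s x) = 0" if "s \<in> F" for s x
    using that F(3) by (auto simp: real_elements_def complex_is_Real_iff)
  \<comment> \<open>The shift by \<open>e\<close> gives a maximal \<open>s\<close> the weight
    \<open>e\<close>, so the sum is positive everywhere; a nonzero weight still forces
    \<open>s > f - e\<close>.\<close>
  define w where "w s x = max 0 (Re (apply_bcontfun s x) - apply_bcontfun f x + e)" for s x
  define W where "W x = (\<Sum>s\<in>F. w s x)" for x
  have w0: "0 \<le> w s x" for s x by (simp add: w_def)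
  have Wle: "w s x \<le> W x" if "s \<in> F" for s x
    unfolding W_def using that F(1) w0 by (intro member_le_sum) auto
  have W: "W x > 0" for x
  proof -
    have "apply_bcontfun f x \<in> (\<lambda>s. Re (apply_bcontfun s x)) ` F"
      unfolding fF using F by (intro Max_in) auto
    then obtain s where "s \<in> F" "apply_bcontfun f x = Re (apply_bcontfun s x)" by auto
    then show ?thesis using Wle[of s x] e by (simp add: w_def)
  qed
  have wcont: "continuous_on UNIV (w s)" for s
    unfolding w_def by (intro continuous_intros continuous_on_apply_bcontfun)
  have Wcont: "continuous_on UNIV W"
    unfolding W_def by (intro continuous_on_sum wcont)
  define g :: "('a \<Rightarrow>\<^sub>C complex) \<Rightarrow> 'a \<Rightarrow>\<^sub>C complex"
    where "g s = Bcontfun (\<lambda>x. of_real (w s x / W x))" for s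
  have g: "apply_bcontfun (g s) x = of_real (w s x / W x)" if "s \<in> F" for s x
  proof -
    have "continuous_on UNIV (\<lambda>x. w s x / W x)"
      by (rule continuous_on_divide[OF wcont Wcont]) (use W in \<open>auto simp: less_le\<close>)
    then have "continuous_on UNIV (\<lambda>x. complex_of_real (w s x / W x))"
      by (rule continuous_on_of_real)
    moreover have "norm (complex_of_real (w s x / W x)) \<le> 1" for x
      using W[of x] Wle[OF that] w0 by (simp only: norm_of_real) (simp add: abs_of_nonneg)
    ultimately have "(\<lambda>x. complex_of_real (w s x / W x)) \<in> bcontfun" by (rule bcontfun_normI)
    then show ?thesis by (simp add: g_def Bcontfun_inverse)
  qed
  have sum_g: "(\<Sum>s\<in>F. g s) = 1"
  proof (rule bcontfun_eqI)
    fix x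
    have "apply_bcontfun (\<Sum>s\<in>F. g s) x = of_real (\<Sum>s\<in>F. w s x / W x)"
      by (simp add: g)
    also have "(\<Sum>s\<in>F. w s x / W x) = 1"
      using W[of x] by (simp add: W_def[of x, symmetric] flip: sum_divide_distrib)
    finally show "apply_bcontfun (\<Sum>s\<in>F. g s) x = apply_bcontfun 1 x" by simp
  qed
  \<comment> \<open>Additivity of \<open>\<Lambda>\<close> over the partition splits
    \<open>\<psi> f\<close> into local pieces, each compared with its own \<open>s\<close>.\<close>
  define \<Lambda> where "\<Lambda> a = vinner H (\<Phi> (of_real_fun f) (gns_vec \<phi>)) (gns_class \<phi> (\<lambda>_. a))" for a
  have "\<Phi> (of_real_fun f) (gns_vec \<phi>) \<in> vecs H"
    by (rule dilates_in_vecs[OF \<Phi>(1) gns_vec_in])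
  then obtain u where u: "u \<in> gns_Cauchy \<phi>" "\<Phi> (of_real_fun f) (gns_vec \<phi>) = gns_class \<phi> u"
    by (rule vecsE)
  have \<Lambda>: "(\<lambda>n. \<phi> (adj a * u n)) \<longlonglongrightarrow> \<Lambda> a" for a
    using inner_class[OF u(1) gns_Cauchy_const[of a]] by (simp add: \<Lambda>_def u(2))
  have "(\<lambda>n. \<Sum>s\<in>F. \<phi> (adj (g s) * u n)) \<longlonglongrightarrow> (\<Sum>s\<in>F. \<Lambda> (g s))"
    by (intro tendsto_sum \<Lambda>)
  moreover have "(\<Sum>s\<in>F. \<phi> (adj (g s) * u n)) = \<phi> (adj 1 * u n)" for n
  proof -
    have "adj (\<Sum>s\<in>F. g s) = (\<Sum>s\<in>F. adj (g s))" by (rule bcontfun_eqI) simp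
    then show ?thesis unfolding sum_g[symmetric] by (simp add: sum_distrib_right)
  qed
  ultimately have "(\<Sum>s\<in>F. \<Lambda> (g s)) = \<Lambda> 1"
    using LIMSEQ_unique[OF \<Lambda>[of 1]] by simp
  also have "\<Lambda> 1 = \<psi> (of_real_fun f)"
    using \<Phi>(1) by (simp add: dilates_def \<Lambda>_def gns_vec_def)
  finally have \<psi>: "\<psi> (of_real_fun f) = (\<Sum>s\<in>F. \<Lambda> (g s))" ..
  have "Re (\<phi> (of_real_fun f - const_bcontfun (of_real e))) \<le> Re (\<phi> (\<Sum>s\<in>F. g s * s))"
  proof (rule mono)
    fix x
    have gs: "apply_bcontfun (\<Sum>s\<in>F. g s * s) x = of_real (\<Sum>s\<in>F. w s x / W x * Re (apply_bcontfun s x))"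
      by (simp add: g complex_eq_iff real)
    show "apply_bcontfun (\<Sum>s\<in>F. g s * s) x \<in> \<real>"
      unfolding gs by simp
    show "apply_bcontfun (of_real_fun f - const_bcontfun (of_real e)) x \<in> \<real>" by simp
    have "(\<Sum>s\<in>F. w s x / W x) = 1"
      using W[of x] by (simp add: W_def[of x, symmetric] flip: sum_divide_distrib)
    then have "apply_bcontfun f x - e = (\<Sum>s\<in>F. w s x / W x * (apply_bcontfun f x - e))"
      by (simp only: sum_distrib_right[symmetric] mult_1)
    also have "\<dots> \<le> (\<Sum>s\<in>F. w s x / W x * Re (apply_bcontfun s x))"
    proof (rule sum_mono)
      fix s
      have "w s x * (apply_bcontfun f x - e) \<le> w s x * Re (apply_bcontfun s x)"
      proof (cases "w s x = 0")
        case False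
        then have "apply_bcontfun f x - e \<le> Re (apply_bcontfun s x)"
          by (auto simp: w_def max_def split: if_splits)
        then show ?thesis using w0 by (rule mult_left_mono)
      qed simp
      then show "w s x / W x * (apply_bcontfun f x - e) \<le> w s x / W x * Re (apply_bcontfun s x)"
        using W[of x] by (simp add: divide_right_mono)
    qed
    finally show "Re (apply_bcontfun (of_real_fun f - const_bcontfun (of_real e)) x) \<le>
        Re (apply_bcontfun (\<Sum>s\<in>F. g s * s) x)"
      unfolding gs by simp
  qed
  then have "Re (\<phi> (of_real_fun f)) - e \<le> (\<Sum>s\<in>F. Re (\<phi> (g s * s)))" by simp
  also have "\<dots> \<le> (\<Sum>s\<in>F. Re (\<Lambda> (g s)))"
  proof (rule sum_mono)
    fix s assume s: "s \<in> F"
    show "Re (\<phi> (g s * s)) \<le> Re (\<Lambda> (g s))"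
      unfolding \<Lambda>_def
    proof (rule dilation_compression[OF \<Phi>])
      show "s \<in> S" using s F(3) by (auto simp: real_elements_def)
      show "apply_bcontfun (of_real_fun f - s) x \<in> \<real>\<^sub>\<ge>\<^sub>0" for x
        using le[OF s] real[OF s] by (simp add: complex_nonneg_Reals_iff)
      show "apply_bcontfun (g s) x \<in> \<real>\<^sub>\<ge>\<^sub>0" for x
        using W[of x] w0[of s x] by (simp only: g[OF s] nonneg_Reals_of_real_iff) simp
    qed
  qed
  also have "\<dots> = Re (\<psi> (of_real_fun f))" by (simp add: \<psi>)
  finally show "Re (\<phi> (of_real_fun f)) \<le> Re (\<psi> (of_real_fun f)) + e" by simp
qed

end

text \<open>Testing against the subdivision of \<open>\<mu>\<close> into point evaluations.\<close>

lemma isd_maxima: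
  assumes "borel_prob \<mu>" "borel_prob \<nu>" and isd: "isd_le S (state_of \<mu>) (state_of \<nu>)" and f: "f \<in> maxima S"
  shows "(\<integral>x. apply_bcontfun f x \<partial>\<mu>) \<le> (\<integral>x. apply_bcontfun f x \<partial>\<nu>)"
proof -
  interpret \<mu>: borel_prob \<mu> by fact
  interpret \<nu>: borel_prob \<nu> by fact
  define \<delta> :: "'a \<Rightarrow> 'a functional" where "\<delta> x = (\<lambda>a. apply_bcontfun a x)" for x
  have \<delta>_state: "\<delta> x \<in> state_space" for x
  proof -
    have "cnj w * w \<in> \<real>\<^sub>\<ge>\<^sub>0" for w :: complex
      using complex_norm_square[of w] by (metis mult.commute nonneg_Reals_of_real_iff zero_le_power2)
    then show ?thesis by (simp add: \<delta>_def state_space_def)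
  qed
  have "continuous_on UNIV \<delta>"
    unfolding \<delta>_def by (intro continuous_on_coordinatewise_then_product) simp
  then have "\<delta> \<in> borel_measurable borel" by (rule borel_measurable_continuous_onI)
  then have "\<delta> \<in> borel_measurable \<mu>" using measurable_cong_sets[OF \<mu>.sets_eq refl] by blast
  then have \<delta>_meas: "\<delta> \<in> \<mu> \<rightarrow>\<^sub>M restrict_space borel state_space"
    using \<delta>_state by (intro measurable_restrict_space2) auto
  define m where "m = distr \<mu> (restrict_space borel state_space) \<delta>"
  have eval_meas [measurable]: "(\<lambda>\<alpha> :: 'a functional. \<alpha> a) \<in> borel_measurable (restrict_space borel state_space)" for a
    by (intro measurable_restrict_space1 borel_measurable_continuous_onI) simp
  have prob_m: "prob_space m" unfolding m_def by (rule \<mu>.prob_space_distr[OF \<delta>_meas])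
  have bary: "barycenter m = state_of \<mu>"
    unfolding barycenter_def state_of_def m_def
    by (subst integral_distr[OF \<delta>_meas eval_meas]) (simp add: \<delta>_def)
  interpret m: barycentric m "state_of \<mu>"
    using prob_m bary by (simp add: barycentric_def barycentric_axioms_def m_def)
  have "state_prob m" using prob_m by (simp add: state_prob_def m_def)
  then obtain \<Psi> where \<Psi>: "\<And>\<alpha>. \<alpha> \<in> state_space \<Longrightarrow> \<Psi> \<alpha> \<in> state_space"
    "\<And>a. (\<lambda>\<alpha>. \<Psi> \<alpha> a) \<in> borel_measurable (completion m)"
    "AE \<alpha> in completion m. dilation_le S \<alpha> (\<Psi> \<alpha>)"
    "\<And>a. state_of \<nu> a = (\<integral>\<alpha>. \<Psi> \<alpha> a \<partial>completion m)"
    using isd bary unfolding isd_le_def by blast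
  interpret cm: prob_space "completion m" by (rule m.prob_space_completion)
  obtain F where F: "finite F" "F \<noteq> {}" "F \<subseteq> real_elements S"
    and fF: "\<And>x. apply_bcontfun f x = Max ((\<lambda>s. Re (apply_bcontfun s x)) ` F)"
    using f by (auto simp: maxima_def)
  \<comment> \<open>Extends \<open>f\<close> from point evaluations to all states:
    \<open>h (\<delta> x) = f x\<close>. For almost every \<alpha> it is at most the value of
    \<open>\<Psi> \<alpha>\<close> at \<open>f\<close>, since \<open>\<Psi> \<alpha>\<close> agrees
    with \<alpha> on \<open>F\<close> and every \<open>s \<in> F\<close> lies below
    \<open>f\<close>.\<close>
  define h where "h \<alpha> = Max ((\<lambda>s. Re (\<alpha> s)) ` F)" for \<alpha> :: "'a functional"
  have h_meas: "h \<in> borel_measurable m"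
    unfolding h_def using F(1) by (intro borel_measurable_Max) measurable
  have h_meas': "h \<in> borel_measurable (restrict_space borel state_space)"
    unfolding h_def using F(1) by (intro borel_measurable_Max) measurable
  have h_bound: "\<bar>h \<alpha>\<bar> \<le> (\<Sum>s\<in>F. norm s)" if "\<alpha> \<in> state_space" for \<alpha>
  proof -
    have "h \<alpha> \<in> (\<lambda>s. Re (\<alpha> s)) ` F" unfolding h_def using F by (intro Max_in) auto
    then obtain s where s: "s \<in> F" "h \<alpha> = Re (\<alpha> s)" by auto
    then have "\<bar>h \<alpha>\<bar> \<le> norm s"
      using abs_Re_le_cmod[of "\<alpha> s"] m.eval_le[of \<alpha> s] that by (simp add: m.space_m)
    also have "\<dots> \<le> (\<Sum>s\<in>F. norm s)" using s F(1) by (intro member_le_sum) auto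
    finally show ?thesis .
  qed
  have int_\<Psi>: "integrable (completion m) (\<lambda>\<alpha>. \<Psi> \<alpha> (of_real_fun f))"
  proof (rule cm.integrable_const_bound[of _ "norm (of_real_fun f)"])
    show "AE \<alpha> in completion m. cmod (\<Psi> \<alpha> (of_real_fun f)) \<le> norm (of_real_fun f)"
      using AE_space by eventually_elim (simp add: m.space_m \<Psi>(1) m.eval_le)
  qed (rule \<Psi>(2))
  have int_h: "integrable (completion m) h"
  proof (rule cm.integrable_const_bound[of _ "\<Sum>s\<in>F. norm s"])
    show "AE \<alpha> in completion m. norm (h \<alpha>) \<le> (\<Sum>s\<in>F. norm s)"
      using AE_space by eventually_elim (simp add: m.space_m h_bound)
  qed (rule measurable_completion[OF h_meas])
  have "(\<integral>\<alpha>. h \<alpha> \<partial>completion m) \<le> (\<integral>\<alpha>. Re (\<Psi> \<alpha> (of_real_fun f)) \<partial>completion m)"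
  proof (rule integral_mono_AE[OF int_h integrable_Re[OF int_\<Psi>]])
    show "AE \<alpha> in completion m. h \<alpha> \<le> Re (\<Psi> \<alpha> (of_real_fun f))"
      using \<Psi>(3) AE_space
    proof eventually_elim
      fix \<alpha> assume dil: "dilation_le S \<alpha> (\<Psi> \<alpha>)" and "\<alpha> \<in> space (completion m)"
      then have \<alpha>: "\<alpha> \<in> state_space" by (simp add: m.space_m)
      interpret \<alpha>: state \<alpha> using \<alpha> by unfold_locales
      interpret \<Psi>: state "\<Psi> \<alpha>" using \<Psi>(1)[OF \<alpha>] by unfold_locales
      have "Re (\<alpha> s) \<le> Re (\<Psi> \<alpha> (of_real_fun f))" if "s \<in> F" for s
      proof -
        have s: "s \<in> S" "\<And>x. apply_bcontfun s x \<in> \<real>" using that F(3) by (auto simp: real_elements_def)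
        have "Re (\<Psi> \<alpha> s) \<le> Re (\<Psi> \<alpha> (of_real_fun f))"
          using s(2) that F by (intro \<Psi>.mono) (auto simp: fF intro!: Max_ge)
        then show ?thesis using \<alpha>.dilates_eq[OF dil s(1)] by simp
      qed
      then show "h \<alpha> \<le> Re (\<Psi> \<alpha> (of_real_fun f))"
        unfolding h_def using F by (subst Max_le_iff) auto
    qed
  qed
  also have "\<dots> = Re (state_of \<nu> (of_real_fun f))"
    using integral_Re[OF int_\<Psi>] by (simp add: \<Psi>(4))
  also have "\<dots> = (\<integral>x. apply_bcontfun f x \<partial>\<nu>)" by (simp add: \<nu>.state_of_of_real_fun)
  also have "(\<integral>\<alpha>. h \<alpha> \<partial>completion m) = (\<integral>\<alpha>. h \<alpha> \<partial>m)" by (rule integral_completion[OF h_meas])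
  also have "\<dots> = (\<integral>x. h (\<delta> x) \<partial>\<mu>)" unfolding m_def by (rule integral_distr[OF \<delta>_meas h_meas'])
  also have "\<dots> = (\<integral>x. apply_bcontfun f x \<partial>\<mu>)" by (simp add: h_def \<delta>_def fF)
  finally show ?thesis .
qed

text \<open>The inequality of integrals is stable under sums, nonnegative multiples and uniform
  limits, so it passes from the generators to the closed cone.\<close>

lemma choquet_leI:
  assumes "borel_prob \<mu>" "borel_prob \<nu>"
    and le: "\<And>f. f \<in> maxima S \<Longrightarrow> (\<integral>x. apply_bcontfun f x \<partial>\<mu>) \<le> (\<integral>x. apply_bcontfun f x \<partial>\<nu>)"
  shows "choquet_le S \<mu> \<nu>"
proof -
  interpret \<mu>: borel_prob \<mu> by fact
  interpret \<nu>: borel_prob \<nu> by fact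
  have cont: "continuous_on UNIV (\<lambda>f :: 'a \<Rightarrow>\<^sub>C real. \<integral>x. apply_bcontfun f x \<partial>\<rho>)" if "borel_prob \<rho>" for \<rho>
  proof -
    interpret borel_prob \<rho> by fact
    have "bounded_linear (\<lambda>f :: 'a \<Rightarrow>\<^sub>C real. \<integral>x. apply_bcontfun f x \<partial>\<rho>)"
    proof (rule bounded_linear_intro[where K = 1])
      fix f :: "'a \<Rightarrow>\<^sub>C real"
      have "norm (\<integral>x. apply_bcontfun f x \<partial>\<rho>) \<le> (\<integral>x. norm (apply_bcontfun f x) \<partial>\<rho>)"
        by (rule integral_norm_bound)
      also have "\<dots> \<le> (\<integral>x. norm f \<partial>\<rho>)"
        using norm_bounded[of f] by (intro integral_mono integrable_norm integrable_bcontfun) auto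
      finally show "norm (\<integral>x. apply_bcontfun f x \<partial>\<rho>) \<le> norm f * 1" by (simp add: prob_space)
    qed (simp_all add: integral_linear)
    then show ?thesis by (rule linear_continuous_on)
  qed
  let ?C = "{f :: 'a \<Rightarrow>\<^sub>C real. (\<integral>x. apply_bcontfun f x \<partial>\<mu>) \<le> (\<integral>x. apply_bcontfun f x \<partial>\<nu>)}"
  have "f + g \<in> ?C" if "f \<in> ?C" "g \<in> ?C" for f g
    using that unfolding mem_Collect_eq \<mu>.integral_linear \<nu>.integral_linear by (intro add_mono)
  moreover have "c *\<^sub>R f \<in> ?C" if "f \<in> ?C" "0 \<le> c" for f c
    using that unfolding mem_Collect_eq \<mu>.integral_linear \<nu>.integral_linear by (intro scaleR_left_mono)
  ultimately have "convex_cone ?C"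
    unfolding convex_cone_iff by simp
  then have "convex_cone hull maxima S \<subseteq> ?C" using le by (intro hull_minimal) auto
  moreover have "closed ?C"
    using assms by (intro closed_Collect_le cont)
  ultimately have "choquet_cone S \<subseteq> ?C" unfolding choquet_cone_def by (rule closure_minimal)
  then show ?thesis unfolding choquet_le_def by blast
qed

theorem theoremC:
  fixes S :: "('a::t2_space \<Rightarrow>\<^sub>C complex) set"
    and \<mu> \<nu> :: "'a measure"
  assumes "compact (UNIV :: 'a set)"
    and "metrizable_space (euclidean :: 'a topology)"
    and "function_system S"
    and "separates_points S"
    and "prob_space \<mu>" and "sets \<mu> = sets borel"
    and "prob_space \<nu>" and "sets \<nu> = sets borel"
  shows "(choquet_le S \<mu> \<nu> \<longleftrightarrow> strong_dilation_le S (state_of \<mu>) (state_of \<nu>)) \<and>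
         (strong_dilation_le S (state_of \<mu>) (state_of \<nu>) \<longleftrightarrow> isd_le S (state_of \<mu>) (state_of \<nu>))"
proof -
  have borel: "borel_prob \<mu>" "borel_prob \<nu>"
    using assms by (auto simp: borel_prob_def borel_prob_axioms_def)
  interpret \<mu>: borel_prob \<mu> by (rule borel)
  interpret \<nu>: borel_prob \<nu> by (rule borel)
  have "strong_dilation_le S (state_of \<mu>) (state_of \<nu>) \<and> isd_le S (state_of \<mu>) (state_of \<nu>)"
    if choquet: "choquet_le S \<mu> \<nu>"
  proof -
    have "maxima S \<subseteq> choquet_cone S"
      unfolding choquet_cone_def by (meson closure_subset hull_subset order_trans)
    then interpret choquet_pair \<mu> \<nu> S
      using choquet assms by unfold_locales (auto simp: choquet_le_def)
    obtain L where L: "L \<in> state_space" "\<And>c s. s \<in> S \<Longrightarrow> L (tensor c s) = state_of \<mu> (c * s)"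
      "\<And>f. L (tensor 1 f) = state_of \<nu> f" by (rule coupling) blast
    obtain Z and p :: "nat \<Rightarrow> 'a \<Rightarrow> 'a \<Rightarrow>\<^sub>C real" where "fine_partitions Z p"
      by (rule fine_partitions_exist[OF assms(1,2)])
    then interpret fine_partitions Z p .
    interpret averaged_coupling \<mu> \<nu> S Z p L by unfold_locales (rule L; assumption)+
    show ?thesis using strong isd by blast
  qed
  moreover have "choquet_le S \<mu> \<nu>" if "strong_dilation_le S (state_of \<mu>) (state_of \<nu>)"
  proof (rule choquet_leI[OF borel])
    fix f assume "f \<in> maxima S"
    from \<mu>.strong_dilation_maxima[OF that this]
    show "(\<integral>x. apply_bcontfun f x \<partial>\<mu>) \<le> (\<integral>x. apply_bcontfun f x \<partial>\<nu>)"
      by (simp add: \<mu>.state_of_of_real_fun \<nu>.state_of_of_real_fun)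
  qed
  moreover have "choquet_le S \<mu> \<nu>" if "isd_le S (state_of \<mu>) (state_of \<nu>)"
    using isd_maxima[OF borel that] by (rule choquet_leI[OF borel])
  ultimately show ?thesis by blast
qed

end
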